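(* (Log-binomial scenario.) Let $N\ge1$ be an integer and $0<p<1$, and let $X$ be the stationary birth–death process on $\{0,1,\dots,N\}$ with rates $\lambda_n=(N-n)p$, $\mu_n=n(1-p)$, whose marginal law is binomial $\mathrm{Bin}(N,p)$. Let $c_X=N\log(p(e-1)+1)$ and mother process $\Lambda(t)=\exp\{X(t)-c_X\}$; let $A_n,A,T$ be as in the context. Then for any $$b>\frac{(p(e^2-1)+1)^N}{(p(e-1)+1)^{2N}},$$ $A_n(t)$ converges in $L_2$ to a process $A(t)$, $t\in[0,1]$, such that, if $A(1)\in L_q$ for $q\in(0,\infty)$, $$\mathbb{E}A^q(t)\sim t^{K(q)},\qquad K(q)=q\Big(1+\frac{c_X}{\log b}\Big)-\frac{N}{\log b}\log\big(p(e^q-1)+1\big),$$ and the Rényi function is $T(q)=K(q)-1$.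
   Context: Given a stationary process $X$, a constant $c_X$ and a scaling parameter $b>1$, let $X^{(j)}$, $j\ge0$, be independent copies of $X$, $\Lambda^{(j)}(t)=\exp\{X^{(j)}(t)-c_X\}$, and $A_n(t)=\int_0^t\prod_{j=0}^n\Lambda^{(j)}(sb^j)\,ds$, $t\in[0,1]$. Let $\mu_n(B)=\int_B\prod_{j=0}^n\Lambda^{(j)}(sb^j)ds$ and $\mu$ its almost-sure weak limit. The Rényi function is $T(q)=\liminf_{n\to\infty}(-\tfrac1n)\log_2\mathbb{E}\sum_{k=0}^{2^n-1}\mu^q([k2^{-n},(k+1)2^{-n}])$. $\mathbb{E}A^q(t)\sim t^{K(q)}$ means there are constants $0<\underline C\le\overline C<\infty$ with $\underline C t^{K(q)}\le\mathbb{E}A^q(t)\le\overline C t^{K(q)}$ for all $t\in[0,1]$. *)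

theory Defs
  imports "HOL-Probability.Probability"
begin

definition bd_gen :: "nat \<Rightarrow> real \<Rightarrow> nat \<Rightarrow> nat \<Rightarrow> real" where
  "bd_gen N p i k =
     (if i \<le> N \<and> k \<le> N then
        (if k = Suc i then real (N - i) * p
         else if i = Suc k then real i * (1 - p)
         else if i = k then - (real (N - i) * p + real i * (1 - p))
         else 0)
      else 0)"

fun mat_pow :: "nat \<Rightarrow> (nat \<Rightarrow> nat \<Rightarrow> real) \<Rightarrow> nat \<Rightarrow> nat \<Rightarrow> nat \<Rightarrow> real" where
  "mat_pow N Q 0 = (\<lambda>i k. if i = k then 1 else 0)"
| "mat_pow N Q (Suc m) = (\<lambda>i k. \<Sum>l\<le>N. mat_pow N Q m i l * Q l k)"

definition bd_trans :: "nat \<Rightarrow> real \<Rightarrow> real \<Rightarrow> nat \<Rightarrow> nat \<Rightarrow> real" where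
  "bd_trans N p t i k = (\<Sum>m. t ^ m / fact m * mat_pow N (bd_gen N p) m i k)"

definition binom_pi :: "nat \<Rightarrow> real \<Rightarrow> nat \<Rightarrow> real" where
  "binom_pi N p i = (if i \<le> N then real (N choose i) * p ^ i * (1 - p) ^ (N - i) else 0)"

definition stationary_bd_process ::
  "nat \<Rightarrow> real \<Rightarrow> 'w measure \<Rightarrow> (real \<Rightarrow> 'w \<Rightarrow> nat) \<Rightarrow> bool" where
  "stationary_bd_process N p M Y \<longleftrightarrow>
     (\<forall>t\<ge>0. Y t \<in> measurable M (count_space UNIV)) \<and>
     (\<forall>(k::nat) (ts::nat \<Rightarrow> real) (st::nat \<Rightarrow> nat).
        0 \<le> ts 0 \<and> (\<forall>m<k. ts m \<le> ts (Suc m)) \<longrightarrow>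
        measure M {\<omega> \<in> space M. \<forall>m\<le>k. Y (ts m) \<omega> = st m} =
          binom_pi N p (st 0) *
          (\<Prod>m<k. bd_trans N p (ts (Suc m) - ts m) (st m) (st (Suc m))))"

definition mf_density ::
  "real \<Rightarrow> (nat \<Rightarrow> real \<Rightarrow> 'w \<Rightarrow> nat) \<Rightarrow> real \<Rightarrow> nat \<Rightarrow> real \<Rightarrow> 'w \<Rightarrow> real" where
  "mf_density c X b n s \<omega> = (\<Prod>j\<le>n. exp (real (X j (s * b ^ j) \<omega>) - c))"

definition A_n ::
  "real \<Rightarrow> (nat \<Rightarrow> real \<Rightarrow> 'w \<Rightarrow> nat) \<Rightarrow> real \<Rightarrow> nat \<Rightarrow> real \<Rightarrow> 'w \<Rightarrow> real" where
  "A_n c X b n t \<omega> = (\<integral>s. indicator {0..t} s * mf_density c X b n s \<omega> \<partial>lborel)"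

definition is_as_weak_limit ::
  "'w measure \<Rightarrow> real \<Rightarrow> (nat \<Rightarrow> real \<Rightarrow> 'w \<Rightarrow> nat) \<Rightarrow> real \<Rightarrow> ('w \<Rightarrow> real measure) \<Rightarrow> bool" where
  "is_as_weak_limit M c X b mu \<longleftrightarrow>
     (\<forall>\<omega>. finite_measure (mu \<omega>) \<and> sets (mu \<omega>) = sets borel \<and>
           emeasure (mu \<omega>) (- {0..1}) = 0) \<and>
     (\<forall>a b'. (\<lambda>\<omega>. measure (mu \<omega>) {a..b'}) \<in> borel_measurable M) \<and>
     (AE \<omega> in M. \<forall>f. continuous_on {0..1} f \<longrightarrow>
        (\<lambda>n. \<integral>s. indicator {0..1} s * f s * mf_density c X b n s \<omega> \<partial>lborel)
          \<longlonglongrightarrow> (\<integral>s. indicator {0..1} s * f s \<partial>mu \<omega>))"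

definition renyi_T :: "'w measure \<Rightarrow> ('w \<Rightarrow> real measure) \<Rightarrow> real \<Rightarrow> ereal" where
  "renyi_T M mu q = liminf (\<lambda>n::nat. ereal (- (1 / real n) * log 2
      (\<integral>\<omega>. (\<Sum>k<2^n. measure (mu \<omega>) {real k / 2^n .. real (Suc k) / 2^n} powr q) \<partial>M)))"

end

theory Submission
  imports Defs "HOL-Computational_Algebra.Polynomial"
begin

text \<open>
  The generating polynomials \<open>(1 + (1 - p) z)\<^sup>k (1 - p z)\<^sup>N\<^sup>-\<^sup>k\<close> diagonalise the generator, with
  eigenvalues \<open>0, -1, \<dots>, -N\<close>; hence the covariance of \<open>exp X\<close> decays exponentially.
  As the increments of the martingale \<open>A\<^sub>n\<close> have second moment at most a constant times
  \<open>(E \<Lambda>\<^sup>2 / b)\<^sup>n\<close>, it converges in \<open>L\<^sub>2\<close> and almost surely.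

  Splitting off the first layer, \<open>A(t / b)\<close> has the law of \<open>b\<^sup>-\<^sup>1 \<integral> \<Lambda>(s / b) dA'(s)\<close> over \<open>[0, t]\<close> with \<open>A'\<close> a
  copy of \<open>A\<close> independent of \<open>\<Lambda>\<close>. Since \<open>\<Lambda>\<close> is constant on \<open>[0, t / b]\<close> with probability \<open>1 - O(t / b)\<close>,
  this gives \<open>E A(t / b)\<^sup>q = b\<^sup>-\<^sup>q E \<Lambda>\<^sup>q (1 + O(t / b)) E A(t)\<^sup>q\<close>; the error factors have a convergent product
  along \<open>t = b\<^sup>-\<^sup>n\<close>, which yields \<open>E A(t)\<^sup>q \<sim> t\<^sup>K\<^sup>(\<^sup>q\<^sup>)\<close>. The mass a weak limit gives to a dyadic interval is
  squeezed between increments of \<open>A\<close> over comparable intervals, and by stationarity the latter have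
  the moments of \<open>A(t)\<close>.
\<close>

section \<open>The binomial birth-death process\<close>

text \<open>The hypotheses give finite-dimensional laws and joint measurability only; nothing is
  known about the regularity of paths. Hence "constant on an interval" is always tested on a finite
  grid, and the error of freezing the first layer must not grow when the grid is refined. It does
  not, because the probability of a change between two times is linear in their distance, so that
  the sum over a grid depends on the length of the interval alone. Truncation does not commute with
  multiplication by the random factor \<open>\<Lambda> / b\<close>. The deterministic bounds
  \<open>lo\<close> and \<open>hi\<close> of \<open>\<Lambda>\<close> replace the missing identity
  by two inequalities whose truncation levels differ; as the levels are arbitrary, the discrepancy
  disappears once they are sent to infinity. The hypothesis on \<open>b\<close> says that the second
  moment of \<open>\<Lambda>\<close> is less than \<open>b\<close>. As \<open>\<Lambda>\<close> has
  mean 1, this also forces \<open>b > 1\<close>. The exponent may have either sign, so every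
  comparison between nearby scales is made with its absolute value.\<close>

lemma bd_gen_abs_le:
  assumes "0 \<le> p" "p \<le> 1"
  shows "\<bar>bd_gen N p i k\<bar> \<le> real N"
proof -
  \<comment> \<open>Both jump rates and the total exit rate have this form, with \<open>a\<close>
    empty and \<open>c\<close> occupied sites or fewer.\<close>
  have *: "real a * p + real c * (1 - p) \<le> real N" if "a + c \<le> N" for a c
  proof -
    have "real a * p + real c * (1 - p) \<le> real (a + c) * p + real (a + c) * (1 - p)"
      using assms by (intro add_mono mult_right_mono) auto
    also have "\<dots> = real (a + c)" by (simp add: algebra_simps)
    finally show ?thesis using that by linarith
  qed
  have "0 \<le> real (N - i) * p" "0 \<le> real i * (1 - p)" using assms by auto
  moreover have "real i * (1 - p) \<le> real N" if "i \<le> N" using *[of 0 i] that by simp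
  moreover have "real (N - i) * p \<le> real N" using *[of "N-i" 0] by simp
  moreover have "real (N - i) * p + real i * (1 - p) \<le> real N" if "i \<le> N"
    using that by (intro *) simp
  ultimately show ?thesis unfolding bd_gen_def abs_le_iff by (auto simp del: of_nat_diff)
qed

lemma mat_pow_abs_le:
  assumes "\<And>i k. \<bar>Q i k\<bar> \<le> C"
  shows "\<bar>mat_pow N Q m i k\<bar> \<le> (real (Suc N) * C) ^ m"
proof (induction m arbitrary: k)
  case (Suc m)
  have "0 \<le> C" using assms[of 0 0] by linarith
  have "\<bar>mat_pow N Q (Suc m) i k\<bar> \<le> (\<Sum>l\<le>N. \<bar>mat_pow N Q m i l * Q l k\<bar>)"
    by simp
  also have "\<dots> \<le> (\<Sum>l\<le>N. (real (Suc N) * C) ^ m * C)"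
    unfolding abs_mult using Suc.IH assms \<open>0 \<le> C\<close> by (intro sum_mono mult_mono) auto
  also have "\<dots> = (real (Suc N) * C) ^ Suc m" by (simp add: algebra_simps)
  finally show ?case .
qed auto

lemma bd_trans_summable:
  assumes "0 \<le> p" "p \<le> 1"
  shows "summable (\<lambda>m. t ^ m / fact m * mat_pow N (bd_gen N p) m i k)"
proof (rule summable_comparison_test')
  show "summable (\<lambda>m. (\<bar>t\<bar> * (real (Suc N) * real N)) ^ m / fact m)"
    using summable_exp[of "\<bar>t\<bar> * (real (Suc N) * real N)"] by (simp add: field_simps)
  fix m :: nat
  have "norm (t ^ m / fact m * mat_pow N (bd_gen N p) m i k)
      \<le> \<bar>t\<bar> ^ m / fact m * (real (Suc N) * real N) ^ m"
    unfolding norm_mult using mat_pow_abs_le[OF bd_gen_abs_le[OF assms]]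
    by (intro mult_mono) (auto simp: power_abs)
  then show "norm (t ^ m / fact m * mat_pow N (bd_gen N p) m i k)
      \<le> (\<bar>t\<bar> * (real (Suc N) * real N)) ^ m / fact m"
    by (simp add: power_mult_distrib)
qed

text \<open>The zeroth term of the series is 1 and the others are dominated by those of
  \<open>exp (t * C)\<close>, so the loss is at most \<open>exp (t * C) - 1\<close>. The restriction
  \<open>t \<le> 1\<close> only serves to make the factor \<open>exp (t * C)\<close>
  uniform.\<close>

lemma bd_trans_diag_lower:
  fixes N :: nat and p t :: real
  assumes "0 \<le> p" "p \<le> 1" "0 \<le> t" "t \<le> 1"
  defines "C \<equiv> real (Suc N) * real N"
  shows "1 - bd_trans N p t i i \<le> C * exp C * t"
proof -
  define f where "f = (\<lambda>m. t ^ m / fact m * mat_pow N (bd_gen N p) m i i)"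
  define g where "g = (\<lambda>m. (t * C) ^ m / fact m)"
  have C0: "0 \<le> C" by (simp add: C_def)
  have fs: "summable f" using bd_trans_summable[OF assms(1,2)] by (simp add: f_def)
  have gs: "summable g" using summable_exp[of "t * C"] by (simp add: g_def field_simps)
  have b: "\<bar>f m\<bar> \<le> g m" for m
  proof -
    have "\<bar>f m\<bar> = t ^ m / fact m * \<bar>mat_pow N (bd_gen N p) m i i\<bar>"
      using assms by (simp add: f_def abs_mult)
    also have "\<dots> \<le> t ^ m / fact m * C ^ m"
      unfolding C_def using mat_pow_abs_le[OF bd_gen_abs_le[OF assms(1,2)]] assms
      by (intro mult_left_mono) auto
    finally show ?thesis by (simp add: g_def power_mult_distrib)
  qed
  have gsum: "(\<Sum>m. g m) = exp (t * C)"
    unfolding exp_def g_def by (simp add: divide_inverse mult.commute)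
  have f0: "f 0 = 1" and g0: "g 0 = 1" by (simp_all add: f_def g_def)
  have "bd_trans N p t i i = (\<Sum>m. f m)" by (simp add: bd_trans_def f_def)
  also have "\<dots> = 1 + (\<Sum>m. f (Suc m))" using suminf_split_head[OF fs] f0 by simp
  finally have 1: "bd_trans N p t i i = 1 + (\<Sum>m. f (Suc m))" .
  have "- (\<Sum>m. f (Suc m)) \<le> (\<Sum>m. g (Suc m))"
  proof -
    have fs': "summable (\<lambda>m. f (Suc m))" and gs': "summable (\<lambda>m. g (Suc m))"
      using fs gs summable_Suc_iff by blast+
    have "(\<Sum>m. - f (Suc m)) \<le> (\<Sum>m. g (Suc m))"
      by (intro suminf_le summable_minus fs' gs') (use b abs_le_iff in blast)
    then show ?thesis by (simp add: suminf_minus[OF fs'])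
  qed
  also have "(\<Sum>m. g (Suc m)) = exp (t * C) - 1" using suminf_split_head[OF gs] g0 gsum by simp
  also have "\<dots> \<le> t * C * exp (t * C)"
  proof -
    have "1 - t * C \<le> exp (- (t * C))" using exp_ge_add_one_self[of "-(t*C)"] by simp
    then have "(1 - t * C) * exp (t * C) \<le> exp (- (t * C)) * exp (t * C)"
      by (intro mult_right_mono) auto
    then show ?thesis by (simp add: algebra_simps flip: exp_add)
  qed
  also have "\<dots> \<le> t * C * exp C"
    using assms C0 by (intro mult_left_mono) (auto intro: mult_left_le_one_le)
  finally show ?thesis using 1 by (simp add: algebra_simps)
qed

section \<open>Krawtchouk polynomials as eigenvectors\<close>

lemma bd_trans_eigenvector:
  assumes p: "0 \<le> p" "p \<le> 1" and i: "i \<le> N"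
    and eig: "\<And>i. i \<le> N \<Longrightarrow> (\<Sum>k\<le>N. bd_gen N p i k * \<phi> k) = \<theta> * \<phi> i"
  shows "(\<Sum>k\<le>N. bd_trans N p t i k * \<phi> k) = exp (\<theta> * t) * \<phi> i"
proof -
  have mp: "(\<Sum>k\<le>N. mat_pow N (bd_gen N p) m i k * \<phi> k) = \<theta> ^ m * \<phi> i" for m
  proof (induction m)
    case 0
    have "(\<Sum>k\<le>N. (if i = k then 1 else 0) * \<phi> k) = (\<Sum>k\<le>N. if i = k then \<phi> k else 0)"
      by (intro sum.cong) auto
    then show ?case using i by (simp add: sum.delta)
  next
    case (Suc m)
    have "(\<Sum>k\<le>N. mat_pow N (bd_gen N p) (Suc m) i k * \<phi> k)
        = (\<Sum>k\<le>N. \<Sum>l\<le>N. mat_pow N (bd_gen N p) m i l * (bd_gen N p l k * \<phi> k))"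
      by (simp add: sum_distrib_right mult.assoc)
    also have "\<dots> = (\<Sum>l\<le>N. mat_pow N (bd_gen N p) m i l * (\<Sum>k\<le>N. bd_gen N p l k * \<phi> k))"
      by (subst sum.swap) (simp add: sum_distrib_left)
    also have "\<dots> = \<theta> * (\<Sum>l\<le>N. mat_pow N (bd_gen N p) m i l * \<phi> l)"
      using eig by (simp add: sum_distrib_left mult.left_commute)
    finally show ?case using Suc by (simp add: mult.assoc)
  qed
  have "(\<lambda>m. t ^ m / fact m * mat_pow N (bd_gen N p) m i k) sums bd_trans N p t i k" for k
    unfolding bd_trans_def by (rule summable_sums[OF bd_trans_summable[OF p]])
  then have 1: "(\<lambda>m. \<Sum>k\<le>N. t ^ m / fact m * mat_pow N (bd_gen N p) m i k * \<phi> k)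
      sums (\<Sum>k\<le>N. bd_trans N p t i k * \<phi> k)"
    by (intro sums_sum sums_mult2)
  have 2: "(\<lambda>m. \<Sum>k\<le>N. t ^ m / fact m * mat_pow N (bd_gen N p) m i k * \<phi> k)
      = (\<lambda>m. (\<theta> * t) ^ m /\<^sub>R fact m * \<phi> i)"
    using mp by (auto simp: mult.assoc power_mult_distrib divide_inverse simp flip: sum_distrib_left)
  have 3: "(\<lambda>m. (\<theta> * t) ^ m /\<^sub>R fact m * \<phi> i) sums (exp (\<theta> * t) * \<phi> i)"
    by (intro sums_mult2 exp_converges)
  show ?thesis by (rule sums_unique2[OF 1[unfolded 2] 3])
qed

text \<open>The generating function of the Krawtchouk polynomials: the coefficient of degree m, as a
  function of the state \<open>k\<close>, is up to normalisation the m-th orthogonal polynomial of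
  the binomial law. Working with the generating function treats all eigenvectors at once.\<close>

definition krawtchouk :: "nat \<Rightarrow> real \<Rightarrow> nat \<Rightarrow> real poly" where
  "krawtchouk N p k = [:1, 1 - p:] ^ k * [:1, - p:] ^ (N - k)"

text \<open>The generator as a difference operator. No boundary cases remain: at
  \<open>i = N\<close> the neighbour \<open>Suc i\<close> leaves the state space but carries rate 0,
  and at \<open>i = 0\<close> the truncated \<open>i - 1\<close> is \<open>i\<close> itself, again
  with rate 0.\<close>

lemma sum_bd_gen:
  fixes g :: "nat \<Rightarrow> real"
  assumes "i \<le> N"
  shows "(\<Sum>k\<le>N. bd_gen N p i k * g k) =
    (real (N - i) * p) * (g (Suc i) - g i) + (real i * (1 - p)) * (g (i - 1) - g i)"
proof -
  define a where "a = real (N - i) * p"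
  define c where "c = real i * (1 - p)"
  have "bd_gen N p i k * g k = (if k = Suc i then a * g (Suc i) else 0)
      + (if k = i - 1 then c * g (i - 1) else 0) - (if k = i then (a + c) * g i else 0)"
    if "k \<le> N" for k
  proof -
    consider "k = Suc i" | "k = i" | "i = Suc k" | "k \<noteq> Suc i" "k \<noteq> i" "i \<noteq> Suc k" by blast
    then show ?thesis
    proof cases
      case 2
      then show ?thesis using that by (cases i) (auto simp: bd_gen_def a_def c_def algebra_simps)
    qed (use that assms in \<open>auto simp: bd_gen_def a_def c_def\<close>)
  qed
  then have "(\<Sum>k\<le>N. bd_gen N p i k * g k)
     = (\<Sum>k\<le>N. (if k = Suc i then a * g (Suc i) else 0))
      + (\<Sum>k\<le>N. (if k = i - 1 then c * g (i - 1) else 0))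
      - (\<Sum>k\<le>N. (if k = i then (a + c) * g i else 0))"
    by (simp add: sum.distrib sum_subtractf)
  also have "(\<Sum>k\<le>N. (if k = Suc i then a * g (Suc i) else 0)) = a * g (Suc i)"
    using assms by (cases "i = N") (auto simp: a_def)
  also have "(\<Sum>k\<le>N. (if k = i - 1 then c * g (i - 1) else 0)) = c * g (i - 1)"
    using assms by simp
  also have "(\<Sum>k\<le>N. (if k = i then (a + c) * g i else 0)) = (a + c) * g i"
    using assms by simp
  finally show ?thesis by (simp add: a_def c_def algebra_simps)
qed

text \<open>On generating functions the generator is the operator -z d/dz. With u = 1 + (1 - p) z
  and v = 1 - p z one has u - v = z, so each jump contributes a factor z or -z, and the jump rates
  are exactly the factors produced by differentiating the powers of u and v.\<close>

lemma bd_gen_krawtchouk: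
  assumes i: "i \<le> N"
  shows "(\<Sum>k\<le>N. smult (bd_gen N p i k) (krawtchouk N p k)) = - pCons 0 (pderiv (krawtchouk N p i))"
proof -
  have "poly (\<Sum>k\<le>N. smult (bd_gen N p i k) (krawtchouk N p k)) z
      = poly (- pCons 0 (pderiv (krawtchouk N p i))) z" for z
  proof -
    define u v where "u = 1 + (1 - p) * z" and "v = 1 - p * z"
    have uv: "u - v = z" by (simp add: u_def v_def algebra_simps)
    have G: "poly (krawtchouk N p k) z = u ^ k * v ^ (N - k)" for k
      by (simp add: krawtchouk_def u_def v_def poly_power mult.commute)
    have dG: "poly (pderiv (krawtchouk N p i)) z
        = real i * (1 - p) * u ^ (i - 1) * v ^ (N - i) - real (N - i) * p * u ^ i * v ^ (N - i - 1)"
      by (simp add: krawtchouk_def u_def v_def poly_power pderiv_mult pderiv_power pderiv_pCons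
          algebra_simps)
    have 1: "real (N - i) * p * (u ^ Suc i * v ^ (N - Suc i) - u ^ i * v ^ (N - i))
        = z * (real (N - i) * p * u ^ i * v ^ (N - i - 1))"
    proof (cases "i = N")
      case False
      then have "N - i = Suc (N - i - 1)" using i by simp
      then have "v ^ (N - i) = v * v ^ (N - i - 1)" by (metis power_Suc)
      then show ?thesis by (simp add: uv[symmetric] algebra_simps)
    qed auto
    have 2: "real i * (1 - p) * (u ^ (i - 1) * v ^ (N - (i - 1)) - u ^ i * v ^ (N - i))
        = - z * (real i * (1 - p) * u ^ (i - 1) * v ^ (N - i))"
    proof (cases i)
      case (Suc j)
      then have "N - (i - 1) = Suc (N - i)" using i by simp
      then show ?thesis using Suc by (simp add: uv[symmetric] algebra_simps)
    qed auto
    have "poly (\<Sum>k\<le>N. smult (bd_gen N p i k) (krawtchouk N p k)) z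
        = (\<Sum>k\<le>N. bd_gen N p i k * (u ^ k * v ^ (N - k)))"
      by (simp add: poly_sum G)
    also have "\<dots> = - z * poly (pderiv (krawtchouk N p i)) z"
      unfolding sum_bd_gen[OF i] 1 2 dG by (simp add: algebra_simps)
    finally show ?thesis by simp
  qed
  then show ?thesis by (intro poly_eq_poly_eq_iff[THEN iffD1] ext)
qed

lemma bd_trans_krawtchouk:
  assumes p: "0 \<le> p" "p \<le> 1" and i: "i \<le> N"
  shows "(\<Sum>k\<le>N. bd_trans N p t i k * coeff (krawtchouk N p k) m)
     = exp (- real m * t) * coeff (krawtchouk N p i) m"
proof (rule bd_trans_eigenvector[OF p i])
  fix i assume "i \<le> N"
  \<comment> \<open>The operator -z d/dz multiplies the coefficient of degree m by -m, which is the
    eigenvalue.\<close>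
  from arg_cong[OF bd_gen_krawtchouk[OF this, of p], of "\<lambda>P. coeff P m"]
  show "(\<Sum>k\<le>N. bd_gen N p i k * coeff (krawtchouk N p k) m) = - real m * coeff (krawtchouk N p i) m"
    by (cases m) (simp_all add: coeff_sum coeff_pderiv algebra_simps)
qed

lemma degree_krawtchouk:
  assumes "k \<le> N"
  shows "degree (krawtchouk N p k) \<le> N"
proof -
  have "degree (krawtchouk N p k) \<le> degree ([:1, 1 - p:] ^ k) + degree ([:1, - p:] ^ (N - k))"
    unfolding krawtchouk_def by (rule degree_mult_le)
  also have "\<dots> \<le> degree [:1, 1 - p:] * k + degree [:1, - p:] * (N - k)"
    by (intro add_mono degree_power_le)
  also have "\<dots> \<le> 1 * k + 1 * (N - k)"
    by (intro add_mono mult_right_mono) auto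
  finally show ?thesis using assms by simp
qed

text \<open>The parameter \<open>z\<close> is chosen so that \<open>(1 + (1 - p) z) / (1 - p z) = exp 1\<close>,
  which makes \<open>exp k\<close> proportional to the generating polynomial \<open>krawtchouk N p k\<close> at \<open>z\<close>.\<close>

lemma bd_trans_exp:
  fixes N :: nat and p t :: real
  assumes p: "0 < p" "p < 1" and i: "i \<le> N"
  defines "r \<equiv> p * (exp 1 - 1) + 1"
  defines "z \<equiv> (exp 1 - 1) / r"
  shows "(\<Sum>k\<le>N. bd_trans N p t i k * exp (real k))
     = r ^ N * (\<Sum>m\<le>N. z ^ m * exp (- real m * t) * coeff (krawtchouk N p i) m)"
proof -
  have r: "r > 0" using p by (simp add: r_def add_pos_pos)
  have v: "1 - p * z = 1 / r" using r by (simp add: z_def field_simps r_def)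
  have u: "1 + (1 - p) * z = exp 1 / r" using r by (simp add: z_def field_simps r_def)
  have G: "exp (real k) = r ^ N * poly (krawtchouk N p k) z" if "k \<le> N" for k
  proof -
    have "poly (krawtchouk N p k) z = (exp 1 / r) ^ k * (1 / r) ^ (N - k)"
      using u v by (simp add: krawtchouk_def poly_power mult.commute)
    also have "\<dots> = exp (real k) / r ^ N"
      using that by (simp add: power_divide exp_of_nat_mult[symmetric] flip: power_add)
    finally show ?thesis using r by simp
  qed
  have P: "poly (krawtchouk N p k) z = (\<Sum>m\<le>N. coeff (krawtchouk N p k) m * z ^ m)" if "k \<le> N" for k
    by (subst poly_as_sum_of_monoms'[OF degree_krawtchouk[OF that], symmetric])
      (simp add: poly_sum poly_monom)
  have "(\<Sum>k\<le>N. bd_trans N p t i k * exp (real k))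
     = (\<Sum>k\<le>N. \<Sum>m\<le>N. r ^ N * (z ^ m * (bd_trans N p t i k * coeff (krawtchouk N p k) m)))"
    using G P by (intro sum.cong) (auto simp: sum_distrib_left ac_simps)
  also have "\<dots> = r ^ N * (\<Sum>m\<le>N. z ^ m * (\<Sum>k\<le>N. bd_trans N p t i k * coeff (krawtchouk N p k) m))"
    by (subst sum.swap) (simp add: sum_distrib_left)
  finally show ?thesis using p i by (simp add: bd_trans_krawtchouk mult.assoc)
qed

lemma coeff_krawtchouk_0: "coeff (krawtchouk N p k) 0 = 1"
  by (simp add: krawtchouk_def coeff_mult_0 coeff_0_power)

text \<open>The moment generating function of the binomial law. The case \<open>q = 0\<close> is
  used repeatedly for the total mass 1, the case \<open>q = 1\<close> for the mean of
  \<open>exp X\<close>.\<close>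

lemma sum_binom_pi_exp: "(\<Sum>i\<le>N. binom_pi N p i * exp (q * real i)) = (p * (exp q - 1) + 1) ^ N"
proof -
  have "(\<Sum>i\<le>N. binom_pi N p i * exp (q * real i))
      = (\<Sum>i\<le>N. real (N choose i) * (p * exp q) ^ i * (1 - p) ^ (N - i))"
    by (intro sum.cong)
      (auto simp: binom_pi_def power_mult_distrib exp_of_nat_mult[symmetric] mult.commute)
  also have "\<dots> = (p * exp q + (1 - p)) ^ N" by (simp add: binomial_ring)
  finally show ?thesis by (simp add: algebra_simps)
qed

lemma binom_pi_nonneg: "0 \<le> p \<Longrightarrow> p \<le> 1 \<Longrightarrow> 0 \<le> binom_pi N p i"
  by (simp add: binom_pi_def)

section \<open>Laws of the stationary process at finitely many times\<close>

locale bd_process = prob_space M for M :: "'w measure" +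
  fixes N :: nat and p :: real and Y :: "real \<Rightarrow> 'w \<Rightarrow> nat"
  assumes p: "0 < p" "p < 1" and process: "stationary_bd_process N p M Y"
begin

lemma measurable_state [measurable]: "0 \<le> t \<Longrightarrow> Y t \<in> M \<rightarrow>\<^sub>M count_space UNIV"
  using process by (simp add: stationary_bd_process_def)

lemma prob_path:
  assumes "0 \<le> ts 0" "\<And>m. m < k \<Longrightarrow> ts m \<le> ts (Suc m)"
  shows "prob {\<omega> \<in> space M. \<forall>m\<le>k. Y (ts m) \<omega> = st m}
    = binom_pi N p (st 0) * (\<Prod>m<k. bd_trans N p (ts (Suc m) - ts m) (st m) (st (Suc m)))"
  using process assms by (auto simp: stationary_bd_process_def)

lemma prob_state: "0 \<le> t \<Longrightarrow> prob {\<omega> \<in> space M. Y t \<omega> = i} = binom_pi N p i"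
  using prob_path[of "\<lambda>_. t" 0 "\<lambda>_. i"] by simp

lemma prob_two_states:
  assumes "0 \<le> s" "s \<le> t"
  shows "prob {\<omega> \<in> space M. Y s \<omega> = i \<and> Y t \<omega> = k} = binom_pi N p i * bd_trans N p (t - s) i k"
proof -
  have "{\<omega> \<in> space M. Y s \<omega> = i \<and> Y t \<omega> = k} = {\<omega> \<in> space M. \<forall>m\<le>1. Y (if m = 0 then s else t) \<omega>
      = (if m = (0::nat) then i else k)}"
    by (auto simp: le_Suc_eq)
  then show ?thesis
    using prob_path[of "\<lambda>m. if m = 0 then s else t" 1 "\<lambda>m. if m = 0 then i else k"] assms by simp
qed

text \<open>The definition of the process does not confine the states to \<open>{..N}\<close>; this
  follows because the binomial weights already sum to 1.\<close>

lemma AE_state_le: "0 \<le> t \<Longrightarrow> AE \<omega> in M. Y t \<omega> \<le> N"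
proof -
  assume t: "0 \<le> t"
  have "prob {\<omega> \<in> space M. Y t \<omega> \<le> N} = prob (\<Union>i\<in>{..N}. {\<omega> \<in> space M. Y t \<omega> = i})"
    by (intro arg_cong[of _ _ prob]) auto
  also have "\<dots> = (\<Sum>i\<le>N. prob {\<omega> \<in> space M. Y t \<omega> = i})"
    by (rule finite_measure_finite_Union) (use t in \<open>auto simp: disjoint_family_on_def\<close>)
  also have "\<dots> = 1" using sum_binom_pi_exp[of N p 0] t by (simp add: prob_state)
  finally show "AE \<omega> in M. Y t \<omega> \<le> N" using t by (subst (asm) prob_Collect_eq_1) auto
qed

lemma expectation_two_states:
  fixes g :: "nat \<Rightarrow> nat \<Rightarrow> real"
  assumes st: "0 \<le> s" "s \<le> t"
  shows "expectation (\<lambda>\<omega>. g (Y s \<omega>) (Y t \<omega>))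
      = (\<Sum>i\<le>N. \<Sum>k\<le>N. binom_pi N p i * bd_trans N p (t - s) i k * g i k)"
proof -
  have m[measurable]: "Y s \<in> M \<rightarrow>\<^sub>M count_space UNIV" "Y t \<in> M \<rightarrow>\<^sub>M count_space UNIV"
    using st by auto
  have "AE \<omega> in M. g (Y s \<omega>) (Y t \<omega>)
      = (\<Sum>i\<le>N. \<Sum>k\<le>N. g i k * indicator {\<omega> \<in> space M. Y s \<omega> = i \<and> Y t \<omega> = k} \<omega>)"
    using AE_state_le[OF st(1)] AE_state_le[OF order_trans[OF st]] AE_space
  proof eventually_elim
    fix \<omega> assume *: "Y s \<omega> \<le> N" "Y t \<omega> \<le> N" "\<omega> \<in> space M"
    have "(\<Sum>i\<le>N. \<Sum>k\<le>N. g i k * indicator {\<omega> \<in> space M. Y s \<omega> = i \<and> Y t \<omega> = k} \<omega>)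
        = (\<Sum>i\<le>N. \<Sum>k\<le>N. if Y t \<omega> = k then (if Y s \<omega> = i then g i k else 0) else 0)"
      using *(3) by (intro sum.cong) (auto simp: indicator_def)
    also have "\<dots> = g (Y s \<omega>) (Y t \<omega>)" using * by simp
    finally show "g (Y s \<omega>) (Y t \<omega>)
        = (\<Sum>i\<le>N. \<Sum>k\<le>N. g i k * indicator {\<omega> \<in> space M. Y s \<omega> = i \<and> Y t \<omega> = k} \<omega>)" by simp
  qed
  then have "expectation (\<lambda>\<omega>. g (Y s \<omega>) (Y t \<omega>)) = expectation (\<lambda>\<omega>.
      \<Sum>i\<le>N. \<Sum>k\<le>N. g i k * indicator {\<omega> \<in> space M. Y s \<omega> = i \<and> Y t \<omega> = k} \<omega>)"
    by (intro integral_cong_AE) auto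
  also have "\<dots> = (\<Sum>i\<le>N. \<Sum>k\<le>N. g i k * prob {\<omega> \<in> space M. Y s \<omega> = i \<and> Y t \<omega> = k})"
  proof -
    define S where "S i k = {\<omega> \<in> space M. Y s \<omega> = i \<and> Y t \<omega> = k}" for i k
    have S[measurable]: "S i k \<in> sets M" for i k by (simp add: S_def)
    have i: "integrable M (\<lambda>\<omega>. g i k * indicator (S i k) \<omega>)" for i k
      by (intro integrable_mult_right integrable_real_indicator) (auto simp: emeasure_eq_measure)
    have "S i k \<inter> space M = S i k" for i k by (auto simp: S_def)
    then have "expectation (\<lambda>\<omega>. \<Sum>i\<le>N. \<Sum>k\<le>N. g i k * indicator (S i k) \<omega>)
        = (\<Sum>i\<le>N. \<Sum>k\<le>N. g i k * prob (S i k))"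
      using i by (simp add: Bochner_Integration.integral_sum Bochner_Integration.integrable_sum
          del: sum_mult_indicator sum_indicator_mult)
    then show ?thesis by (simp only: S_def)
  qed
  finally show ?thesis using st by (simp add: prob_two_states ac_simps)
qed

lemma bd_trans_0: "bd_trans N p 0 i k = (if i = k then 1 else 0)"
  unfolding bd_trans_def by (subst suminf_finite[of "{0}"]) auto

lemma expectation_state:
  fixes g :: "nat \<Rightarrow> real"
  assumes "0 \<le> t"
  shows "expectation (\<lambda>\<omega>. g (Y t \<omega>)) = (\<Sum>i\<le>N. binom_pi N p i * g i)"
proof -
  have "expectation (\<lambda>\<omega>. g (Y t \<omega>)) = (\<Sum>i\<le>N. \<Sum>k\<le>N. if i = k then binom_pi N p i * g i else 0)"
    using expectation_two_states[OF assms order_refl, of "\<lambda>i k. g i"]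
    by (simp add: bd_trans_0 if_distrib[of "\<lambda>x. _ * x * _"] cong: if_cong)
  also have "\<dots> = (\<Sum>i\<le>N. binom_pi N p i * g i)" by simp
  finally show ?thesis .
qed

lemma expectation_exp_state:
  "0 \<le> t \<Longrightarrow> expectation (\<lambda>\<omega>. exp (q * real (Y t \<omega>))) = (p * (exp q - 1) + 1) ^ N"
  by (subst expectation_state) (auto simp: sum_binom_pi_exp)

text \<open>Expanding the exponential in eigenvectors, the constant mode gives the product of the
  means, and mode m decays like exp (-m (t - s)), hence at least like exp (-(t - s)) for m at least
  1.\<close>

lemma exp_covariance_decay:
  obtains C where "0 \<le> C" "\<And>s t. 0 \<le> s \<Longrightarrow> s \<le> t \<Longrightarrow>
    \<bar>expectation (\<lambda>\<omega>. exp (real (Y s \<omega>)) * exp (real (Y t \<omega>))) - (p * (exp 1 - 1) + 1) ^ (2 * N)\<bar>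
      \<le> C * exp (- (t - s))"
proof -
  define r where "r = p * (exp 1 - 1) + 1"
  define z where "z = (exp 1 - 1) / r"
  \<comment> \<open>The contribution of mode \<open>m\<close> at equal times; \<open>d 0\<close> is
    the square of the mean of \<open>exp X\<close>.\<close>
  define d where "d m = r ^ N * z ^ m * (\<Sum>i\<le>N. binom_pi N p i * exp (real i) * coeff (krawtchouk N p i) m)" for m
  define C where "C = (\<Sum>m\<in>{1..N}. \<bar>d m\<bar>)"
  have "0 \<le> C" by (simp add: C_def sum_nonneg)
  moreover have "\<bar>expectation (\<lambda>\<omega>. exp (real (Y s \<omega>)) * exp (real (Y t \<omega>))) - r ^ (2 * N)\<bar>
      \<le> C * exp (- (t - s))" if st: "0 \<le> s" "s \<le> t" for s t
  proof -
    have "expectation (\<lambda>\<omega>. exp (real (Y s \<omega>)) * exp (real (Y t \<omega>)))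
        = (\<Sum>i\<le>N. \<Sum>k\<le>N. binom_pi N p i * bd_trans N p (t - s) i k * (exp (real i) * exp (real k)))"
      by (rule expectation_two_states[OF st])
    also have "\<dots> = (\<Sum>i\<le>N. binom_pi N p i * exp (real i) * (\<Sum>k\<le>N. bd_trans N p (t - s) i k * exp (real k)))"
      by (simp add: sum_distrib_left ac_simps)
    also have "\<dots> = (\<Sum>i\<le>N. binom_pi N p i * exp (real i) *
        (r ^ N * (\<Sum>m\<le>N. z ^ m * exp (- real m * (t - s)) * coeff (krawtchouk N p i) m)))"
      by (intro sum.cong) (auto simp: bd_trans_exp[OF p] r_def z_def)
    also have "\<dots> = (\<Sum>i\<le>N. \<Sum>m\<le>N. binom_pi N p i * exp (real i) *
        (r ^ N * (z ^ m * exp (- real m * (t - s)) * coeff (krawtchouk N p i) m)))"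
      by (simp add: sum_distrib_left)
    also have "\<dots> = (\<Sum>m\<le>N. exp (- real m * (t - s)) * d m)"
      by (subst sum.swap) (simp add: d_def sum_distrib_left ac_simps)
    also have "\<dots> = d 0 + (\<Sum>m\<in>{1..N}. exp (- real m * (t - s)) * d m)"
      by (simp add: atMost_atLeast0 sum.atLeast_Suc_atMost)
    also have "d 0 = r ^ (2 * N)"
      using sum_binom_pi_exp[of N p 1]
      by (simp add: d_def coeff_krawtchouk_0 r_def mult_2 power_add)
    finally have "\<bar>expectation (\<lambda>\<omega>. exp (real (Y s \<omega>)) * exp (real (Y t \<omega>))) - r ^ (2 * N)\<bar>
       \<le> (\<Sum>m\<in>{1..N}. \<bar>exp (- real m * (t - s)) * d m\<bar>)" by simp
    also have "\<dots> \<le> (\<Sum>m\<in>{1..N}. exp (- (t - s)) * \<bar>d m\<bar>)"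
    proof (intro sum_mono)
      fix m assume "m \<in> {1..N}"
      then have "1 * (t - s) \<le> real m * (t - s)" using st by (intro mult_right_mono) auto
      then have "exp (- real m * (t - s)) \<le> exp (- (t - s))" by simp
      then show "\<bar>exp (- real m * (t - s)) * d m\<bar> \<le> exp (- (t - s)) * \<bar>d m\<bar>"
        by (simp add: abs_mult mult_right_mono)
    qed
    finally show ?thesis by (simp add: C_def sum_distrib_left mult.commute)
  qed
  ultimately show ?thesis using that unfolding r_def by blast
qed

text \<open>For gaps up to 1 this is \<open>bd_trans_diag_lower\<close> averaged over the binomial
  law. For longer gaps the summand 1 in the constant makes the bound exceed 1.\<close>

lemma prob_state_change:
  assumes st: "0 \<le> s" "s \<le> t"
  defines "C \<equiv> real (Suc N) * real N"
  shows "prob {\<omega> \<in> space M. Y s \<omega> \<noteq> Y t \<omega>} \<le> (1 + C * exp C) * (t - s)"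
proof (cases "t - s \<le> 1")
  case True
  have m[measurable]: "Y s \<in> M \<rightarrow>\<^sub>M count_space UNIV" "Y t \<in> M \<rightarrow>\<^sub>M count_space UNIV"
    using st by auto
  have "prob {\<omega> \<in> space M. Y s \<omega> \<noteq> Y t \<omega>} = expectation (indicator {\<omega> \<in> space M. Y s \<omega> \<noteq> Y t \<omega>})"
    by (simp, intro arg_cong[of _ _ prob]) auto
  also have "\<dots> = expectation (\<lambda>\<omega>. 1 - (if Y s \<omega> = Y t \<omega> then 1 else 0))"
    by (intro Bochner_Integration.integral_cong) (auto simp: indicator_def)
  also have "\<dots> = 1 - expectation (\<lambda>\<omega>. if Y s \<omega> = Y t \<omega> then 1 else 0)"
  proof -
    have "(\<lambda>\<omega>. if real (Y s \<omega>) = real (Y t \<omega>) then 1 else (0::real)) \<in> borel_measurable M"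
      by measurable
    then have "integrable M (\<lambda>\<omega>. if Y s \<omega> = Y t \<omega> then 1 else (0::real))"
      by (intro integrable_const_bound[where B=1]) auto
    then show ?thesis by (simp add: Bochner_Integration.integral_diff prob_space)
  qed
  also have "expectation (\<lambda>\<omega>. if Y s \<omega> = Y t \<omega> then 1 else 0)
      = (\<Sum>i\<le>N. binom_pi N p i * bd_trans N p (t - s) i i)"
    by (subst expectation_two_states[OF st]) (simp add: if_distrib[of "\<lambda>x. _ * x"] cong: if_cong)
  also have "1 - (\<Sum>i\<le>N. binom_pi N p i * bd_trans N p (t - s) i i)
      = (\<Sum>i\<le>N. binom_pi N p i * (1 - bd_trans N p (t - s) i i))"
    using sum_binom_pi_exp[of N p 0] by (simp add: algebra_simps sum_subtractf)
  also have "\<dots> \<le> (\<Sum>i\<le>N. binom_pi N p i * (C * exp C * (t - s)))"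
    unfolding C_def using p st True
    by (intro sum_mono mult_left_mono bd_trans_diag_lower binom_pi_nonneg) auto
  also have "\<dots> = C * exp C * (t - s)"
    using sum_binom_pi_exp[of N p 0] by (simp flip: sum_distrib_right)
  also have "\<dots> \<le> (1 + C * exp C) * (t - s)"
    using st by (intro mult_right_mono) auto
  finally show ?thesis .
next
  case False
  have "0 \<le> C" by (simp add: C_def)
  then have "1 * 1 \<le> (1 + C * exp C) * (t - s)" using False by (intro mult_mono) auto
  then show ?thesis using prob_le_1 order_trans by (metis mult_1)
qed

end

text \<open>A law on a countable product is determined by its point masses, and these involve only
  the increments of time, all equal to \<open>\<beta>\<close> on an equispaced grid. So neither the
  starting time nor the choice of the process matters.\<close>

lemma distr_grid_eq:
  assumes "bd_process M N p Y" "bd_process M N p Y'" "0 \<le> \<alpha>" "0 \<le> \<beta>" "0 < k"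
  shows "distr M (Pi\<^sub>M {..<k} (\<lambda>_. count_space UNIV)) (\<lambda>\<omega>. \<lambda>i\<in>{..<k}. Y (\<alpha> + \<beta> * real i) \<omega>)
    = distr M (Pi\<^sub>M {..<k} (\<lambda>_. count_space UNIV)) (\<lambda>\<omega>. \<lambda>i\<in>{..<k}. Y' (\<beta> * real i) \<omega>)"
    (is "?D = ?D'")
proof -
  interpret Y: bd_process M N p Y by fact
  interpret Y': bd_process M N p Y' by fact
  have m[measurable]: "Y (\<alpha> + \<beta> * real i) \<in> M \<rightarrow>\<^sub>M count_space UNIV"
      "Y' (\<beta> * real i) \<in> M \<rightarrow>\<^sub>M count_space UNIV" for i
    using assms by auto
  obtain k' where k': "k = Suc k'" using \<open>0 < k\<close> gr0_implies_Suc by blast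
  let ?P = "PiE {..<k} (\<lambda>_. UNIV :: nat set)"
  have S: "sets (Pi\<^sub>M {..<k} (\<lambda>_. count_space (UNIV :: nat set))) = Pow ?P"
    by (subst count_space_PiM_finite) auto
  show ?thesis
  proof (rule measure_eqI_countable)
    show "sets ?D = Pow ?P" "sets ?D' = Pow ?P" using S by auto
    show "countable ?P" by (intro countable_PiE) auto
    fix v assume v: "v \<in> ?P"
    have A: "{v} \<in> sets (Pi\<^sub>M {..<k} (\<lambda>_. count_space (UNIV :: nat set)))" using v S by auto
    have "Y.prob ((\<lambda>\<omega>. \<lambda>i\<in>{..<k}. Y (\<alpha> + \<beta> * real i) \<omega>) -` {v} \<inter> space M)
        = Y.prob {\<omega> \<in> space M. \<forall>m\<le>k'. Y (\<alpha> + \<beta> * real m) \<omega> = v m}"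
      using v by (intro arg_cong[of _ _ Y.prob]) (auto simp: k' fun_eq_iff PiE_def extensional_def less_Suc_eq_le)
    also have "\<dots> = binom_pi N p (v 0) * (\<Prod>m<k'. bd_trans N p \<beta> (v m) (v (Suc m)))"
      using assms by (subst Y.prob_path) (auto simp: algebra_simps)
    also have "\<dots> = Y.prob {\<omega> \<in> space M. \<forall>m\<le>k'. Y' (\<beta> * real m) \<omega> = v m}"
      using assms by (subst Y'.prob_path) (auto simp: algebra_simps)
    also have "\<dots> = Y.prob ((\<lambda>\<omega>. \<lambda>i\<in>{..<k}. Y' (\<beta> * real i) \<omega>) -` {v} \<inter> space M)"
      using v by (intro arg_cong[of _ _ Y.prob]) (auto simp: k' fun_eq_iff PiE_def extensional_def less_Suc_eq_le)
    finally show "emeasure ?D {v} = emeasure ?D' {v}"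
      using A by (simp add: emeasure_distr Y.emeasure_eq_measure)
  qed
qed

section \<open>Moments and interval integrals\<close>

text \<open>The sum of the absolute values has finite integral, hence is finite almost everywhere.
  This turns summable L1 bounds into almost sure convergence, both for the masses and for their
  Riemann sums.\<close>

lemma AE_summable_abs:
  fixes f :: "nat \<Rightarrow> 'a \<Rightarrow> real"
  assumes f: "\<And>n. integrable M (f n)" and le: "\<And>n. (\<integral>x. \<bar>f n x\<bar> \<partial>M) \<le> c n" and c: "summable c"
  shows "AE x in M. summable (\<lambda>n. \<bar>f n x\<bar>)"
proof -
  have m[measurable]: "\<And>n. f n \<in> borel_measurable M" using f by auto
  have s: "summable (\<lambda>n. \<integral>x. \<bar>f n x\<bar> \<partial>M)"
    by (rule summable_comparison_test'[OF c]) (use le in auto)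
  have "(\<integral>\<^sup>+x. (\<Sum>n. ennreal \<bar>f n x\<bar>) \<partial>M) = (\<Sum>n. \<integral>\<^sup>+x. ennreal \<bar>f n x\<bar> \<partial>M)"
    by (rule nn_integral_suminf) auto
  also have "\<dots> = (\<Sum>n. ennreal (\<integral>x. \<bar>f n x\<bar> \<partial>M))"
    using f by (subst nn_integral_eq_integral) auto
  also have "\<dots> = ennreal (\<Sum>n. \<integral>x. \<bar>f n x\<bar> \<partial>M)"
    by (intro suminf_ennreal2 s) auto
  finally have "(\<integral>\<^sup>+x. (\<Sum>n. ennreal \<bar>f n x\<bar>) \<partial>M) \<noteq> \<infinity>" by simp
  then have "AE x in M. (\<Sum>n. ennreal \<bar>f n x\<bar>) \<noteq> \<infinity>"
    by (intro nn_integral_PInf_AE) auto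
  then show ?thesis by eventually_elim (auto intro: summable_suminf_not_top)
qed

text \<open>Expectations of truncated powers pass to the limit under almost sure convergence
  for every \<open>q > 0\<close>, without uniform integrability; the truncation is removed only at the very end.\<close>

definition trunc_powr :: "real \<Rightarrow> real \<Rightarrow> real \<Rightarrow> real" where
  "trunc_powr l q x = (min x l) powr q"

lemma trunc_powr_measurable [measurable]: "trunc_powr l q \<in> borel_measurable borel"
  unfolding trunc_powr_def by measurable

lemma trunc_powr_nonneg: "0 \<le> trunc_powr l q x"
  by (simp add: trunc_powr_def)

lemma trunc_powr_le: "0 < q \<Longrightarrow> 0 \<le> l \<Longrightarrow> 0 \<le> x \<Longrightarrow> trunc_powr l q x \<le> l powr q"
  by (auto simp: trunc_powr_def intro!: powr_mono2)

lemma trunc_powr_le_powr: "0 < q \<Longrightarrow> 0 \<le> l \<Longrightarrow> 0 \<le> x \<Longrightarrow> trunc_powr l q x \<le> x powr q"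
  by (auto simp: trunc_powr_def intro!: powr_mono2)

lemma trunc_powr_mono: "0 < q \<Longrightarrow> 0 \<le> l \<Longrightarrow> 0 \<le> x \<Longrightarrow> x \<le> y \<Longrightarrow> trunc_powr l q x \<le> trunc_powr l q y"
  by (auto simp: trunc_powr_def intro!: powr_mono2)

text \<open>Later \<open>w\<close> is random. Moving only its deterministic lower bound
  \<open>d\<close> into the level leaves a function of \<open>w\<close> times a function of
  \<open>x\<close>, to which independence applies. The companion \<open>trunc_powr_mult_ge\<close>
  uses an upper bound in the same way.\<close>

lemma trunc_powr_mult_le:
  assumes "0 < q" "0 < l" "0 < d" "d \<le> w" "0 \<le> x"
  shows "trunc_powr l q (w * x) \<le> w powr q * trunc_powr (l / d) q x"
proof -
  have "min (w * x) l \<le> w * min x (l / d)"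
  proof -
    define e where "e = l / d"
    have "d * e \<le> w * e" using assms by (intro mult_right_mono) (auto simp: e_def)
    moreover have "d * e = l" using assms by (simp add: e_def)
    moreover have "w * min x e = min (w * x) (w * e)" using assms by (simp add: min_mult_distrib_left)
    ultimately show ?thesis unfolding e_def[symmetric] by linarith
  qed
  then have "(min (w * x) l) powr q \<le> (w * min x (l / d)) powr q"
    using assms by (intro powr_mono2) auto
  then show ?thesis using assms by (simp add: trunc_powr_def powr_mult)
qed

lemma trunc_powr_mult_ge:
  assumes "0 < q" "0 < l" "0 < w" "w \<le> d" "0 \<le> x"
  shows "w powr q * trunc_powr (l / d) q x \<le> trunc_powr l q (w * x)"
proof -
  have "w * min x (l / d) \<le> min (w * x) l"
  proof -
    define e where "e = l / d"
    have "w * e \<le> d * e" using assms by (intro mult_right_mono) (auto simp: e_def)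
    moreover have "d * e = l" using assms by (simp add: e_def)
    moreover have "w * min x e = min (w * x) (w * e)" using assms by (simp add: min_mult_distrib_left)
    ultimately show ?thesis unfolding e_def[symmetric] by linarith
  qed
  then have "(w * min x (l / d)) powr q \<le> (min (w * x) l) powr q"
    using assms by (intro powr_mono2) auto
  then show ?thesis using assms by (simp add: trunc_powr_def powr_mult)
qed

context prob_space
begin

abbreviation tmom :: "real \<Rightarrow> real \<Rightarrow> ('a \<Rightarrow> real) \<Rightarrow> real" where
  "tmom l q Z \<equiv> expectation (\<lambda>x. trunc_powr l q (Z x))"

lemma trunc_powr_integrable:
  assumes "0 < q" "0 \<le> l" "Z \<in> borel_measurable M" "AE x in M. 0 \<le> Z x"
  shows "integrable M (\<lambda>x. trunc_powr l q (Z x))"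
proof (rule integrable_const_bound[where B="l powr q"])
  show "AE x in M. norm (trunc_powr l q (Z x)) \<le> l powr q"
    using assms(4) by eventually_elim (use assms in \<open>auto simp: trunc_powr_nonneg trunc_powr_le\<close>)
qed (use assms in measurable)

lemma trunc_powr_tendsto:
  assumes q: "0 < q" "0 \<le> l" and Z: "\<And>n. Z n \<in> borel_measurable M" "Z' \<in> borel_measurable M"
    and nn: "\<And>n. AE x in M. 0 \<le> Z n x" and lim: "AE x in M. (\<lambda>n. Z n x) \<longlonglongrightarrow> Z' x"
  shows "(\<lambda>n. tmom l q (Z n)) \<longlonglongrightarrow> tmom l q Z'"
proof (rule integral_dominated_convergence[where w="\<lambda>_. l powr q"])
  have nn': "AE x in M. \<forall>n. 0 \<le> Z n x" using nn by (simp add: AE_all_countable)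
  show "AE x in M. (\<lambda>n. trunc_powr l q (Z n x)) \<longlonglongrightarrow> trunc_powr l q (Z' x)"
    using nn' lim
  proof eventually_elim
    fix x assume *: "\<forall>n. 0 \<le> Z n x" "(\<lambda>n. Z n x) \<longlonglongrightarrow> Z' x"
    have "(\<lambda>n. min (Z n x) l) \<longlonglongrightarrow> min (Z' x) l" using * by (intro tendsto_min tendsto_const)
    then show "(\<lambda>n. trunc_powr l q (Z n x)) \<longlonglongrightarrow> trunc_powr l q (Z' x)"
      unfolding trunc_powr_def using q * by (intro tendsto_powr') auto
  qed
  show "AE x in M. norm (trunc_powr l q (Z n x)) \<le> l powr q" for n
    using nn[of n] by eventually_elim (use q in \<open>auto simp: trunc_powr_nonneg trunc_powr_le\<close>)
qed (use Z in auto)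

text \<open>The truncations are dominated by the integrable \<open>Z powr q\<close> and eventually
  equal to it. Together with \<open>trunc_le_moment\<close> this reduces inequalities between
  moments to inequalities between truncated moments at every level.\<close>

lemma moment_le_of_trunc_le:
  assumes q: "0 < q" and Z: "Z \<in> borel_measurable M" "AE x in M. 0 \<le> Z x"
    "integrable M (\<lambda>x. Z x powr q)"
    and le: "\<And>l. 0 < l \<Longrightarrow> tmom l q Z \<le> B"
  shows "expectation (\<lambda>x. Z x powr q) \<le> B"
proof -
  have "(\<lambda>n. tmom (real (Suc n)) q Z) \<longlonglongrightarrow> expectation (\<lambda>x. Z x powr q)"
  proof (rule integral_dominated_convergence[where w="\<lambda>x. Z x powr q"])
    show "AE x in M. (\<lambda>n. trunc_powr (real (Suc n)) q (Z x)) \<longlonglongrightarrow> Z x powr q"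
    proof (intro AE_I2)
      fix x
      have "\<forall>\<^sub>F n in sequentially. Z x \<le> real (Suc n)"
        using eventually_ge_at_top[of "nat \<lceil>Z x\<rceil>"] by eventually_elim linarith
      then have "\<forall>\<^sub>F n in sequentially. trunc_powr (real (Suc n)) q (Z x) = Z x powr q"
        by eventually_elim (simp add: trunc_powr_def min_def)
      then show "(\<lambda>n. trunc_powr (real (Suc n)) q (Z x)) \<longlonglongrightarrow> Z x powr q"
        by (rule tendsto_eventually)
    qed
    show "AE x in M. norm (trunc_powr (real (Suc n)) q (Z x)) \<le> Z x powr q" for n
      using Z(2) by eventually_elim (use q in \<open>auto simp: trunc_powr_nonneg trunc_powr_le_powr\<close>)
  qed (use Z in auto)
  then show ?thesis by (rule LIMSEQ_le_const2) (use le in auto)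
qed

lemma trunc_le_moment:
  assumes q: "0 < q" "0 < l" and Z: "Z \<in> borel_measurable M" "AE x in M. 0 \<le> Z x"
    "integrable M (\<lambda>x. Z x powr q)"
  shows "tmom l q Z \<le> expectation (\<lambda>x. Z x powr q)"
proof (rule integral_mono_AE)
  show "AE x in M. trunc_powr l q (Z x) \<le> Z x powr q"
    using Z(2) by eventually_elim (use q in \<open>simp add: trunc_powr_le_powr\<close>)
qed (use assms in \<open>auto intro!: trunc_powr_integrable\<close>)

text \<open>The factor \<open>g\<close> makes squares of interval integrals accessible: one copy of
  the integral plays the role of \<open>g\<close>, the other is interchanged with the expectation.
  With \<open>g = 0\<close> only the measurability statement is of interest.\<close>

lemma interval_fubini:
  fixes f :: "real \<Rightarrow> 'a \<Rightarrow> real"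
  assumes m[measurable]: "(\<lambda>x. f (fst x) (snd x)) \<in> borel_measurable (borel \<Otimes>\<^sub>M M)"
    and f: "\<And>s \<omega>. s \<in> {a..c} \<Longrightarrow> \<omega> \<in> space M \<Longrightarrow> \<bar>f s \<omega>\<bar> \<le> B"
    and g[measurable]: "g \<in> borel_measurable M" "\<And>\<omega>. \<omega> \<in> space M \<Longrightarrow> \<bar>g \<omega>\<bar> \<le> B'"
  shows "(\<lambda>\<omega>. \<integral>s. indicator {a..c} s * f s \<omega> \<partial>lborel) \<in> borel_measurable M"
    and "integrable M (\<lambda>\<omega>. g \<omega> * (\<integral>s. indicator {a..c} s * f s \<omega> \<partial>lborel))"
    and "expectation (\<lambda>\<omega>. g \<omega> * (\<integral>s. indicator {a..c} s * f s \<omega> \<partial>lborel))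
       = (\<integral>s. indicator {a..c} s * expectation (\<lambda>\<omega>. g \<omega> * f s \<omega>) \<partial>lborel)"
proof -
  have Times: "emeasure (lborel \<Otimes>\<^sub>M M) ({a..c} \<times> space M) = emeasure lborel {a..c} * emeasure M (space M)"
    by (rule emeasure_pair_measure_Times) auto
  interpret pair_sigma_finite lborel M ..
  let ?h = "\<lambda>s \<omega>. g \<omega> * (indicator {a..c} s * f s \<omega>)"
  have m2: "(\<lambda>x. f (fst x) (snd x)) \<in> borel_measurable (lborel \<Otimes>\<^sub>M M)"
    using m by (simp cong: measurable_cong_sets sets_pair_measure_cong)
  have m3: "case_prod ?h \<in> borel_measurable (lborel \<Otimes>\<^sub>M M)"
    unfolding split_beta' using m2 by measurable
  have int: "integrable (lborel \<Otimes>\<^sub>M M) (case_prod ?h)"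
  proof (rule integrableI_bounded_set[where A="{a..c} \<times> space M" and B="B' * B"])
    show "emeasure (lborel \<Otimes>\<^sub>M M) ({a..c} \<times> space M) < \<infinity>"
      using Times by (simp add: emeasure_space_1 emeasure_lborel_Icc_eq)
    show "AE x in lborel \<Otimes>\<^sub>M M. x \<in> {a..c} \<times> space M \<longrightarrow> norm (case_prod ?h x) \<le> B' * B"
    proof (intro AE_I2 impI)
      fix x assume "x \<in> {a..c} \<times> space M"
      then have "\<bar>g (snd x)\<bar> * \<bar>f (fst x) (snd x)\<bar> \<le> B' * B"
        using f[of "fst x" "snd x"] g(2)[of "snd x"]
        by (intro mult_mono) (auto intro: order_trans[OF abs_ge_zero])
      then show "norm (case_prod ?h x) \<le> B' * B" using \<open>x \<in> _\<close> by (auto simp: abs_mult)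
    qed
    show "AE x in lborel \<Otimes>\<^sub>M M. x \<notin> {a..c} \<times> space M \<longrightarrow> case_prod ?h x = 0"
      by (intro AE_I2) (auto simp: space_pair_measure indicator_def)
  qed (use m3 in auto)
  show "(\<lambda>\<omega>. \<integral>s. indicator {a..c} s * f s \<omega> \<partial>lborel) \<in> borel_measurable M"
  proof (rule lborel.borel_measurable_lebesgue_integral)
    have "(\<lambda>x. indicator {a..c} (fst x) * f (fst x) (snd x)) \<in> borel_measurable (lborel \<Otimes>\<^sub>M M)"
      using m2 by measurable
    from measurable_pair_swap[OF this]
    show "(\<lambda>(\<omega>, s). indicator {a..c} s * f s \<omega>) \<in> borel_measurable (M \<Otimes>\<^sub>M lborel)"
      by (simp add: split_beta')
  qed
  have eq: "g \<omega> * (\<integral>s. indicator {a..c} s * f s \<omega> \<partial>lborel) = (\<integral>s. ?h s \<omega> \<partial>lborel)" for \<omega>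
    by simp
  show "integrable M (\<lambda>\<omega>. g \<omega> * (\<integral>s. indicator {a..c} s * f s \<omega> \<partial>lborel))"
    unfolding eq by (rule integrable_snd[OF int])
  show "expectation (\<lambda>\<omega>. g \<omega> * (\<integral>s. indicator {a..c} s * f s \<omega> \<partial>lborel))
       = (\<integral>s. indicator {a..c} s * expectation (\<lambda>\<omega>. g \<omega> * f s \<omega>) \<partial>lborel)"
  proof -
    have "expectation (\<lambda>\<omega>. ?h s \<omega>) = indicator {a..c} s * expectation (\<lambda>\<omega>. g \<omega> * f s \<omega>)" for s
      by (subst integral_mult_right_zero[symmetric]) (simp add: ac_simps)
    then show ?thesis unfolding eq Fubini_integral[OF int] by simp
  qed
qed

end

section \<open>Cascades of bounded stationary layers\<close>

text \<open>All that the birth-death process has to supply. \<open>law\<close> joins stationarity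
  and equality in law of the layers, on equispaced grids only; \<open>C1\<close> controls
  decorrelation and \<open>C2\<close> the rate of change. The bounds \<open>lo\<close> and
  \<open>hi\<close> hold everywhere, so that integrability never involves an exceptional
  set.\<close>

locale cascade = prob_space M for M :: "'w measure" +
  fixes L :: "nat \<Rightarrow> real \<Rightarrow> 'w \<Rightarrow> real" and b lo hi m2 C1 C2 :: real
  assumes L_joint: "(\<lambda>x. L j (fst x) (snd x)) \<in> borel_measurable (borel \<Otimes>\<^sub>M M)"
    and lo: "0 < lo" and L_lo: "lo \<le> L j s \<omega>" and L_hi: "L j s \<omega> \<le> hi"
    and b: "1 < b"
    and indep: "indep_vars (\<lambda>_. Pi\<^sub>M {0..} (\<lambda>_. borel)) (\<lambda>j \<omega>. \<lambda>t\<in>{0..}. L j t \<omega>) UNIV"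
    and law: "0 \<le> \<alpha> \<Longrightarrow> 0 \<le> \<beta> \<Longrightarrow> 0 < k \<Longrightarrow>
      distr M (Pi\<^sub>M {..<k} (\<lambda>_. borel)) (\<lambda>\<omega>. \<lambda>r\<in>{..<k}. L j (\<alpha> + \<beta> * real r) \<omega>)
      = distr M (Pi\<^sub>M {..<k} (\<lambda>_. borel)) (\<lambda>\<omega>. \<lambda>r\<in>{..<k}. L 0 (\<beta> * real r) \<omega>)"
    and mean: "0 \<le> s \<Longrightarrow> expectation (L j s) = 1"
    and second_moment: "0 \<le> s \<Longrightarrow> 0 \<le> t \<Longrightarrow> expectation (\<lambda>\<omega>. L j s \<omega> * L j t \<omega>) \<le> m2"
    and covariance: "0 \<le> s \<Longrightarrow> 0 \<le> t \<Longrightarrow>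
      \<bar>expectation (\<lambda>\<omega>. L j s \<omega> * L j t \<omega>) - 1\<bar> \<le> C1 * exp (- \<bar>s - t\<bar>)"
    and m2: "m2 < b"
    and change: "0 \<le> s \<Longrightarrow> 0 \<le> t \<Longrightarrow> prob {\<omega> \<in> space M. L j s \<omega> \<noteq> L j t \<omega>} \<le> C2 * \<bar>s - t\<bar>"
begin

lemma L_measurable [measurable (raw)]:
  assumes [measurable]: "f \<in> borel_measurable A" "g \<in> A \<rightarrow>\<^sub>M M"
  shows "(\<lambda>x. L j (f x) (g x)) \<in> borel_measurable A"
  using measurable_compose[OF measurable_Pair[OF assms] L_joint] by simp

lemma lo_le_hi: "lo \<le> hi" using L_lo[of 0 0 undefined] L_hi[of 0 0 undefined] by linarith

lemma hi: "0 < hi" using lo lo_le_hi by linarith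

lemma L_pos: "0 < L j s \<omega>" using lo L_lo[of j s \<omega>] by linarith

text \<open>The density and the mass built from the layers \<open>i, \<dots>, i + n\<close>: the shift \<open>i = 1\<close> appears
  when the first layer is split off and the rest is rescaled by \<open>b\<close>.\<close>

definition den :: "nat \<Rightarrow> nat \<Rightarrow> real \<Rightarrow> 'w \<Rightarrow> real" where
  "den i n s \<omega> = (\<Prod>j\<le>n. L (i + j) (s * b ^ j) \<omega>)"

definition mass :: "nat \<Rightarrow> nat \<Rightarrow> real \<Rightarrow> real \<Rightarrow> 'w \<Rightarrow> real" where
  "mass i n a c \<omega> = (\<integral>s. indicator {a..c} s * den i n s \<omega> \<partial>lborel)"

definition riemann :: "nat \<Rightarrow> nat \<Rightarrow> real \<Rightarrow> real \<Rightarrow> nat \<Rightarrow> 'w \<Rightarrow> real" where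
  "riemann i n a t k \<omega> = t / real k * (\<Sum>r<k. den i n (a + t / real k * real r) \<omega>)"

lemma den_measurable [measurable (raw)]:
  assumes [measurable]: "f \<in> borel_measurable A" "g \<in> A \<rightarrow>\<^sub>M M"
  shows "(\<lambda>x. den i n (f x) (g x)) \<in> borel_measurable A"
  unfolding den_def by measurable

lemma riemann_measurable [measurable]: "riemann i n a t k \<in> borel_measurable M"
  unfolding riemann_def by measurable

lemma den_pos: "0 < den i n s \<omega>"
  unfolding den_def by (intro prod_pos) (auto simp: L_pos)

lemma den_le: "den i n s \<omega> \<le> hi ^ Suc n"
proof -
  have "den i n s \<omega> \<le> (\<Prod>j\<le>n. hi)"
    unfolding den_def using L_hi L_pos by (intro prod_mono) (auto simp: less_imp_le)
  then show ?thesis by simp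
qed

lemma abs_den_le: "\<bar>den i n s \<omega>\<bar> \<le> hi ^ Suc n"
  using den_le[of i n s \<omega>] den_pos[of i n s \<omega>] by simp

lemma mass_measurable [measurable]: "mass i n a c \<in> borel_measurable M"
  unfolding mass_def
  by (rule interval_fubini(1)[where B="hi ^ Suc n" and g="\<lambda>_. 0" and B'=0]) (auto simp: abs_den_le simp del: power_Suc)

lemma den_integrable: "\<omega> \<in> space M \<Longrightarrow> integrable lborel (\<lambda>s. indicator {a..c} s * den i n s \<omega>)"
  by (rule integrableI_bounded_set[where A="{a..c}" and B="hi ^ Suc n"])
    (auto simp: abs_den_le emeasure_lborel_Icc_eq indicator_def simp del: power_Suc)

lemma mass_nonneg: "0 \<le> mass i n a c \<omega>"
  unfolding mass_def by (intro Bochner_Integration.integral_nonneg) (auto simp: less_imp_le den_pos)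

lemma riemann_nonneg: "0 \<le> t \<Longrightarrow> 0 \<le> riemann i n a t k \<omega>"
  unfolding riemann_def using den_pos by (intro mult_nonneg_nonneg sum_nonneg) (auto simp: less_imp_le)

lemma mass_split:
  assumes "a \<le> c" "c \<le> d" "\<omega> \<in> space M"
  shows "mass i n a d \<omega> = mass i n a c \<omega> + mass i n c d \<omega>"
proof -
  have "mass i n a c \<omega> + mass i n c d \<omega> = (\<integral>s. indicator {a..c} s * den i n s \<omega>
      + indicator {c..d} s * den i n s \<omega> \<partial>lborel)"
    unfolding mass_def using assms den_integrable by (intro Bochner_Integration.integral_add[symmetric]) auto
  also have "\<dots> = mass i n a d \<omega>"
    unfolding mass_def
  proof (rule integral_cong_AE)
    show "AE s in lborel. indicator {a..c} s * den i n s \<omega> + indicator {c..d} s * den i n s \<omega>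
        = indicator {a..d} s * den i n s \<omega>"
      using AE_lborel_singleton[of c] by eventually_elim (use assms in \<open>auto simp: indicator_def\<close>)
  qed (use assms in measurable)
  finally show ?thesis by simp
qed

end

text \<open>Needed to regard the layers \<open>i\<close>, \<open>i + 1\<close>, ... as an
  independent family numbered from 0.\<close>

lemma (in prob_space) indep_vars_reindex:
  assumes ind: "indep_vars M' X (f ` I)" and inj: "inj_on f I"
  shows "indep_vars (\<lambda>i. M' (f i)) (\<lambda>i. X (f i)) I"
  unfolding indep_vars_def2
proof (intro conjI ballI)
  show "random_variable (M' (f i)) (X (f i))" if "i \<in> I" for i
    using ind that by (auto simp: indep_vars_def2)
  let ?F = "\<lambda>i. {X i -` A \<inter> space M | A. A \<in> sets (M' i)}"
  have F: "indep_sets ?F (f ` I)" using ind by (auto simp: indep_vars_def2)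
  show "indep_sets (\<lambda>i. ?F (f i)) I"
  proof (rule indep_setsI)
    show "?F (f i) \<subseteq> events" if "i \<in> I" for i using F that by (auto simp: indep_sets_def)
    fix A J assume J: "J \<noteq> {}" "J \<subseteq> I" "finite J" "\<forall>j\<in>J. A j \<in> ?F (f j)"
    have injJ: "inj_on f J" using inj J(2) by (rule inj_on_subset)
    let ?A = "\<lambda>i. A (inv_into J f i)"
    have A: "?A (f j) = A j" if "j \<in> J" for j using injJ that by simp
    have "prob (\<Inter>i\<in>f ` J. ?A i) = (\<Prod>i\<in>f ` J. prob (?A i))"
      by (rule indep_setsD[OF F]) (use J A in auto)
    then show "prob (\<Inter>j\<in>J. A j) = (\<Prod>j\<in>J. prob (A j))"
      using A by (simp add: prod.reindex[OF injJ])
  qed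
qed

text \<open>\<open>2 / \<beta>\<close> is the integral over the whole line. The interval is enlarged
  so as to contain \<open>s\<close> and cut there, where the absolute value changes branch and each
  piece has an elementary antiderivative.\<close>

lemma integral_exp_abs_le:
  fixes \<beta> :: real
  assumes "0 < \<beta>"
  shows "(\<integral>x. indicator {a..c} x * exp (- (\<beta> * \<bar>s - x\<bar>)) \<partial>lborel) \<le> 2 / \<beta>"
proof -
  define u v where "u = min a s" and "v = max c s"
  have uv: "u \<le> s" "s \<le> v" "u \<le> a" "c \<le> v" by (auto simp: u_def v_def)
  have 1: "has_bochner_integral lborel (\<lambda>x. exp (- (\<beta> * (s - x))) * indicator {u..s} x)
      (exp (- (\<beta> * (s - s))) / \<beta> - exp (- (\<beta> * (s - u))) / \<beta>)"
    using uv assms by (intro has_bochner_integral_FTC_Icc_real) (auto intro!: derivative_eq_intros)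
  have 2: "has_bochner_integral lborel (\<lambda>x. exp (- (\<beta> * (x - s))) * indicator {s..v} x)
      (- exp (- (\<beta> * (v - s))) / \<beta> - - exp (- (\<beta> * (s - s))) / \<beta>)"
    using uv assms by (intro has_bochner_integral_FTC_Icc_real) (auto intro!: derivative_eq_intros)
  let ?g = "\<lambda>x. exp (- (\<beta> * (s - x))) * indicator {u..s} x + exp (- (\<beta> * (x - s))) * indicator {s..v} x"
  have 3: "has_bochner_integral lborel ?g
     (exp (- (\<beta> * (s - s))) / \<beta> - exp (- (\<beta> * (s - u))) / \<beta> +
      (- exp (- (\<beta> * (v - s))) / \<beta> - - exp (- (\<beta> * (s - s))) / \<beta>))"
    by (rule has_bochner_integral_add[OF 1 2])
  have "(\<integral>x. indicator {a..c} x * exp (- (\<beta> * \<bar>s - x\<bar>)) \<partial>lborel) \<le> (\<integral>x. ?g x \<partial>lborel)"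
  proof (rule integral_mono)
    show "integrable lborel (\<lambda>x. indicator {a..c} x * exp (- (\<beta> * \<bar>s - x\<bar>)))"
      by (rule integrableI_bounded_set[where A="{a..c}" and B=1])
        (use assms in \<open>auto simp: emeasure_lborel_Icc_eq indicator_def\<close>)
    show "integrable lborel ?g" using integrable.intros[OF 3] .
    fix x show "indicator {a..c} x * exp (- (\<beta> * \<bar>s - x\<bar>)) \<le> ?g x"
      using uv by (auto simp: indicator_def abs_if)
  qed
  also have "\<dots> = (1 - exp (- (\<beta> * (s - u)))) / \<beta> + (1 - exp (- (\<beta> * (v - s)))) / \<beta>"
    using 3 by (simp add: has_bochner_integral_integral_eq diff_divide_distrib)
  also have "\<dots> \<le> 1 / \<beta> + 1 / \<beta>"
    using assms by (intro add_mono divide_right_mono) auto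
  finally show ?thesis by simp
qed

section \<open>Second moments of the mass increments\<close>

context cascade
begin

abbreviation path :: "nat \<Rightarrow> 'w \<Rightarrow> real \<Rightarrow> real" where
  "path j \<omega> \<equiv> \<lambda>t\<in>{0..}. L j t \<omega>"

lemma expectation_prod_layers:
  assumes m: "\<And>j. j \<le> n \<Longrightarrow> g j \<in> borel_measurable (Pi\<^sub>M {0..} (\<lambda>_. borel))"
    and i: "\<And>j. j \<le> n \<Longrightarrow> integrable M (\<lambda>\<omega>. g j (path j \<omega>) :: real)"
  shows "expectation (\<lambda>\<omega>. \<Prod>j\<le>n. g j (path j \<omega>)) = (\<Prod>j\<le>n. expectation (\<lambda>\<omega>. g j (path j \<omega>)))"
proof (rule indep_vars_lebesgue_integral)
  show "indep_vars (\<lambda>_. borel) (\<lambda>j \<omega>. g j (path j \<omega>)) {..n}"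
    by (rule indep_vars_compose2[OF indep_vars_subset[OF indep]]) (use m in auto)
qed (use i in auto)

lemma L_integrable [simp]: "integrable M (L j s)"
  using L_hi L_pos by (intro integrable_const_bound[where B=hi]) (auto simp: less_imp_le)

lemma LL_integrable [simp]: "integrable M (\<lambda>\<omega>. L j s \<omega> * L j t \<omega>)"
  using L_hi L_pos hi
  by (intro integrable_const_bound[where B="hi * hi"]) (auto simp: abs_mult less_imp_le intro!: mult_mono)

lemma m2_nonneg: "0 \<le> m2"
proof -
  have "0 \<le> expectation (\<lambda>\<omega>. L 0 0 \<omega> * L 0 0 \<omega>)"
    by (intro Bochner_Integration.integral_nonneg) auto
  then show ?thesis using second_moment[of 0 0 0] by linarith
qed

lemma C1_nonneg: "0 \<le> C1"
  using covariance[of 0 0 0] by (simp add: order_trans[OF abs_ge_zero])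

lemma den_diff: "den 0 (Suc n) s \<omega> - den 0 n s \<omega> = den 0 n s \<omega> * (L (Suc n) (s * b ^ Suc n) \<omega> - 1)"
  by (simp add: den_def algebra_simps)

text \<open>The expectation factorises over the layers. Each of the \<open>Suc n\<close> old layers
  contributes at most \<open>m2\<close>; the new one is centred and contributes its covariance at
  the dilated distance \<open>b ^ Suc n * \<bar>s - t\<bar>\<close>.\<close>

lemma den_increment_covariance:
  assumes s: "0 \<le> s" "0 \<le> t"
  shows "\<bar>expectation (\<lambda>\<omega>. (den 0 (Suc n) s \<omega> - den 0 n s \<omega>) * (den 0 (Suc n) t \<omega> - den 0 n t \<omega>))\<bar>
    \<le> C1 * m2 ^ Suc n * exp (- (b ^ Suc n * \<bar>s - t\<bar>))"
proof -
  have bj: "0 \<le> s * b ^ j" "0 \<le> t * b ^ j" for j using s b by auto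
  define g where "g j x = (if j = Suc n then (x (s * b ^ j) - 1) * (x (t * b ^ j) - 1)
      else x (s * b ^ j) * x (t * b ^ j))" for j :: nat and x :: "real \<Rightarrow> real"
  have comp: "(\<lambda>x. x u) \<in> borel_measurable (Pi\<^sub>M {0..} (\<lambda>_. borel :: real measure))" if "0 \<le> u" for u :: real
    using that by (intro measurable_component_singleton) auto
  have gm: "g j \<in> borel_measurable (Pi\<^sub>M {0..} (\<lambda>_. borel))" for j
    using comp[OF bj(1)[of j]] comp[OF bj(2)[of j]] by (cases "j = Suc n") (simp_all add: g_def[abs_def])
  have gp: "g j (path j \<omega>) = (if j = Suc n then (L j (s * b ^ j) \<omega> - 1) * (L j (t * b ^ j) \<omega> - 1)
      else L j (s * b ^ j) \<omega> * L j (t * b ^ j) \<omega>)" for j \<omega>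
    using bj[of j] by (auto simp: g_def simp del: power_Suc)
  have e: "(den 0 (Suc n) s \<omega> - den 0 n s \<omega>) * (den 0 (Suc n) t \<omega> - den 0 n t \<omega>)
      = (\<Prod>j\<le>Suc n. g j (path j \<omega>))" for \<omega>
    unfolding den_diff by (simp add: gp den_def prod.distrib)
  have gi: "integrable M (\<lambda>\<omega>. g j (path j \<omega>))" for j
    by (cases "j = Suc n") (simp_all add: gp algebra_simps)
  have E1: "expectation (\<lambda>\<omega>. g (Suc n) (path (Suc n) \<omega>))
      = expectation (\<lambda>\<omega>. L (Suc n) (s * b ^ Suc n) \<omega> * L (Suc n) (t * b ^ Suc n) \<omega>) - 1"
    using mean[OF bj(1)] mean[OF bj(2)]
    by (simp add: gp algebra_simps prob_space del: power_Suc)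
  have "\<bar>s * b ^ Suc n - t * b ^ Suc n\<bar> = b ^ Suc n * \<bar>s - t\<bar>"
    using b by (simp add: abs_mult flip: left_diff_distrib)
  then have E1': "\<bar>expectation (\<lambda>\<omega>. g (Suc n) (path (Suc n) \<omega>))\<bar> \<le> C1 * exp (- (b ^ Suc n * \<bar>s - t\<bar>))"
    unfolding E1 using covariance[OF bj] by metis
  have E2: "0 \<le> expectation (\<lambda>\<omega>. g j (path j \<omega>))" "expectation (\<lambda>\<omega>. g j (path j \<omega>)) \<le> m2" if "j \<le> n" for j
    using that second_moment[OF bj] L_pos
    by (auto simp: gp less_imp_le intro!: Bochner_Integration.integral_nonneg)
  have "expectation (\<lambda>\<omega>. (den 0 (Suc n) s \<omega> - den 0 n s \<omega>) * (den 0 (Suc n) t \<omega> - den 0 n t \<omega>))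
      = (\<Prod>j\<le>Suc n. expectation (\<lambda>\<omega>. g j (path j \<omega>)))"
    unfolding e by (rule expectation_prod_layers[OF gm gi])
  also have "\<bar>\<dots>\<bar> = (\<Prod>j\<le>n. expectation (\<lambda>\<omega>. g j (path j \<omega>))) * \<bar>expectation (\<lambda>\<omega>. g (Suc n) (path (Suc n) \<omega>))\<bar>"
  proof -
    have "0 \<le> (\<Prod>j\<le>n. expectation (\<lambda>\<omega>. g j (path j \<omega>)))" using E2(1) by (intro prod_nonneg) auto
    then show ?thesis by (simp add: abs_mult)
  qed
  also have "\<dots> \<le> m2 ^ Suc n * (C1 * exp (- (b ^ Suc n * \<bar>s - t\<bar>)))"
  proof (intro mult_mono E1')
    have "(\<Prod>j\<le>n. expectation (\<lambda>\<omega>. g j (path j \<omega>))) \<le> (\<Prod>j\<le>n. m2)"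
      using E2 by (intro prod_mono) auto
    then show "(\<Prod>j\<le>n. expectation (\<lambda>\<omega>. g j (path j \<omega>))) \<le> m2 ^ Suc n" by simp
  qed (use m2_nonneg in auto)
  finally show ?thesis by (simp add: ac_simps)
qed

text \<open>The square is a double integral of increment covariances. Integrating the exponential
  kernel in one variable costs \<open>2 / b ^ Suc n\<close> uniformly in the other one, which turns
  \<open>m2 ^ Suc n\<close> into \<open>(m2 / b) ^ Suc n\<close>.\<close>

lemma mass_increment_L2:
  assumes a: "0 \<le> a" "a \<le> c"
  shows "integrable M (\<lambda>\<omega>. (mass 0 (Suc n) a c \<omega> - mass 0 n a c \<omega>)\<^sup>2)"
    and "expectation (\<lambda>\<omega>. (mass 0 (Suc n) a c \<omega> - mass 0 n a c \<omega>)\<^sup>2) \<le> 2 * C1 * (c - a) * (m2 / b) ^ Suc n"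
proof -
  define f where "f s \<omega> = den 0 (Suc n) s \<omega> - den 0 n s \<omega>" for s \<omega>
  define B where "B = hi ^ Suc (Suc n) + hi ^ Suc n"
  have B: "\<bar>f s \<omega>\<bar> \<le> B" for s \<omega>
    using abs_den_le[of 0 "Suc n" s \<omega>] abs_den_le[of 0 n s \<omega>] by (simp add: f_def B_def)
  have B0: "0 \<le> B" unfolding B_def using hi by (intro add_nonneg_nonneg) (auto simp: less_imp_le)
  have fm[measurable (raw)]: "(\<lambda>x. f (h x) (h' x)) \<in> borel_measurable A"
    if "h \<in> borel_measurable A" "h' \<in> A \<rightarrow>\<^sub>M M" for h h' and A :: "'z measure"
    unfolding f_def using that by measurable
  define D where "D \<omega> = (\<integral>s. indicator {a..c} s * f s \<omega> \<partial>lborel)" for \<omega>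
  have D: "mass 0 (Suc n) a c \<omega> - mass 0 n a c \<omega> = D \<omega>" if "\<omega> \<in> space M" for \<omega>
    unfolding mass_def D_def f_def
    by (subst Bochner_Integration.integral_diff[symmetric]) (use that in \<open>simp_all add: den_integrable algebra_simps\<close>)
  have Dm[measurable]: "D \<in> borel_measurable M"
    unfolding D_def by (rule interval_fubini(1)[where B=B and B'=0 and g="\<lambda>_. 0"]) (use B in auto)
  have ii: "integrable lborel (\<lambda>s. indicator {a..c} s * h s)"
    if "h \<in> borel_measurable borel" "\<And>s. s \<in> {a..c} \<Longrightarrow> \<bar>h s\<bar> \<le> B'" for h :: "real \<Rightarrow> real" and B'
    by (rule integrableI_bounded_set[where A="{a..c}" and B=B'])
      (use that in \<open>auto simp: emeasure_lborel_Icc_eq indicator_def\<close>)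
  have ind: "(\<integral>s. indicator {a..c} s * K \<partial>lborel) = (c - a) * K" for K :: real
    using a by simp
  have DB: "\<bar>D \<omega>\<bar> \<le> (c - a) * B" if "\<omega> \<in> space M" for \<omega>
  proof -
    have "\<bar>D \<omega>\<bar> \<le> (\<integral>s. \<bar>indicator {a..c} s * f s \<omega>\<bar> \<partial>lborel)"
      unfolding D_def by (rule integral_abs_bound)
    also have "\<dots> = (\<integral>s. indicator {a..c} s * \<bar>f s \<omega>\<bar> \<partial>lborel)"
      by (simp add: abs_mult)
    also have "\<dots> \<le> (\<integral>s. indicator {a..c} s * B \<partial>lborel)"
      by (intro integral_mono ii[of _ B]) (use B B0 that in \<open>auto intro!: mult_left_mono\<close>)
    finally show ?thesis unfolding ind .
  qed
  \<comment> \<open>One factor is kept as the weight \<open>D\<close> and the other is expanded;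
    inside the resulting expectation \<open>D\<close> is then expanded in turn.\<close>
  have sq: "(mass 0 (Suc n) a c \<omega> - mass 0 n a c \<omega>)\<^sup>2 = D \<omega> * (\<integral>s. indicator {a..c} s * f s \<omega> \<partial>lborel)"
    if "\<omega> \<in> space M" for \<omega>
    using D[OF that] that by (simp add: D_def power2_eq_square)
  note F = interval_fubini[where f=f and a=a and c=c and B=B and g=D and B'="(c - a) * B"]
  show "integrable M (\<lambda>\<omega>. (mass 0 (Suc n) a c \<omega> - mass 0 n a c \<omega>)\<^sup>2)"
    using F(2)[OF _ B Dm DB] by (simp add: sq cong: Bochner_Integration.integrable_cong)
  define q where "q = C1 * m2 ^ Suc n"
  have q0: "0 \<le> q" unfolding q_def using C1_nonneg m2_nonneg by auto
  have inner: "expectation (\<lambda>\<omega>. D \<omega> * f s \<omega>) \<le> q * (2 / b ^ Suc n)" if s: "s \<in> {a..c}" for s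
  proof -
    have "expectation (\<lambda>\<omega>. D \<omega> * f s \<omega>) = expectation (\<lambda>\<omega>. f s \<omega> * (\<integral>t. indicator {a..c} t * f t \<omega> \<partial>lborel))"
      by (simp add: D_def mult.commute)
    also have "\<dots> = (\<integral>t. indicator {a..c} t * expectation (\<lambda>\<omega>. f s \<omega> * f t \<omega>) \<partial>lborel)"
      using B by (intro interval_fubini(3)[where B=B and B'=B]) auto
    also have "\<dots> \<le> (\<integral>t. q * (indicator {a..c} t * exp (- (b ^ Suc n * \<bar>s - t\<bar>))) \<partial>lborel)"
    proof (rule integral_mono)
      have EB: "\<bar>expectation (\<lambda>\<omega>. f s \<omega> * f t \<omega>)\<bar> \<le> q * exp (- (b ^ Suc n * \<bar>s - t\<bar>))" if "t \<in> {a..c}" for t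
        unfolding f_def q_def using den_increment_covariance[of s t n] a s that by auto
      have EB': "\<bar>expectation (\<lambda>\<omega>. f s \<omega> * f t \<omega>)\<bar> \<le> q" if "t \<in> {a..c}" for t
      proof -
        have "q * exp (- (b ^ Suc n * \<bar>s - t\<bar>)) \<le> q * 1" using b q0 by (intro mult_left_mono) auto
        then show ?thesis using EB[OF that] by linarith
      qed
      show "integrable lborel (\<lambda>t. indicator {a..c} t * expectation (\<lambda>\<omega>. f s \<omega> * f t \<omega>))"
        by (rule ii[OF _ EB']) measurable
      show "integrable lborel (\<lambda>t. q * (indicator {a..c} t * exp (- (b ^ Suc n * \<bar>s - t\<bar>))))"
        by (intro integrable_mult_right ii[of _ 1]) (use b in auto)
      show "indicator {a..c} t * expectation (\<lambda>\<omega>. f s \<omega> * f t \<omega>)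
          \<le> q * (indicator {a..c} t * exp (- (b ^ Suc n * \<bar>s - t\<bar>)))" for t
        using EB[of t] by (auto simp: indicator_def)
    qed
    also have "\<dots> \<le> q * (2 / b ^ Suc n)"
      unfolding integral_mult_right_zero
      using b by (intro mult_left_mono integral_exp_abs_le q0) auto
    finally show ?thesis .
  qed
  have innerB: "\<bar>expectation (\<lambda>\<omega>. D \<omega> * f s \<omega>)\<bar> \<le> (c - a) * B * B" for s
  proof -
    have B1: "0 \<le> (c - a) * B" using B0 a by simp
    have "\<bar>expectation (\<lambda>\<omega>. D \<omega> * f s \<omega>)\<bar> \<le> expectation (\<lambda>\<omega>. \<bar>D \<omega> * f s \<omega>\<bar>)"
      by (rule integral_abs_bound)
    also have "\<dots> \<le> expectation (\<lambda>\<omega>. (c - a) * B * B)"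
    proof (rule integral_mono')
      show "\<bar>D \<omega> * f s \<omega>\<bar> \<le> (c - a) * B * B" if "\<omega> \<in> space M" for \<omega>
        unfolding abs_mult using DB[OF that] B B1 by (intro mult_mono) auto
      show "0 \<le> (c - a) * B * B" using B1 B0 by (rule mult_nonneg_nonneg)
    qed auto
    finally show ?thesis by (simp add: prob_space)
  qed
  have "expectation (\<lambda>\<omega>. (mass 0 (Suc n) a c \<omega> - mass 0 n a c \<omega>)\<^sup>2)
      = expectation (\<lambda>\<omega>. D \<omega> * (\<integral>s. indicator {a..c} s * f s \<omega> \<partial>lborel))"
    by (intro Bochner_Integration.integral_cong refl sq)
  also have "\<dots> = (\<integral>s. indicator {a..c} s * expectation (\<lambda>\<omega>. D \<omega> * f s \<omega>) \<partial>lborel)"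
    by (rule F(3)[OF _ B Dm DB]) measurable
  also have "\<dots> \<le> (\<integral>s. indicator {a..c} s * (q * (2 / b ^ Suc n)) \<partial>lborel)"
    using b q0 inner
    by (intro integral_mono ii[OF _ innerB] ii[of _ "q * (2 / b ^ Suc n)"])
      (measurable, auto intro!: mult_left_mono simp: indicator_def)
  also have "\<dots> = (c - a) * (q * (2 / b ^ Suc n))" by (rule ind)
  finally show "expectation (\<lambda>\<omega>. (mass 0 (Suc n) a c \<omega> - mass 0 n a c \<omega>)\<^sup>2) \<le> 2 * C1 * (c - a) * (m2 / b) ^ Suc n"
    by (simp add: q_def power_divide field_simps)
qed

end

section \<open>Convergence of the masses\<close>

text \<open>With the weights \<open>\<rho> ^ j\<close>, Cauchy-Schwarz bounds the squared distance
  of \<open>Z k\<close> and \<open>Z n\<close> by \<open>\<rho> ^ n / (1 - \<rho>)\<close> times one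
  integrable function \<open>G\<close>, for all \<open>k \<ge> n\<close> at once. This single bound
  yields almost sure convergence, integrability and convergence in L2 to an explicitly measurable
  limit.\<close>

lemma (in prob_space) geometric_L2_limit:
  fixes Z :: "nat \<Rightarrow> 'a \<Rightarrow> real"
  assumes m[measurable]: "\<And>n. Z n \<in> borel_measurable M"
    and i: "\<And>n. integrable M (\<lambda>x. (Z (Suc n) x - Z n x)\<^sup>2)"
    and le: "\<And>n. expectation (\<lambda>x. (Z (Suc n) x - Z n x)\<^sup>2) \<le> K * r ^ n"
    and r: "0 \<le> r" "r < 1"
  defines "Z' \<equiv> \<lambda>x. if convergent (\<lambda>n. Z n x) then lim (\<lambda>n. Z n x) else 0"
  shows "Z' \<in> borel_measurable M" and "AE x in M. (\<lambda>n. Z n x) \<longlonglongrightarrow> Z' x"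
    and "\<And>n. integrable M (\<lambda>x. (Z n x - Z' x)\<^sup>2)"
    and "(\<lambda>n. expectation (\<lambda>x. (Z n x - Z' x)\<^sup>2)) \<longlonglongrightarrow> 0"
proof -
  \<comment> \<open>Strictly between \<open>r\<close> and 1: below 1 for the geometric tail, above
    \<open>r\<close> so that the series of the weighted squares still has finite mean.\<close>
  define \<rho> where "\<rho> = (1 + r) / 2"
  have \<rho>: "0 < \<rho>" "\<rho> < 1" "r < \<rho>" using r by (auto simp: \<rho>_def)
  define d where "d n x = Z (Suc n) x - Z n x" for n x
  define f where "f n x = (d n x)\<^sup>2 / \<rho> ^ n" for n x
  have f0: "0 \<le> f n x" for n x using \<rho> by (simp add: f_def)
  have fi: "integrable M (f n)" for n using i[of n] by (simp add: f_def[abs_def] d_def)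
  have fle: "(\<integral>x. \<bar>f n x\<bar> \<partial>M) \<le> K * (r / \<rho>) ^ n" for n
    using le[of n] \<rho> f0 by (simp add: f_def d_def power_divide divide_right_mono)
  have sK: "summable (\<lambda>n. K * (r / \<rho>) ^ n)" using r \<rho> by (intro summable_mult summable_geometric) auto
  have AEs: "AE x in M. summable (\<lambda>n. \<bar>f n x\<bar>)" by (rule AE_summable_abs[OF fi fle sK])
  define G where "G x = (\<Sum>n. f n x)" for x
  have Gi: "integrable M G"
    unfolding G_def
  proof (rule integrable_suminf[OF fi])
    show "AE x in M. summable (\<lambda>n. norm (f n x))" using AEs by simp
    show "summable (\<lambda>n. expectation (\<lambda>x. norm (f n x)))"
      by (rule summable_comparison_test'[OF sK]) (use fle in auto)
  qed
  have bound: "(Z k x - Z n x)\<^sup>2 \<le> \<rho> ^ n / (1 - \<rho>) * G x" if "n \<le> k" "summable (\<lambda>n. \<bar>f n x\<bar>)" for n k x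
  proof -
    have sf: "summable (\<lambda>n. f n x)" using that(2) f0 by simp
    have "Z k x - Z n x = (\<Sum>j\<in>{n..<k}. d j x)"
      using sum_Suc_diff'[of n k "\<lambda>n. Z n x"] that by (simp add: d_def)
    also have "\<dots> = (\<Sum>j\<in>{n..<k}. sqrt \<rho> ^ j * (d j x / sqrt \<rho> ^ j))" using \<rho> by simp
    finally have "(Z k x - Z n x)\<^sup>2 \<le> (\<Sum>j\<in>{n..<k}. (sqrt \<rho> ^ j)\<^sup>2) * (\<Sum>j\<in>{n..<k}. (d j x / sqrt \<rho> ^ j)\<^sup>2)"
      using Cauchy_Schwarz_ineq_sum by metis
    also have "(\<Sum>j\<in>{n..<k}. (sqrt \<rho> ^ j)\<^sup>2) = (\<Sum>j\<in>{n..<k}. \<rho> ^ j)"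
      using \<rho> by (simp add: power_mult[symmetric] mult.commute[of _ 2] power_mult)
    also have "(\<Sum>j\<in>{n..<k}. (d j x / sqrt \<rho> ^ j)\<^sup>2) = (\<Sum>j\<in>{n..<k}. f j x)"
      using \<rho> by (simp add: f_def power_divide power_mult[symmetric] mult.commute[of _ 2] power_mult)
    also have "(\<Sum>j\<in>{n..<k}. \<rho> ^ j) = (\<rho> ^ n - \<rho> ^ k) / (1 - \<rho>)"
    proof -
      have "(1 - \<rho>) * (\<Sum>j\<in>{n..<k}. \<rho> ^ j) = (\<Sum>j\<in>{n..<k}. (- (\<rho> ^ Suc j)) - (- (\<rho> ^ j)))"
        by (simp add: sum_distrib_left algebra_simps)
      also have "\<dots> = \<rho> ^ n - \<rho> ^ k" using sum_Suc_diff'[OF \<open>n \<le> k\<close>, of "\<lambda>j. - (\<rho> ^ j)"] by simp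
      finally show ?thesis using \<rho> by (simp add: field_simps)
    qed
    also have "(\<rho> ^ n - \<rho> ^ k) / (1 - \<rho>) * (\<Sum>j\<in>{n..<k}. f j x) \<le> \<rho> ^ n / (1 - \<rho>) * G x"
    proof (rule mult_mono)
      show "(\<Sum>j\<in>{n..<k}. f j x) \<le> G x" unfolding G_def by (rule sum_le_suminf[OF sf]) (use f0 in auto)
    qed (use \<rho> f0 in \<open>auto simp: sum_nonneg divide_right_mono\<close>)
    finally show ?thesis .
  qed
  have to0: "(\<lambda>n. \<rho> ^ n / (1 - \<rho>) * c) \<longlonglongrightarrow> 0" for c
  proof -
    have "(\<lambda>n. \<rho> ^ n / (1 - \<rho>) * c) \<longlonglongrightarrow> 0 / (1 - \<rho>) * c"
      using \<rho> by (intro tendsto_intros LIMSEQ_power_zero) auto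
    then show ?thesis by simp
  qed
  have conv: "(\<lambda>n. Z n x) \<longlonglongrightarrow> Z' x" if s: "summable (\<lambda>n. \<bar>f n x\<bar>)" for x
  proof -
    have "Cauchy (\<lambda>n. Z n x)"
    proof (rule CauchyI')
      fix e :: real assume e: "0 < e"
      then have "\<forall>\<^sub>F n in sequentially. \<rho> ^ n / (1 - \<rho>) * G x < e\<^sup>2"
        using to0[of "G x"] by (intro order_tendstoD) auto
      then obtain n0 where n0: "\<And>n. n \<ge> n0 \<Longrightarrow> \<rho> ^ n / (1 - \<rho>) * G x < e\<^sup>2"
        by (auto simp: eventually_sequentially)
      have "norm (Z m x - Z n x) < e" if "n0 \<le> m" "m < n" for m n
      proof -
        have "(Z n x - Z m x)\<^sup>2 < e\<^sup>2" using bound[OF less_imp_le[OF that(2)] s] n0[OF that(1)] by linarith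
        then show ?thesis
          using power2_less_imp_less[of "\<bar>Z n x - Z m x\<bar>" e] e
          by (simp add: abs_minus_commute power2_commute)
      qed
      then show "\<exists>n0. \<forall>m\<ge>n0. \<forall>n>m. dist (Z m x) (Z n x) < e"
        unfolding dist_norm by blast
    qed
    then have "convergent (\<lambda>n. Z n x)" by (rule Cauchy_convergent)
    then show ?thesis by (simp add: Z'_def convergent_LIMSEQ_iff)
  qed
  show AEc: "AE x in M. (\<lambda>n. Z n x) \<longlonglongrightarrow> Z' x" using AEs by eventually_elim (rule conv)
  show Z'm[measurable]: "Z' \<in> borel_measurable M" unfolding Z'_def Cauchy_convergent_iff[symmetric] by measurable
  have AEb: "AE x in M. (Z n x - Z' x)\<^sup>2 \<le> \<rho> ^ n / (1 - \<rho>) * G x" for n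
    using AEs
  proof eventually_elim
    fix x assume s: "summable (\<lambda>n. \<bar>f n x\<bar>)"
    have "(\<lambda>k. (Z k x - Z n x)\<^sup>2) \<longlonglongrightarrow> (Z' x - Z n x)\<^sup>2" by (intro tendsto_intros conv s)
    then have "(Z' x - Z n x)\<^sup>2 \<le> \<rho> ^ n / (1 - \<rho>) * G x"
      by (rule LIMSEQ_le_const2) (use bound[OF _ s] in blast)
    then show "(Z n x - Z' x)\<^sup>2 \<le> \<rho> ^ n / (1 - \<rho>) * G x" by (simp add: power2_commute)
  qed
  show sqi: "integrable M (\<lambda>x. (Z n x - Z' x)\<^sup>2)" for n
  proof (rule Bochner_Integration.integrable_bound)
    show "integrable M (\<lambda>x. \<rho> ^ n / (1 - \<rho>) * G x)" using Gi by simp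
    show "AE x in M. norm ((Z n x - Z' x)\<^sup>2) \<le> norm (\<rho> ^ n / (1 - \<rho>) * G x)"
      using AEb[of n]
      by eventually_elim (simp only: real_norm_def abs_power2 order_trans[OF _ abs_ge_self])
  qed measurable
  show "(\<lambda>n. expectation (\<lambda>x. (Z n x - Z' x)\<^sup>2)) \<longlonglongrightarrow> 0"
  proof (rule tendsto_sandwich[OF _ _ tendsto_const to0[of "expectation G"]])
    have "expectation (\<lambda>x. (Z n x - Z' x)\<^sup>2) \<le> expectation (\<lambda>x. \<rho> ^ n / (1 - \<rho>) * G x)" for n
      using Gi by (intro integral_mono_AE sqi AEb) auto
    then show "\<forall>\<^sub>F n in sequentially. expectation (\<lambda>x. (Z n x - Z' x)\<^sup>2) \<le> \<rho> ^ n / (1 - \<rho>) * expectation G"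
      by simp
  qed simp
qed

section \<open>The limit masses and their mean\<close>

context cascade
begin

text \<open>Each interval has its own limit and its own exceptional null set, so additivity in the
  endpoints holds almost surely only. The default 0 keeps the limit nonnegative everywhere.\<close>

definition lmass :: "real \<Rightarrow> real \<Rightarrow> 'w \<Rightarrow> real" where
  "lmass a c \<omega> = (if convergent (\<lambda>n. mass 0 n a c \<omega>) then lim (\<lambda>n. mass 0 n a c \<omega>) else 0)"

lemma
  assumes "0 \<le> a" "a \<le> c"
  shows lmass_measurable: "lmass a c \<in> borel_measurable M"
    and mass_tendsto: "AE \<omega> in M. (\<lambda>n. mass 0 n a c \<omega>) \<longlonglongrightarrow> lmass a c \<omega>"
    and mass_lmass_integrable: "integrable M (\<lambda>\<omega>. (mass 0 n a c \<omega> - lmass a c \<omega>)\<^sup>2)"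
    and mass_tendsto_L2: "(\<lambda>n. expectation (\<lambda>\<omega>. (mass 0 n a c \<omega> - lmass a c \<omega>)\<^sup>2)) \<longlonglongrightarrow> 0"
proof -
  have le: "expectation (\<lambda>\<omega>. (mass 0 (Suc n) a c \<omega> - mass 0 n a c \<omega>)\<^sup>2)
      \<le> 2 * C1 * (c - a) * (m2 / b) * (m2 / b) ^ n" for n
    using mass_increment_L2(2)[OF assms, of n] by (simp add: mult.assoc)
  have r: "0 \<le> m2 / b" "m2 / b < 1" using m2 b m2_nonneg by auto
  note * = geometric_L2_limit[OF mass_measurable mass_increment_L2(1)[OF assms] le r, folded lmass_def]
  show "lmass a c \<in> borel_measurable M" "AE \<omega> in M. (\<lambda>n. mass 0 n a c \<omega>) \<longlonglongrightarrow> lmass a c \<omega>"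
    "integrable M (\<lambda>\<omega>. (mass 0 n a c \<omega> - lmass a c \<omega>)\<^sup>2)"
    "(\<lambda>n. expectation (\<lambda>\<omega>. (mass 0 n a c \<omega> - lmass a c \<omega>)\<^sup>2)) \<longlonglongrightarrow> 0"
    using * by (simp_all add: lmass_def[abs_def])
qed

lemma lmass_nonneg: "0 \<le> lmass a c \<omega>"
proof (cases "convergent (\<lambda>n. mass 0 n a c \<omega>)")
  case True
  then have "(\<lambda>n. mass 0 n a c \<omega>) \<longlonglongrightarrow> lmass a c \<omega>"
    by (simp add: lmass_def convergent_LIMSEQ_iff)
  then show ?thesis by (rule LIMSEQ_le_const) (auto simp: mass_nonneg)
qed (simp add: lmass_def)

lemma mass_le: "\<omega> \<in> space M \<Longrightarrow> a \<le> c \<Longrightarrow> mass i n a c \<omega> \<le> (c - a) * hi ^ Suc n"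
proof -
  assume *: "\<omega> \<in> space M" "a \<le> c"
  have "mass i n a c \<omega> \<le> (\<integral>s. indicator {a..c} s * hi ^ Suc n \<partial>lborel)"
    unfolding mass_def
  proof (intro integral_mono den_integrable *)
    show "integrable lborel (\<lambda>s. indicator {a..c} s * hi ^ Suc n)"
      by (intro integrable_mult_left integrable_real_indicator) (auto simp: emeasure_lborel_Icc_eq)
    show "indicator {a..c} s * den i n s \<omega> \<le> indicator {a..c} s * hi ^ Suc n" for s
      by (intro mult_left_mono den_le) auto
  qed
  then show ?thesis using * by simp
qed

lemma mass_sq_integrable: "a \<le> c \<Longrightarrow> integrable M (\<lambda>\<omega>. (mass i n a c \<omega>)\<^sup>2)"
proof (rule integrable_const_bound[where B="((c - a) * hi ^ Suc n)\<^sup>2"])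
  assume "a \<le> c"
  then show "AE \<omega> in M. norm ((mass i n a c \<omega>)\<^sup>2) \<le> ((c - a) * hi ^ Suc n)\<^sup>2"
    using mass_le mass_nonneg by (intro AE_I2) (auto intro!: power_mono simp del: power_Suc)
qed measurable

lemma lmass_sq_integrable:
  assumes "0 \<le> a" "a \<le> c"
  shows "integrable M (\<lambda>\<omega>. (lmass a c \<omega>)\<^sup>2)"
proof (rule Bochner_Integration.integrable_bound)
  have [measurable]: "lmass a c \<in> borel_measurable M" by (rule lmass_measurable[OF assms])
  show "integrable M (\<lambda>\<omega>. 2 * (mass 0 0 a c \<omega> - lmass a c \<omega>)\<^sup>2 + 2 * (mass 0 0 a c \<omega>)\<^sup>2)"
    using mass_lmass_integrable[OF assms] mass_sq_integrable[OF assms(2)] by simp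
  show "AE \<omega> in M. norm ((lmass a c \<omega>)\<^sup>2) \<le> norm (2 * (mass 0 0 a c \<omega> - lmass a c \<omega>)\<^sup>2 + 2 * (mass 0 0 a c \<omega>)\<^sup>2)"
  proof (intro AE_I2)
    fix \<omega>
    have "2 * (x - y)\<^sup>2 + 2 * x\<^sup>2 - y\<^sup>2 = (2 * x - y)\<^sup>2" for x y :: real
      by (simp add: power2_eq_square algebra_simps)
    from this[of "mass 0 0 a c \<omega>" "lmass a c \<omega>"]
    have "(lmass a c \<omega>)\<^sup>2 \<le> 2 * (mass 0 0 a c \<omega> - lmass a c \<omega>)\<^sup>2 + 2 * (mass 0 0 a c \<omega>)\<^sup>2"
      using zero_le_power2[of "2 * mass 0 0 a c \<omega> - lmass a c \<omega>"] by linarith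
    then show "norm ((lmass a c \<omega>)\<^sup>2) \<le> norm (2 * (mass 0 0 a c \<omega> - lmass a c \<omega>)\<^sup>2 + 2 * (mass 0 0 a c \<omega>)\<^sup>2)"
      by simp
  qed
  show "(\<lambda>\<omega>. (lmass a c \<omega>)\<^sup>2) \<in> borel_measurable M" by measurable
qed

lemma expectation_den: "0 \<le> s \<Longrightarrow> expectation (den 0 n s) = 1"
proof -
  assume s: "0 \<le> s"
  have sb: "0 \<le> s * b ^ j" for j using s b by simp
  have "expectation (\<lambda>\<omega>. \<Prod>j\<le>n. path j \<omega> (s * b ^ j)) = (\<Prod>j\<le>n. expectation (\<lambda>\<omega>. path j \<omega> (s * b ^ j)))"
    using sb by (intro expectation_prod_layers[where g="\<lambda>j x. x (s * b ^ j)"] measurable_component_singleton) auto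
  then show ?thesis using sb mean by (simp add: den_def[abs_def])
qed

lemma expectation_mass:
  assumes "0 \<le> a" "a \<le> c"
  shows "expectation (mass 0 n a c) = c - a"
proof -
  have "expectation (\<lambda>\<omega>. 1 * (\<integral>s. indicator {a..c} s * den 0 n s \<omega> \<partial>lborel))
      = (\<integral>s. indicator {a..c} s * expectation (\<lambda>\<omega>. 1 * den 0 n s \<omega>) \<partial>lborel)"
    by (rule interval_fubini(3)[where B="hi ^ Suc n" and B'=1]) (auto simp: abs_den_le simp del: power_Suc)
  also have "\<dots> = (\<integral>s. indicator {a..c} s \<partial>lborel)"
    using assms expectation_den[of _ n] by (intro Bochner_Integration.integral_cong) (auto simp: indicator_def)
  finally show ?thesis using assms by (simp add: mass_def[abs_def])
qed

lemma lmass_integrable: "0 \<le> a \<Longrightarrow> a \<le> c \<Longrightarrow> integrable M (lmass a c)"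
  using square_integrable_imp_integrable[OF lmass_measurable lmass_sq_integrable] by blast

text \<open>All approximations have mean \<open>c - a\<close>, and convergence in L2 preserves it.
  This is what excludes a degenerate limit when lower bounds on moments are derived.\<close>

lemma expectation_lmass:
  assumes "0 \<le> a" "a \<le> c"
  shows "expectation (lmass a c) = c - a"
proof -
  have [measurable]: "lmass a c \<in> borel_measurable M" by (rule lmass_measurable[OF assms])
  have mi: "integrable M (mass 0 n a c)" for n
    using square_integrable_imp_integrable[OF mass_measurable mass_sq_integrable[OF assms(2)]] .
  have "(\<lambda>n. sqrt (expectation (\<lambda>\<omega>. (mass 0 n a c \<omega> - lmass a c \<omega>)\<^sup>2))) \<longlonglongrightarrow> sqrt 0"
    by (intro tendsto_real_sqrt mass_tendsto_L2 assms)
  moreover have "\<bar>(c - a) - expectation (lmass a c)\<bar> \<le> sqrt (expectation (\<lambda>\<omega>. (mass 0 n a c \<omega> - lmass a c \<omega>)\<^sup>2))" for n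
  proof -
    let ?D = "\<lambda>\<omega>. mass 0 n a c \<omega> - lmass a c \<omega>"
    have Di: "integrable M ?D" using mi lmass_integrable[OF assms] by simp
    have "0 \<le> variance ?D" by (rule variance_positive)
    then have "(expectation ?D)\<^sup>2 \<le> expectation (\<lambda>\<omega>. (?D \<omega>)\<^sup>2)"
      using variance_eq[OF Di mass_lmass_integrable[OF assms]] by simp
    then have "\<bar>expectation ?D\<bar> \<le> sqrt (expectation (\<lambda>\<omega>. (?D \<omega>)\<^sup>2))"
      using real_le_rsqrt real_sqrt_abs real_sqrt_le_mono by metis
    moreover have "expectation ?D = (c - a) - expectation (lmass a c)"
      using expectation_mass[OF assms] mi lmass_integrable[OF assms] by simp
    ultimately show ?thesis by simp
  qed
  ultimately have "\<bar>(c - a) - expectation (lmass a c)\<bar> \<le> 0"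
    using LIMSEQ_le_const[of _ 0 "\<bar>(c - a) - expectation (lmass a c)\<bar>"] by fastforce
  then show ?thesis by simp
qed

end

section \<open>Riemann sums and scale recursion\<close>

lemma measurable_component_component:
  assumes "j \<in> J" "u \<in> T"
  shows "(\<lambda>x. x j u) \<in> Pi\<^sub>M J (\<lambda>_. Pi\<^sub>M T (\<lambda>_. N)) \<rightarrow>\<^sub>M N"
  by (rule measurable_compose[OF measurable_component_singleton[OF assms(1)]
        measurable_component_singleton[OF assms(2), of "\<lambda>_. N"]])

context cascade
begin

text \<open>Riemann sums only involve finite-dimensional distributions, so that stationarity and the
  equality in law of the layers apply to them directly, without a regular version of the paths.\<close>

lemma riemann_law:
  assumes a: "0 \<le> a" "0 \<le> t" "0 < k" and \<phi>[measurable]: "\<phi> \<in> borel_measurable borel"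
  shows "expectation (\<lambda>\<omega>. \<phi> (riemann i n a t k \<omega>) :: real) = expectation (\<lambda>\<omega>. \<phi> (riemann 0 n 0 t k \<omega>))"
proof -
  define P where "P = Pi\<^sub>M {..<k} (\<lambda>_. borel :: real measure)"
  \<comment> \<open>Layer \<open>j\<close> sees the grid dilated by \<open>b ^ j\<close>. It remains
    equispaced, so \<open>law\<close> applies to every layer separately and independence assembles
    the joint law.\<close>
  define V where "V i a j \<omega> = (\<lambda>r\<in>{..<k}. L (i + j) (a * b ^ j + t / real k * b ^ j * real r) \<omega>)"
    for i a and j :: nat and \<omega>
  define F where "F v = \<phi> (t / real k * (\<Sum>r<k. \<Prod>j\<le>n. v j r))" for v :: "nat \<Rightarrow> nat \<Rightarrow> real"
  have Vm[measurable]: "V i a j \<in> M \<rightarrow>\<^sub>M P" for i a j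
    unfolding V_def P_def by measurable
  have comp: "(\<lambda>v. v j r) \<in> borel_measurable (Pi\<^sub>M {..n} (\<lambda>_. P))" if "j \<le> n" "r < k" for j r
    unfolding P_def using that by (intro measurable_component_component) auto
  have Fm: "F \<in> borel_measurable (Pi\<^sub>M {..n} (\<lambda>_. P))"
    unfolding F_def using comp by measurable
  have E: "expectation (\<lambda>\<omega>. \<phi> (riemann i n a t k \<omega>)) = (\<integral>v. F v \<partial>Pi\<^sub>M {..n} (\<lambda>j. distr M P (V i a j)))"
    if a: "0 \<le> a" for i a
  proof -
    have "indep_vars (\<lambda>_. Pi\<^sub>M {0..} (\<lambda>_. borel)) (\<lambda>j. path (i + j)) {..n}"
      by (rule indep_vars_reindex[where f="\<lambda>j. i + j", OF indep_vars_subset[OF indep]]) auto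
    then have "indep_vars (\<lambda>_. P) (\<lambda>j \<omega>. (\<lambda>r\<in>{..<k}. path (i + j) \<omega> (a * b ^ j + t / real k * b ^ j * real r))) {..n}"
    proof (rule indep_vars_compose2[where Y="\<lambda>j x. \<lambda>r\<in>{..<k}. x (a * b ^ j + t / real k * b ^ j * real r)"])
      fix j assume "j \<in> {..n}"
      show "(\<lambda>x. \<lambda>r\<in>{..<k}. x (a * b ^ j + t / real k * b ^ j * real r))
          \<in> Pi\<^sub>M {0..} (\<lambda>_. borel) \<rightarrow>\<^sub>M P"
        unfolding P_def using a \<open>0 \<le> t\<close> b
        by (intro measurable_restrict measurable_component_singleton) auto
    qed
    also have "(\<lambda>j \<omega>. (\<lambda>r\<in>{..<k}. path (i + j) \<omega> (a * b ^ j + t / real k * b ^ j * real r))) = V i a"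
      using a \<open>0 \<le> t\<close> b by (auto simp: V_def fun_eq_iff restrict_def)
    finally have "indep_vars (\<lambda>_. P) (V i a) {..n}" .
    then have D: "distr M (Pi\<^sub>M {..n} (\<lambda>_. P)) (\<lambda>\<omega>. \<lambda>j\<in>{..n}. V i a j \<omega>)
        = Pi\<^sub>M {..n} (\<lambda>j. distr M P (V i a j))"
      by (subst (asm) indep_vars_iff_distr_eq_PiM') auto
    have "riemann i n a t k \<omega> = t / real k * (\<Sum>r<k. \<Prod>j\<le>n. (\<lambda>j\<in>{..n}. V i a j \<omega>) j r)" for \<omega>
      unfolding riemann_def den_def V_def
      by (intro arg_cong2[of _ _ _ _ "(*)"] sum.cong prod.cong refl) (auto simp: algebra_simps)
    then have "expectation (\<lambda>\<omega>. \<phi> (riemann i n a t k \<omega>)) = expectation (\<lambda>\<omega>. F (\<lambda>j\<in>{..n}. V i a j \<omega>))"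
      by (simp add: F_def)
    also have "\<dots> = (\<integral>v. F v \<partial>distr M (Pi\<^sub>M {..n} (\<lambda>_. P)) (\<lambda>\<omega>. \<lambda>j\<in>{..n}. V i a j \<omega>))"
      by (subst integral_distr[OF _ Fm]) measurable
    finally show ?thesis unfolding D .
  qed
  have "distr M P (V i a j) = distr M P (V 0 0 j)" for j
  proof -
    have "0 \<le> a * b ^ j" "0 \<le> t / real k * b ^ j" using a b by auto
    note * = law[OF this \<open>0 < k\<close>] law[OF order_refl this(2) \<open>0 < k\<close>]
    show ?thesis unfolding V_def P_def using *(1)[of "i + j"] *(2)[of j] by simp
  qed
  then show ?thesis using E[OF a(1), of i] E[of 0 0] by simp
qed

section \<open>Mean error of the Riemann sums\<close>

text \<open>The densities at \<open>s\<close> and \<open>t\<close> differ only if some layer changes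
  between its dilated times, and then by at most \<open>hi ^ Suc n\<close>, since both lie between 0
  and this bound. This continuity in mean stands in for regularity of the paths.\<close>

lemma den_modulus:
  assumes s: "0 \<le> s" "0 \<le> t"
  shows "expectation (\<lambda>\<omega>. \<bar>den i n s \<omega> - den i n t \<omega>\<bar>) \<le> hi ^ Suc n * C2 * (\<Sum>j\<le>n. b ^ j) * \<bar>s - t\<bar>"
proof -
  define S where "S j = {\<omega> \<in> space M. L (i + j) (s * b ^ j) \<omega> \<noteq> L (i + j) (t * b ^ j) \<omega>}" for j
  have S[measurable]: "S j \<in> events" for j unfolding S_def by measurable
  have Si: "S j \<inter> space M = S j" for j by (auto simp: S_def)
  have "expectation (\<lambda>\<omega>. \<bar>den i n s \<omega> - den i n t \<omega>\<bar>) \<le> expectation (\<lambda>\<omega>. \<Sum>j\<le>n. hi ^ Suc n * indicator (S j) \<omega>)"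
  proof (rule integral_mono')
    show "integrable M (\<lambda>\<omega>. \<Sum>j\<le>n. hi ^ Suc n * indicator (S j) \<omega>)"
      by (intro Bochner_Integration.integrable_sum integrable_mult_right integrable_real_indicator S)
        (auto simp: emeasure_eq_measure)
    show "0 \<le> (\<Sum>j\<le>n. hi ^ Suc n * indicator (S j) \<omega>)" for \<omega>
      using hi by (intro sum_nonneg) auto
    fix \<omega> assume \<omega>: "\<omega> \<in> space M"
    show "\<bar>den i n s \<omega> - den i n t \<omega>\<bar> \<le> (\<Sum>j\<le>n. hi ^ Suc n * indicator (S j) \<omega>)"
    proof (cases "\<exists>j\<le>n. \<omega> \<in> S j")
      case True
      then obtain j where j: "j \<le> n" "\<omega> \<in> S j" by blast
      have "\<bar>den i n s \<omega> - den i n t \<omega>\<bar> \<le> hi ^ Suc n"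
        using den_le[of i n s \<omega>] den_pos[of i n s \<omega>] den_le[of i n t \<omega>] den_pos[of i n t \<omega>] by linarith
      also have "\<dots> = hi ^ Suc n * indicator (S j) \<omega>" using j by simp
      also have "\<dots> \<le> (\<Sum>j\<le>n. hi ^ Suc n * indicator (S j) \<omega>)"
        using j hi by (intro member_le_sum) auto
      finally show ?thesis .
    next
      case False
      then have "den i n s \<omega> = den i n t \<omega>"
        unfolding den_def using \<omega> by (intro prod.cong refl) (auto simp: S_def)
      then show ?thesis using hi by (auto intro!: sum_nonneg)
    qed
  qed
  also have "\<dots> = (\<Sum>j\<le>n. hi ^ Suc n * prob (S j))"
    by (subst Bochner_Integration.integral_sum)
      (auto intro!: integrable_mult_right integrable_real_indicator S simp: emeasure_eq_measure Si)
  also have "\<dots> \<le> (\<Sum>j\<le>n. hi ^ Suc n * (C2 * (b ^ j * \<bar>s - t\<bar>)))"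
  proof (intro sum_mono mult_left_mono)
    fix j
    have "0 \<le> s * b ^ j" "0 \<le> t * b ^ j" using s b by auto
    from change[OF this, of "i + j"]
    show "prob (S j) \<le> C2 * (b ^ j * \<bar>s - t\<bar>)"
      using b unfolding S_def by (simp add: abs_mult flip: left_diff_distrib) (simp add: mult.commute)
  qed (use hi in auto)
  also have "\<dots> = hi ^ Suc n * C2 * (\<Sum>j\<le>n. b ^ j) * \<bar>s - t\<bar>"
    by (simp add: sum_distrib_left sum_distrib_right ac_simps)
  finally show ?thesis .
qed

lemma C2_nonneg: "0 \<le> C2"
  using order_trans[OF measure_nonneg change[of 0 1 0]] by simp

lemma mass_cell_riemann:
  assumes a: "0 \<le> a" "a \<le> c"
  shows "expectation (\<lambda>\<omega>. \<bar>mass i n a c \<omega> - (c - a) * den i n a \<omega>\<bar>)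
    \<le> hi ^ Suc n * C2 * (\<Sum>j\<le>n. b ^ j) * (c - a)\<^sup>2"
proof -
  define H where "H = hi ^ Suc n * C2 * (\<Sum>j\<le>n. b ^ j)"
  have H: "0 \<le> H" unfolding H_def using hi C2_nonneg b by (intro mult_nonneg_nonneg sum_nonneg) auto
  have B: "\<bar>\<bar>den i n s \<omega> - den i n a \<omega>\<bar>\<bar> \<le> hi ^ Suc n" for s \<omega>
    using den_le[of i n s \<omega>] den_pos[of i n s \<omega>] den_le[of i n a \<omega>] den_pos[of i n a \<omega>] by linarith
  let ?I = "\<lambda>\<omega>. \<integral>s. indicator {a..c} s * \<bar>den i n s \<omega> - den i n a \<omega>\<bar> \<partial>lborel"
  note F = interval_fubini[where f="\<lambda>s \<omega>. \<bar>den i n s \<omega> - den i n a \<omega>\<bar>" and a=a and c=c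
      and B="hi ^ Suc n" and g="\<lambda>_. 1" and B'=1, OF _ B]
  have ind: "(\<integral>s. indicator {a..c} s * K \<partial>lborel) = (c - a) * K" for K :: real
    using a by simp
  have ii: "integrable lborel (\<lambda>s. indicator {a..c} s * h s)"
    if "h \<in> borel_measurable borel" "\<And>s. s \<in> {a..c} \<Longrightarrow> \<bar>h s\<bar> \<le> K" for h :: "real \<Rightarrow> real" and K
    by (rule integrableI_bounded_set[where A="{a..c}" and B=K])
      (use that in \<open>auto simp: emeasure_lborel_Icc_eq indicator_def\<close>)
  have "expectation (\<lambda>\<omega>. \<bar>mass i n a c \<omega> - (c - a) * den i n a \<omega>\<bar>) \<le> expectation (\<lambda>\<omega>. 1 * ?I \<omega>)"
  proof (rule integral_mono')
    show "integrable M (\<lambda>\<omega>. 1 * ?I \<omega>)" by (rule F(2)) auto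
    fix \<omega> assume \<omega>: "\<omega> \<in> space M"
    have eq: "mass i n a c \<omega> - (c - a) * den i n a \<omega>
        = (\<integral>s. indicator {a..c} s * den i n s \<omega> - indicator {a..c} s * den i n a \<omega> \<partial>lborel)"
      unfolding mass_def ind[symmetric] using \<omega> den_integrable[OF \<omega>]
      by (intro Bochner_Integration.integral_diff[symmetric] ii[of _ "hi ^ Suc n"]) (auto simp: abs_den_le simp del: power_Suc)
    have "\<bar>mass i n a c \<omega> - (c - a) * den i n a \<omega>\<bar>
        \<le> (\<integral>s. \<bar>indicator {a..c} s * den i n s \<omega> - indicator {a..c} s * den i n a \<omega>\<bar> \<partial>lborel)"
      unfolding eq by (rule integral_abs_bound)
    also have "\<dots> = ?I \<omega>"
      by (intro Bochner_Integration.integral_cong refl) (simp add: indicator_def)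
    finally show "\<bar>mass i n a c \<omega> - (c - a) * den i n a \<omega>\<bar> \<le> 1 * ?I \<omega>" unfolding mult_1 .
    have "0 \<le> ?I \<omega>" by (intro Bochner_Integration.integral_nonneg) simp
    then show "0 \<le> 1 * ?I \<omega>" unfolding mult_1 .
  qed
  also have "\<dots> = (\<integral>s. indicator {a..c} s * expectation (\<lambda>\<omega>. 1 * \<bar>den i n s \<omega> - den i n a \<omega>\<bar>) \<partial>lborel)"
    by (rule F(3)) auto
  also have "\<dots> \<le> (\<integral>s. indicator {a..c} s * (H * (c - a)) \<partial>lborel)"
  proof (rule integral_mono)
    have le: "expectation (\<lambda>\<omega>. 1 * \<bar>den i n s \<omega> - den i n a \<omega>\<bar>) \<le> H * (c - a)" if "s \<in> {a..c}" for s
    proof -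
      have "expectation (\<lambda>\<omega>. 1 * \<bar>den i n s \<omega> - den i n a \<omega>\<bar>) \<le> H * \<bar>s - a\<bar>"
        unfolding H_def using den_modulus[of s a i n] a that by simp
      also have "\<dots> \<le> H * (c - a)" using that H by (intro mult_left_mono) auto
      finally show ?thesis .
    qed
    show "integrable lborel (\<lambda>s. indicator {a..c} s * expectation (\<lambda>\<omega>. 1 * \<bar>den i n s \<omega> - den i n a \<omega>\<bar>))"
      by (rule ii[of _ "H * (c - a)"]) (use le in auto)
    show "integrable lborel (\<lambda>s. indicator {a..c} s * (H * (c - a)))"
      by (rule ii[of _ "\<bar>H * (c - a)\<bar>"]) auto
    show "indicator {a..c} s * expectation (\<lambda>\<omega>. 1 * \<bar>den i n s \<omega> - den i n a \<omega>\<bar>) \<le> indicator {a..c} s * (H * (c - a))" for s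
      using le[of s] by (simp add: indicator_def)
  qed
  also have "\<dots> = (c - a) * (H * (c - a))" by (rule ind)
  finally show ?thesis unfolding H_def by (simp add: power2_eq_square ac_simps)
qed

text \<open>By \<open>mass_cell_riemann\<close> a cell of width \<open>t / k\<close> has mean error
  of order \<open>(t / k)\<^sup>2\<close>; adding \<open>k\<close> of them leaves order
  \<open>1 / k\<close>.\<close>

lemma mass_riemann_L1:
  assumes a: "0 \<le> a" "0 \<le> t" "0 < k"
  shows "integrable M (\<lambda>\<omega>. mass i n a (a + t) \<omega> - riemann i n a t k \<omega>)"
    and "expectation (\<lambda>\<omega>. \<bar>mass i n a (a + t) \<omega> - riemann i n a t k \<omega>\<bar>)
      \<le> hi ^ Suc n * C2 * (\<Sum>j\<le>n. b ^ j) * t\<^sup>2 / real k"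
proof -
  define H where "H = hi ^ Suc n * C2 * (\<Sum>j\<le>n. b ^ j)"
  define \<delta> where "\<delta> = t / real k"
  define g where "g r = a + \<delta> * real r" for r
  have \<delta>: "0 \<le> \<delta>" using a by (simp add: \<delta>_def)
  have g: "0 \<le> g r" "g r \<le> g (Suc r)" "a \<le> g r" "g (Suc r) - g r = \<delta>" for r
    using a \<delta> by (auto simp: g_def algebra_simps)
  have gk: "g k = a + t" using a by (simp add: g_def \<delta>_def)
  define D where "D r \<omega> = mass i n (g r) (g (Suc r)) \<omega> - \<delta> * den i n (g r) \<omega>" for r \<omega>
  have Di: "integrable M (D r)" for r
  proof (rule integrable_const_bound[where B="\<delta> * hi ^ Suc n + \<delta> * hi ^ Suc n"])
    show "AE \<omega> in M. norm (D r \<omega>) \<le> \<delta> * hi ^ Suc n + \<delta> * hi ^ Suc n"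
    proof (intro AE_I2)
      fix \<omega> assume \<omega>: "\<omega> \<in> space M"
      have "\<bar>mass i n (g r) (g (Suc r)) \<omega>\<bar> \<le> \<delta> * hi ^ Suc n"
        using mass_le[OF \<omega> g(2), of i n r] mass_nonneg[of i n "g r" "g (Suc r)" \<omega>] g(4)[of r] by simp
      moreover have "\<bar>\<delta> * den i n (g r) \<omega>\<bar> \<le> \<delta> * hi ^ Suc n"
        unfolding abs_mult using \<delta> abs_den_le by (auto intro!: mult_left_mono simp del: power_Suc)
      ultimately show "norm (D r \<omega>) \<le> \<delta> * hi ^ Suc n + \<delta> * hi ^ Suc n" unfolding D_def by simp
    qed
  qed (unfold D_def, measurable)
  have sum: "mass i n a (g k') \<omega> = (\<Sum>r<k'. mass i n (g r) (g (Suc r)) \<omega>)" if "\<omega> \<in> space M" for k' \<omega>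
  proof (induction k')
    case 0
    have "mass i n a a \<omega> = 0" using mass_le[OF that order_refl, of i n a] mass_nonneg[of i n a a \<omega>] by simp
    then show ?case by (simp add: g_def)
  next
    case (Suc k')
    then show ?case using mass_split[OF g(3) g(2) that, of i n k'] by simp
  qed
  have eq: "mass i n a (a + t) \<omega> - riemann i n a t k \<omega> = (\<Sum>r<k. D r \<omega>)" if "\<omega> \<in> space M" for \<omega>
    using sum[OF that, of k] unfolding gk
    by (simp add: D_def riemann_def g_def \<delta>_def sum_subtractf sum_distrib_left)
  show "integrable M (\<lambda>\<omega>. mass i n a (a + t) \<omega> - riemann i n a t k \<omega>)"
    using Di by (subst Bochner_Integration.integrable_cong[OF refl eq]) auto
  have "expectation (\<lambda>\<omega>. \<bar>mass i n a (a + t) \<omega> - riemann i n a t k \<omega>\<bar>) \<le> expectation (\<lambda>\<omega>. \<Sum>r<k. \<bar>D r \<omega>\<bar>)"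
    using Di by (intro integral_mono') (auto simp: eq intro: sum_nonneg sum_abs)
  also have "\<dots> = (\<Sum>r<k. expectation (\<lambda>\<omega>. \<bar>D r \<omega>\<bar>))"
    using Di by (intro Bochner_Integration.integral_sum) auto
  also have "\<dots> \<le> (\<Sum>r<k. H * \<delta>\<^sup>2)"
    using mass_cell_riemann[OF g(1) g(2), of i n] g(4) by (intro sum_mono) (simp add: D_def H_def)
  also have "\<dots> = H * t\<^sup>2 / real k"
    using a by (simp add: \<delta>_def power2_eq_square field_simps)
  finally show "expectation (\<lambda>\<omega>. \<bar>mass i n a (a + t) \<omega> - riemann i n a t k \<omega>\<bar>)
      \<le> hi ^ Suc n * C2 * (\<Sum>j\<le>n. b ^ j) * t\<^sup>2 / real k" unfolding H_def .
qed

text \<open>Along the grids with \<open>2 ^ r\<close> points the L1 errors are summable, which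
  upgrades convergence in mean to almost sure convergence.\<close>

lemma riemann_tendsto:
  assumes a: "0 \<le> a" "0 \<le> t"
  shows "AE \<omega> in M. (\<lambda>r. riemann i n a t (2 ^ r) \<omega>) \<longlonglongrightarrow> mass i n a (a + t) \<omega>"
proof -
  define H where "H = hi ^ Suc n * C2 * (\<Sum>j\<le>n. b ^ j) * t\<^sup>2"
  have "AE \<omega> in M. summable (\<lambda>r. \<bar>mass i n a (a + t) \<omega> - riemann i n a t (2 ^ r) \<omega>\<bar>)"
  proof (rule AE_summable_abs)
    show "integrable M (\<lambda>\<omega>. mass i n a (a + t) \<omega> - riemann i n a t (2 ^ r) \<omega>)" for r
      by (rule mass_riemann_L1[OF a]) simp
    show "expectation (\<lambda>\<omega>. \<bar>mass i n a (a + t) \<omega> - riemann i n a t (2 ^ r) \<omega>\<bar>) \<le> H * (1 / 2) ^ r" for r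
      using mass_riemann_L1(2)[OF a, of "2 ^ r" i n] by (simp add: H_def power_divide)
    show "summable (\<lambda>r. H * (1 / 2) ^ r)" by (intro summable_mult summable_geometric) auto
  qed
  then show ?thesis
  proof eventually_elim
    fix \<omega> assume "summable (\<lambda>r. \<bar>mass i n a (a + t) \<omega> - riemann i n a t (2 ^ r) \<omega>\<bar>)"
    then have "(\<lambda>r. \<bar>mass i n a (a + t) \<omega> - riemann i n a t (2 ^ r) \<omega>\<bar>) \<longlonglongrightarrow> 0"
      by (rule summable_LIMSEQ_zero)
    then have "(\<lambda>r. mass i n a (a + t) \<omega> - riemann i n a t (2 ^ r) \<omega>) \<longlonglongrightarrow> 0"
      by (rule tendsto_rabs_zero_cancel)
    from tendsto_diff[OF tendsto_const[of "mass i n a (a + t) \<omega>"] this]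
    show "(\<lambda>r. riemann i n a t (2 ^ r) \<omega>) \<longlonglongrightarrow> mass i n a (a + t) \<omega>" by simp
  qed
qed

end

lemma borel_measurable_if_all_eq:
  fixes X :: "nat \<Rightarrow> 'a \<Rightarrow> real"
  assumes [measurable]: "\<And>r. X r \<in> borel_measurable N" "Z \<in> borel_measurable N"
  shows "(\<lambda>x. (if \<forall>r<k. X r x = Z x then Z x else c) powr q) \<in> borel_measurable N"
  by measurable

section \<open>Separation of the first layer\<close>

context cascade
begin

lemma indep_first_layer:
  fixes f :: "(real \<Rightarrow> real) \<Rightarrow> real" and g :: "(nat \<Rightarrow> real \<Rightarrow> real) \<Rightarrow> real"
  assumes f: "f \<in> borel_measurable (Pi\<^sub>M {0..} (\<lambda>_. borel))"
    and g: "g \<in> borel_measurable (Pi\<^sub>M {1..Suc n} (\<lambda>_. Pi\<^sub>M {0..} (\<lambda>_. borel)))"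
    and i: "integrable M (\<lambda>\<omega>. f (path 0 \<omega>))" "integrable M (\<lambda>\<omega>. g (\<lambda>j\<in>{1..Suc n}. path j \<omega>))"
  shows "expectation (\<lambda>\<omega>. f (path 0 \<omega>) * g (\<lambda>j\<in>{1..Suc n}. path j \<omega>))
    = expectation (\<lambda>\<omega>. f (path 0 \<omega>)) * expectation (\<lambda>\<omega>. g (\<lambda>j\<in>{1..Suc n}. path j \<omega>))"
proof (rule indep_var_lebesgue_integral[OF _ i])
  have "indep_var (Pi\<^sub>M {0} (\<lambda>_. Pi\<^sub>M {0..} (\<lambda>_. borel))) (\<lambda>\<omega>. restrict (\<lambda>j. path j \<omega>) {0})
      (Pi\<^sub>M {1..Suc n} (\<lambda>_. Pi\<^sub>M {0..} (\<lambda>_. borel))) (\<lambda>\<omega>. restrict (\<lambda>j. path j \<omega>) {1..Suc n})"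
    by (rule indep_var_restrict[OF indep]) auto
  moreover have "(\<lambda>x. f (x 0)) \<in> borel_measurable (Pi\<^sub>M {0::nat} (\<lambda>_. Pi\<^sub>M {0..} (\<lambda>_. borel)))"
    by (rule measurable_compose[OF
          measurable_component_singleton[of "0 :: nat" "{0}" "\<lambda>_. Pi\<^sub>M {0..} (\<lambda>_. borel)"] f]) simp
  ultimately have "indep_var borel ((\<lambda>x. f (x 0)) \<circ> (\<lambda>\<omega>. restrict (\<lambda>j. path j \<omega>) {0}))
      borel (g \<circ> (\<lambda>\<omega>. restrict (\<lambda>j. path j \<omega>) {1..Suc n}))"
    using g by (rule indep_var_compose)
  then show "indep_var borel (\<lambda>\<omega>. f (path 0 \<omega>)) borel (\<lambda>\<omega>. g (\<lambda>j\<in>{1..Suc n}. path j \<omega>))"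
    by (simp add: comp_def)
qed

definition kap :: "real \<Rightarrow> real" where
  "kap q = expectation (\<lambda>\<omega>. L 0 0 \<omega> powr q)"

text \<open>\<open>weight hi\<close> dominates and \<open>weight lo\<close> minorises the first layer on the whole grid.\<close>

definition weight :: "real \<Rightarrow> nat \<Rightarrow> real \<Rightarrow> 'w \<Rightarrow> real" where
  "weight c k \<delta> \<omega> = (if \<forall>r<k. L 0 (\<delta> * real r) \<omega> = L 0 0 \<omega> then L 0 0 \<omega> else c)"

lemma weight_measurable [measurable]: "weight c k \<delta> \<in> borel_measurable M"
  unfolding weight_def by measurable

lemma weight_bounds:
  assumes "lo \<le> c" "c \<le> hi"
  shows "lo \<le> weight c k \<delta> \<omega>" "weight c k \<delta> \<omega> \<le> hi"
  using assms L_lo L_hi by (auto simp: weight_def)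

lemma L_powr_integrable: "0 < q \<Longrightarrow> integrable M (\<lambda>\<omega>. L j s \<omega> powr q)"
proof (rule integrable_const_bound[where B="hi powr q"])
  assume q: "0 < q"
  have "L j s \<omega> powr q \<le> hi powr q" for \<omega>
    using q L_pos[of j s \<omega>] L_hi[of j s \<omega>] by (intro powr_mono2) auto
  then show "AE \<omega> in M. norm (L j s \<omega> powr q) \<le> hi powr q" by simp
qed measurable

lemma weight_powr_integrable:
  assumes "0 < q" "lo \<le> c" "c \<le> hi"
  shows "integrable M (\<lambda>\<omega>. weight c k \<delta> \<omega> powr q)"
proof (rule integrable_const_bound[where B="hi powr q"])
  have "weight c k \<delta> \<omega> powr q \<le> hi powr q" for \<omega>
    using weight_bounds[OF assms(2,3), of k \<delta> \<omega>] lo assms by (intro powr_mono2) auto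
  then show "AE \<omega> in M. norm (weight c k \<delta> \<omega> powr q) \<le> hi powr q" by simp
qed measurable

lemma kap_ge: "0 < q \<Longrightarrow> lo powr q \<le> kap q"
proof -
  assume q: "0 < q"
  have "expectation (\<lambda>_. lo powr q) \<le> kap q"
    unfolding kap_def
    by (intro integral_mono L_powr_integrable q powr_mono2) (use lo L_lo q in auto)
  then show ?thesis by (simp add: prob_space)
qed

lemma kap_pos: "0 < q \<Longrightarrow> 0 < kap q"
  using kap_ge[of q] lo powr_gt_zero[of lo q] by linarith

text \<open>A nonconstant layer changes between two consecutive grid points. The resulting bound
  involves only \<open>\<delta> * real k\<close>, the length covered by the grid, and hence survives
  its refinement.\<close>

lemma prob_not_constant:
  assumes \<delta>: "0 \<le> \<delta>"
  shows "prob {\<omega> \<in> space M. \<not> (\<forall>r<k. L 0 (\<delta> * real r) \<omega> = L 0 0 \<omega>)} \<le> C2 * (\<delta> * real k)"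
proof -
  define S where "S r = {\<omega> \<in> space M. L 0 (\<delta> * real r) \<omega> \<noteq> L 0 (\<delta> * real (Suc r)) \<omega>}" for r
  have S[measurable]: "S r \<in> events" for r unfolding S_def by measurable
  have "{\<omega> \<in> space M. \<not> (\<forall>r<k. L 0 (\<delta> * real r) \<omega> = L 0 0 \<omega>)} \<subseteq> (\<Union>r<k. S r)"
  proof
    fix \<omega> assume \<omega>: "\<omega> \<in> {\<omega> \<in> space M. \<not> (\<forall>r<k. L 0 (\<delta> * real r) \<omega> = L 0 0 \<omega>)}"
    show "\<omega> \<in> (\<Union>r<k. S r)"
    proof (rule ccontr)
      assume *: "\<omega> \<notin> (\<Union>r<k. S r)"
      have "r \<le> k \<Longrightarrow> L 0 (\<delta> * real r) \<omega> = L 0 0 \<omega>" for r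
      proof (induction r)
        case (Suc r)
        then have "\<omega> \<notin> S r" using * by auto
        then show ?case using Suc \<omega> by (auto simp: S_def)
      qed simp
      then show False using \<omega> by auto
    qed
  qed
  then have "prob {\<omega> \<in> space M. \<not> (\<forall>r<k. L 0 (\<delta> * real r) \<omega> = L 0 0 \<omega>)} \<le> prob (\<Union>r<k. S r)"
    by (intro finite_measure_mono) auto
  also have "\<dots> \<le> (\<Sum>r<k. prob (S r))" by (intro finite_measure_subadditive_finite) auto
  also have "\<dots> \<le> (\<Sum>r<k. C2 * \<delta>)"
  proof (intro sum_mono)
    fix r
    show "prob (S r) \<le> C2 * \<delta>"
      using change[of "\<delta> * real r" "\<delta> * real (Suc r)" 0] \<delta> by (simp add: S_def algebra_simps)
  qed
  finally show ?thesis by (simp add: ac_simps)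
qed

text \<open>The two powers agree unless the layer changes on the grid, and in that case both lie
  between 0 and \<open>hi powr q\<close>.\<close>

lemma weight_moment:
  assumes q: "0 < q" and c: "lo \<le> c" "c \<le> hi" and \<delta>: "0 \<le> \<delta>"
  shows "\<bar>expectation (\<lambda>\<omega>. weight c k \<delta> \<omega> powr q) - kap q\<bar> \<le> hi powr q * C2 * (\<delta> * real k)"
proof -
  define S where "S = {\<omega> \<in> space M. \<not> (\<forall>r<k. L 0 (\<delta> * real r) \<omega> = L 0 0 \<omega>)}"
  have S[measurable]: "S \<in> events" unfolding S_def by measurable
  have "expectation (\<lambda>\<omega>. weight c k \<delta> \<omega> powr q) - kap q
      = expectation (\<lambda>\<omega>. weight c k \<delta> \<omega> powr q - L 0 0 \<omega> powr q)"
    unfolding kap_def using q c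
    by (intro Bochner_Integration.integral_diff[symmetric] weight_powr_integrable L_powr_integrable)
  then have "\<bar>expectation (\<lambda>\<omega>. weight c k \<delta> \<omega> powr q) - kap q\<bar>
      \<le> expectation (\<lambda>\<omega>. \<bar>weight c k \<delta> \<omega> powr q - L 0 0 \<omega> powr q\<bar>)"
    by (simp only: integral_abs_bound)
  also have "\<dots> \<le> expectation (\<lambda>\<omega>. hi powr q * indicator S \<omega>)"
  proof (rule integral_mono')
    show "integrable M (\<lambda>\<omega>. hi powr q * indicator S \<omega>)"
      by (intro integrable_mult_right integrable_real_indicator S) (auto simp: emeasure_eq_measure)
    fix \<omega> assume \<omega>: "\<omega> \<in> space M"
    have "weight c k \<delta> \<omega> powr q \<le> hi powr q" "L 0 0 \<omega> powr q \<le> hi powr q"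
      using weight_bounds[OF c, of k \<delta> \<omega>] lo q L_pos[of 0 0 \<omega>] L_hi[of 0 0 \<omega>] by (auto intro!: powr_mono2)
    then have "\<bar>weight c k \<delta> \<omega> powr q - L 0 0 \<omega> powr q\<bar> \<le> hi powr q"
      using powr_ge_zero[of "weight c k \<delta> \<omega>" q] powr_ge_zero[of "L 0 0 \<omega>" q] by linarith
    then show "\<bar>weight c k \<delta> \<omega> powr q - L 0 0 \<omega> powr q\<bar> \<le> hi powr q * indicator S \<omega>"
      using \<omega> by (cases "\<omega> \<in> S") (auto simp: weight_def S_def)
  qed auto
  also have "\<dots> = hi powr q * prob S"
    using sets.sets_into_space[OF S] by (simp add: Int_absorb2)
  also have "\<dots> \<le> hi powr q * (C2 * (\<delta> * real k))"
    unfolding S_def by (intro mult_left_mono prob_not_constant \<delta>) auto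
  finally show ?thesis by (simp add: ac_simps)
qed

lemma den_Suc_shift: "den 0 (Suc n) s \<omega> = L 0 s \<omega> * den 1 n (s * b) \<omega>"
  unfolding den_def by (subst prod.atMost_Suc_shift) (simp add: ac_simps)

text \<open>Multiplication by \<open>b\<close> carries the grid of \<open>[0, t / b]\<close> to the
  grid of \<open>[0, t]\<close> with the same number of points. Once the first layer is replaced by
  its constant bound it can be taken out of the sum.\<close>

lemma riemann_bounds:
  assumes "0 \<le> t"
  shows "riemann 0 (Suc n) 0 (t / b) k \<omega> \<le> weight hi k (t / b / real k) \<omega> / b * riemann 1 n 0 t k \<omega>"
    and "weight lo k (t / b / real k) \<omega> / b * riemann 1 n 0 t k \<omega> \<le> riemann 0 (Suc n) 0 (t / b) k \<omega>"
proof -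
  let ?\<delta> = "t / b / real k"
  have e: "riemann 0 (Suc n) 0 (t / b) k \<omega>
      = t / b / real k * (\<Sum>r<k. L 0 (?\<delta> * real r) \<omega> * den 1 n (t / real k * real r) \<omega>)"
    using b by (simp add: riemann_def den_Suc_shift)
  have w: "c / b * riemann 1 n 0 t k \<omega>
      = t / b / real k * (\<Sum>r<k. c * den 1 n (t / real k * real r) \<omega>)" for c
    by (simp add: riemann_def flip: sum_distrib_left)
  have "L 0 (?\<delta> * real r) \<omega> \<le> weight hi k ?\<delta> \<omega>" "weight lo k ?\<delta> \<omega> \<le> L 0 (?\<delta> * real r) \<omega>" if "r < k" for r
    using that L_lo L_hi by (auto simp: weight_def)
  then show "riemann 0 (Suc n) 0 (t / b) k \<omega> \<le> weight hi k ?\<delta> \<omega> / b * riemann 1 n 0 t k \<omega>"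
    "weight lo k ?\<delta> \<omega> / b * riemann 1 n 0 t k \<omega> \<le> riemann 0 (Suc n) 0 (t / b) k \<omega>"
    unfolding e w using b assms
    by (intro mult_left_mono sum_mono mult_right_mono less_imp_le[OF den_pos]; simp)+
qed

lemma weight_riemann_indep:
  assumes q: "0 < q" "0 < l" and c: "lo \<le> c" "c \<le> hi" and t: "0 \<le> \<delta>" "0 \<le> t"
  shows "integrable M (\<lambda>\<omega>. weight c k \<delta> \<omega> powr q * trunc_powr l q (riemann 1 n 0 t k \<omega>))"
    and "expectation (\<lambda>\<omega>. weight c k \<delta> \<omega> powr q * trunc_powr l q (riemann 1 n 0 t k \<omega>))
    = expectation (\<lambda>\<omega>. weight c k \<delta> \<omega> powr q) * tmom l q (riemann 1 n 0 t k)"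
proof -
  \<comment> \<open>\<open>f\<close> and \<open>g\<close> read the weight and the truncated Riemann
    sum off the paths, the form in which independence of layer 0 from the others is
    available.\<close>
  define f where "f x = (if \<forall>r<k. x (\<delta> * real r) = x 0 then x 0 else c) powr q" for x :: "real \<Rightarrow> real"
  define g where "g x = trunc_powr l q (t / real k * (\<Sum>r<k. \<Prod>j\<le>n. x (1 + j) ((0 + t / real k * real r) * b ^ j)))"
    for x :: "nat \<Rightarrow> real \<Rightarrow> real"
  have f: "f \<in> borel_measurable (Pi\<^sub>M {0..} (\<lambda>_. borel))"
    unfolding f_def using t by (intro borel_measurable_if_all_eq measurable_component_singleton) auto
  have "(\<lambda>x. x (1 + j) ((0 + t / real k * real r) * b ^ j))
      \<in> borel_measurable (Pi\<^sub>M {1..Suc n} (\<lambda>_. Pi\<^sub>M {0..} (\<lambda>_. borel :: real measure)))" if "j \<le> n" for j r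
    using that t b by (intro measurable_component_component) auto
  then have "(\<lambda>x. \<Prod>j\<le>n. x (1 + j) ((0 + t / real k * real r) * b ^ j))
      \<in> borel_measurable (Pi\<^sub>M {1..Suc n} (\<lambda>_. Pi\<^sub>M {0..} (\<lambda>_. borel :: real measure)))" for r
    by (intro borel_measurable_prod) auto
  then have g: "g \<in> borel_measurable (Pi\<^sub>M {1..Suc n} (\<lambda>_. Pi\<^sub>M {0..} (\<lambda>_. borel)))"
    unfolding g_def
    by (intro measurable_compose[OF _ trunc_powr_measurable] borel_measurable_times
        borel_measurable_const borel_measurable_sum)
  have fw: "f (path 0 \<omega>) = weight c k \<delta> \<omega> powr q" for \<omega>
    using t by (auto simp: f_def weight_def)
  have gr: "g (\<lambda>j\<in>{1..Suc n}. path j \<omega>) = trunc_powr l q (riemann 1 n 0 t k \<omega>)" for \<omega>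
  proof -
    have "(\<lambda>j\<in>{1..Suc n}. path j \<omega>) (1 + j) ((0 + t / real k * real r) * b ^ j)
        = L (1 + j) ((0 + t / real k * real r) * b ^ j) \<omega>" if "j \<le> n" for j r
      using that t b by simp
    then have "(\<Sum>r<k. \<Prod>j\<le>n. (\<lambda>j\<in>{1..Suc n}. path j \<omega>) (1 + j) ((0 + t / real k * real r) * b ^ j))
        = (\<Sum>r<k. \<Prod>j\<le>n. L (1 + j) ((0 + t / real k * real r) * b ^ j) \<omega>)"
      by (intro sum.cong prod.cong refl) auto
    then show ?thesis unfolding g_def riemann_def den_def by simp
  qed
  have fi: "integrable M (\<lambda>\<omega>. f (path 0 \<omega>))" unfolding fw using q c by (intro weight_powr_integrable)
  have gi: "integrable M (\<lambda>\<omega>. g (\<lambda>j\<in>{1..Suc n}. path j \<omega>))"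
    unfolding gr using q t by (intro trunc_powr_integrable) (auto simp: riemann_nonneg)
  show "expectation (\<lambda>\<omega>. weight c k \<delta> \<omega> powr q * trunc_powr l q (riemann 1 n 0 t k \<omega>))
    = expectation (\<lambda>\<omega>. weight c k \<delta> \<omega> powr q) * tmom l q (riemann 1 n 0 t k)"
    using indep_first_layer[OF f g fi gi] unfolding fw gr .
  show "integrable M (\<lambda>\<omega>. weight c k \<delta> \<omega> powr q * trunc_powr l q (riemann 1 n 0 t k \<omega>))"
  proof (rule integrable_const_bound[where B="hi powr q * l powr q"])
    show "AE \<omega> in M. norm (weight c k \<delta> \<omega> powr q * trunc_powr l q (riemann 1 n 0 t k \<omega>)) \<le> hi powr q * l powr q"
    proof (intro AE_I2)
      fix \<omega>
      have "weight c k \<delta> \<omega> powr q * trunc_powr l q (riemann 1 n 0 t k \<omega>) \<le> hi powr q * l powr q"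
        using weight_bounds[OF c, of k \<delta> \<omega>] lo q t
        by (intro mult_mono powr_mono2 trunc_powr_le riemann_nonneg trunc_powr_nonneg) auto
      then show "norm (weight c k \<delta> \<omega> powr q * trunc_powr l q (riemann 1 n 0 t k \<omega>)) \<le> hi powr q * l powr q"
        by (simp add: abs_mult trunc_powr_nonneg)
    qed
  qed measurable
qed

section \<open>One scale step for truncated moments\<close>

text \<open>The new level is \<open>l / (lo / b)\<close> because \<open>lo / b\<close> is the
  smallest value of the factor split off. The remaining layers start at 1 and are renumbered from 0
  by \<open>riemann_law\<close>.\<close>

lemma riemann_step_upper:
  assumes q: "0 < q" "0 < l" and t: "0 \<le> t" "0 < k"
  shows "tmom l q (riemann 0 (Suc n) 0 (t / b) k)
    \<le> (kap q + hi powr q * C2 * (t / b)) / b powr q *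
      tmom (l / (lo / b)) q (riemann 0 n 0 t k)"
proof -
  let ?\<delta> = "t / b / real k" and ?l = "l / (lo / b)"
  have l: "0 < ?l" using q lo b by simp
  have \<delta>: "0 \<le> ?\<delta>" using t b by simp
  note W = weight_riemann_indep[OF q(1) l lo_le_hi order_refl \<delta> t(1)]
  have "tmom l q (riemann 0 (Suc n) 0 (t / b) k)
      \<le> expectation (\<lambda>\<omega>. weight hi k ?\<delta> \<omega> powr q * trunc_powr ?l q (riemann 1 n 0 t k \<omega>) / b powr q)"
  proof (rule integral_mono)
    show "integrable M (\<lambda>\<omega>. trunc_powr l q (riemann 0 (Suc n) 0 (t / b) k \<omega>))"
      using q t b by (intro trunc_powr_integrable) (auto simp: riemann_nonneg)
    show "integrable M (\<lambda>\<omega>. weight hi k ?\<delta> \<omega> powr q * trunc_powr ?l q (riemann 1 n 0 t k \<omega>) / b powr q)"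
      using W(1) by simp
    fix \<omega>
    have w: "lo / b \<le> weight hi k ?\<delta> \<omega> / b"
      using weight_bounds[OF lo_le_hi order_refl] b by (intro divide_right_mono) auto
    have "trunc_powr l q (riemann 0 (Suc n) 0 (t / b) k \<omega>)
        \<le> trunc_powr l q (weight hi k ?\<delta> \<omega> / b * riemann 1 n 0 t k \<omega>)"
      using q t b by (intro trunc_powr_mono riemann_bounds) (auto simp: riemann_nonneg)
    also have "\<dots> \<le> (weight hi k ?\<delta> \<omega> / b) powr q * trunc_powr ?l q (riemann 1 n 0 t k \<omega>)"
      using q t b lo w by (intro trunc_powr_mult_le) (auto simp: riemann_nonneg)
    also have "\<dots> = weight hi k ?\<delta> \<omega> powr q * trunc_powr ?l q (riemann 1 n 0 t k \<omega>) / b powr q"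
      using weight_bounds(1)[OF lo_le_hi order_refl, of k ?\<delta> \<omega>] lo b by (simp add: powr_divide)
    finally show "trunc_powr l q (riemann 0 (Suc n) 0 (t / b) k \<omega>)
        \<le> weight hi k ?\<delta> \<omega> powr q * trunc_powr ?l q (riemann 1 n 0 t k \<omega>) / b powr q" .
  qed
  also have "\<dots> = expectation (\<lambda>\<omega>. weight hi k ?\<delta> \<omega> powr q) / b powr q *
      tmom ?l q (riemann 1 n 0 t k)"
    using W(2) by simp
  also have "\<dots> \<le> (kap q + hi powr q * C2 * (t / b)) / b powr q *
      tmom ?l q (riemann 1 n 0 t k)"
  proof (intro mult_right_mono divide_right_mono)
    have "?\<delta> * real k = t / b" using t by simp
    then show "expectation (\<lambda>\<omega>. weight hi k ?\<delta> \<omega> powr q) \<le> kap q + hi powr q * C2 * (t / b)"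
      using weight_moment[OF q(1) lo_le_hi order_refl \<delta>, of k] by (simp only: abs_le_iff) linarith
  qed (auto intro!: Bochner_Integration.integral_nonneg simp: trunc_powr_nonneg)
  also have "tmom ?l q (riemann 1 n 0 t k)
      = tmom ?l q (riemann 0 n 0 t k)"
    using t by (intro riemann_law) auto
  finally show ?thesis .
qed

text \<open>The mirror image, with level \<open>l / (hi / b)\<close>. The maximum with
  \<open>lo powr q\<close> keeps the factor positive when \<open>t\<close> is too large for the
  linear error term to be informative.\<close>

lemma riemann_step_lower:
  assumes q: "0 < q" "0 < l" and t: "0 \<le> t" "0 < k"
  shows "max (lo powr q) (kap q - hi powr q * C2 * (t / b)) / b powr q *
      tmom (l / (hi / b)) q (riemann 0 n 0 t k)
    \<le> tmom l q (riemann 0 (Suc n) 0 (t / b) k)"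
proof -
  let ?\<delta> = "t / b / real k" and ?l = "l / (hi / b)"
  have l: "0 < ?l" using q hi b by simp
  have \<delta>: "0 \<le> ?\<delta>" using t b by simp
  note W = weight_riemann_indep[OF q(1) l order_refl lo_le_hi \<delta> t(1)]
  have "max (lo powr q) (kap q - hi powr q * C2 * (t / b)) / b powr q *
      tmom ?l q (riemann 0 n 0 t k)
    = max (lo powr q) (kap q - hi powr q * C2 * (t / b)) / b powr q *
      tmom ?l q (riemann 1 n 0 t k)"
    using t riemann_law[of 0 t k "trunc_powr ?l q" 1 n] by simp
  also have "\<dots> \<le> expectation (\<lambda>\<omega>. weight lo k ?\<delta> \<omega> powr q) / b powr q *
      tmom ?l q (riemann 1 n 0 t k)"
  proof (intro mult_right_mono divide_right_mono max.boundedI)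
    have "?\<delta> * real k = t / b" using t by simp
    then show "kap q - hi powr q * C2 * (t / b) \<le> expectation (\<lambda>\<omega>. weight lo k ?\<delta> \<omega> powr q)"
      using weight_moment[OF q(1) order_refl lo_le_hi \<delta>, of k] by (simp only: abs_le_iff) linarith
    have "expectation (\<lambda>_. lo powr q) \<le> expectation (\<lambda>\<omega>. weight lo k ?\<delta> \<omega> powr q)"
      by (intro integral_mono weight_powr_integrable powr_mono2)
        (use q lo lo_le_hi weight_bounds(1)[OF order_refl lo_le_hi] in auto)
    then show "lo powr q \<le> expectation (\<lambda>\<omega>. weight lo k ?\<delta> \<omega> powr q)" by (simp add: prob_space)
  qed (auto intro!: Bochner_Integration.integral_nonneg simp: trunc_powr_nonneg)
  also have "\<dots> = expectation (\<lambda>\<omega>. weight lo k ?\<delta> \<omega> powr q * trunc_powr ?l q (riemann 1 n 0 t k \<omega>) / b powr q)"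
    using W(2) by simp
  also have "\<dots> \<le> tmom l q (riemann 0 (Suc n) 0 (t / b) k)"
  proof (rule integral_mono)
    show "integrable M (\<lambda>\<omega>. trunc_powr l q (riemann 0 (Suc n) 0 (t / b) k \<omega>))"
      using q t b by (intro trunc_powr_integrable) (auto simp: riemann_nonneg)
    show "integrable M (\<lambda>\<omega>. weight lo k ?\<delta> \<omega> powr q * trunc_powr ?l q (riemann 1 n 0 t k \<omega>) / b powr q)"
      using W(1) by simp
    fix \<omega>
    have w: "0 < weight lo k ?\<delta> \<omega> / b" "weight lo k ?\<delta> \<omega> / b \<le> hi / b"
      using weight_bounds[OF order_refl lo_le_hi, of k ?\<delta> \<omega>] b lo by (auto intro!: divide_right_mono)
    have "weight lo k ?\<delta> \<omega> powr q * trunc_powr ?l q (riemann 1 n 0 t k \<omega>) / b powr q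
        = (weight lo k ?\<delta> \<omega> / b) powr q * trunc_powr ?l q (riemann 1 n 0 t k \<omega>)"
      using weight_bounds(1)[OF order_refl lo_le_hi, of k ?\<delta> \<omega>] lo b by (simp add: powr_divide)
    also have "\<dots> \<le> trunc_powr l q (weight lo k ?\<delta> \<omega> / b * riemann 1 n 0 t k \<omega>)"
      using q t w by (intro trunc_powr_mult_ge) (auto simp: riemann_nonneg)
    also have "\<dots> \<le> trunc_powr l q (riemann 0 (Suc n) 0 (t / b) k \<omega>)"
      using q t b w by (intro trunc_powr_mono riemann_bounds mult_nonneg_nonneg) (auto simp: riemann_nonneg)
    finally show "weight lo k ?\<delta> \<omega> powr q * trunc_powr ?l q (riemann 1 n 0 t k \<omega>) / b powr q
        \<le> trunc_powr l q (riemann 0 (Suc n) 0 (t / b) k \<omega>)" .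
  qed
  finally show ?thesis .
qed

lemma trunc_riemann_tendsto:
  assumes "0 < q" "0 < l" "0 \<le> a" "0 \<le> t"
  shows "(\<lambda>r. tmom l q (riemann i n a t (2 ^ r)))
    \<longlonglongrightarrow> tmom l q (mass i n a (a + t))"
  using assms by (intro trunc_powr_tendsto riemann_tendsto) (auto simp: riemann_nonneg)

lemma trunc_mass_tendsto:
  assumes "0 < q" "0 < l" "0 \<le> a" "a \<le> c"
  shows "(\<lambda>n. tmom l q (mass 0 n a c))
    \<longlonglongrightarrow> tmom l q (lmass a c)"
  using assms by (intro trunc_powr_tendsto mass_tendsto lmass_measurable) (auto simp: mass_nonneg)

lemma trunc_lmass_shift:
  assumes q: "0 < q" "0 < l" and a: "0 \<le> a" "0 \<le> t"
  shows "tmom l q (lmass a (a + t)) = tmom l q (lmass 0 t)"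
proof -
  have "tmom l q (mass 0 n a (a + t)) = tmom l q (mass 0 n 0 t)" for n
  proof -
    have "tmom l q (riemann 0 n a t (2 ^ r))
        = tmom l q (riemann 0 n 0 t (2 ^ r))" for r
      using a by (intro riemann_law) auto
    then show ?thesis
      using trunc_riemann_tendsto[OF q a, of 0 n] trunc_riemann_tendsto[OF q order_refl a(2), of 0 n]
      by (simp add: LIMSEQ_unique)
  qed
  then show ?thesis
    using trunc_mass_tendsto[OF q a(1), of "a + t"] trunc_mass_tendsto[OF q order_refl a(2)] a
    by (simp add: LIMSEQ_unique)
qed

text \<open>The factor depends neither on the grid nor on the number of layers, so two limits can be
  taken in turn: the grid is refined at fixed \<open>n\<close>, then \<open>n\<close> tends to
  infinity. The left side carries one layer more, whence the index shift in the second
  limit.\<close>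

lemma trunc_lmass_step_upper:
  assumes q: "0 < q" "0 < l" and t: "0 \<le> t"
  shows "tmom l q (lmass 0 (t / b))
    \<le> (kap q + hi powr q * C2 * (t / b)) / b powr q *
      tmom (l / (lo / b)) q (lmass 0 t)"
proof -
  let ?c = "(kap q + hi powr q * C2 * (t / b)) / b powr q"
  have l: "0 < l / (lo / b)" using q lo b by simp
  have tb: "0 \<le> t / b" using t b by simp
  have "tmom l q (mass 0 (Suc n) 0 (t / b))
    \<le> ?c * tmom (l / (lo / b)) q (mass 0 n 0 t)" for n
    by (rule LIMSEQ_le[OF trunc_riemann_tendsto[OF q order_refl tb, unfolded add_0]
          tendsto_mult_left[OF trunc_riemann_tendsto[OF q(1) l order_refl t, unfolded add_0]]])
      (intro exI allI impI riemann_step_upper q t, simp)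
  then show ?thesis
    by (intro LIMSEQ_le[OF LIMSEQ_Suc[OF trunc_mass_tendsto[OF q order_refl tb]]
          tendsto_mult_left[OF trunc_mass_tendsto[OF q(1) l order_refl t]]] exI allI impI)
qed

lemma trunc_lmass_step_lower:
  assumes q: "0 < q" "0 < l" and t: "0 \<le> t"
  shows "max (lo powr q) (kap q - hi powr q * C2 * (t / b)) / b powr q *
      tmom (l / (hi / b)) q (lmass 0 t)
    \<le> tmom l q (lmass 0 (t / b))"
proof -
  let ?c = "max (lo powr q) (kap q - hi powr q * C2 * (t / b)) / b powr q"
  have l: "0 < l / (hi / b)" using q hi b by simp
  have tb: "0 \<le> t / b" using t b by simp
  have "?c * tmom (l / (hi / b)) q (mass 0 n 0 t)
    \<le> tmom l q (mass 0 (Suc n) 0 (t / b))" for n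
    by (rule LIMSEQ_le[OF tendsto_mult_left[OF trunc_riemann_tendsto[OF q(1) l order_refl t, unfolded add_0]]
          trunc_riemann_tendsto[OF q order_refl tb, unfolded add_0]])
      (intro exI allI impI riemann_step_lower q t, simp)
  then show ?thesis
    by (intro LIMSEQ_le[OF tendsto_mult_left[OF trunc_mass_tendsto[OF q(1) l order_refl t]]
          LIMSEQ_Suc[OF trunc_mass_tendsto[OF q order_refl tb]]] exI allI impI)
qed

end

section \<open>Power law for the moments\<close>

lemma one_minus_ge_exp:
  fixes y :: real
  assumes "0 \<le> y" "y \<le> 1 / 2"
  shows "exp (- (2 * y)) \<le> 1 - y"
proof -
  have "y * y \<le> y * (1 / 2)" using assms by (intro mult_left_mono) auto
  moreover have "- y - 2 * y\<^sup>2 \<le> ln (1 - y)" using assms by (intro ln_one_minus_pos_lower_bound)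
  ultimately have "- (2 * y) \<le> ln (1 - y)" by (simp add: power2_eq_square)
  then show ?thesis using assms by (simp add: ln_ge_iff)
qed

text \<open>Puts the lower step factor into exponential form, so that the errors of successive steps
  add up in an exponent.\<close>

lemma exp_lower_bound_of_max:
  fixes \<kappa> v H :: real
  assumes "0 < v" "v \<le> \<kappa>" "0 \<le> H"
  obtains h where "0 \<le> h" "\<And>x. 0 \<le> x \<Longrightarrow> \<kappa> * exp (- (h * x)) \<le> max v (\<kappa> - H * x)"
proof (cases "H = 0")
  case True
  then show ?thesis using that[of 0] by simp
next
  case False
  \<comment> \<open>The first entry serves small \<open>x\<close>, through 1 - y \<ge> exp (-2 y)
    for y at most 1/2; the second makes the left side at most \<open>v\<close> as soon as
    \<open>H * x / \<kappa>\<close> exceeds 1/2.\<close>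
  define h where "h = max (2 * H / \<kappa>) (2 * H / \<kappa> * ln (\<kappa> / v))"
  have \<kappa>: "0 < \<kappa>" "0 < H" using assms False by auto
  have h0: "0 \<le> h" using \<kappa> by (simp add: h_def max.coboundedI1)
  moreover have "\<kappa> * exp (- (h * x)) \<le> max v (\<kappa> - H * x)" if x: "0 \<le> x" for x
  proof (cases "H * x / \<kappa> \<le> 1 / 2")
    case True
    have "exp (- (h * x)) \<le> exp (- (2 * (H * x / \<kappa>)))"
    proof -
      have "2 * H / \<kappa> * x \<le> h * x" unfolding h_def by (intro mult_right_mono x) simp
      then show ?thesis by simp
    qed
    also have "\<dots> \<le> 1 - H * x / \<kappa>" using True x \<kappa> by (intro one_minus_ge_exp) auto
    finally have "\<kappa> * exp (- (h * x)) \<le> \<kappa> * (1 - H * x / \<kappa>)" using \<kappa> by simp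
    also have "\<dots> = \<kappa> - H * x" using \<kappa> by (simp add: algebra_simps)
    finally show ?thesis by simp
  next
    case False
    have l0: "0 \<le> ln (\<kappa> / v)" using assms by (intro ln_ge_zero) simp
    have "1 * ln (\<kappa> / v) \<le> (2 * (H * x / \<kappa>)) * ln (\<kappa> / v)"
    proof (rule mult_right_mono[OF _ l0])
      show "1 \<le> 2 * (H * x / \<kappa>)" using False by linarith
    qed
    also have "\<dots> = 2 * H / \<kappa> * ln (\<kappa> / v) * x" by simp
    also have "\<dots> \<le> h * x" unfolding h_def by (intro mult_right_mono x) simp
    finally have "exp (- (h * x)) \<le> exp (- ln (\<kappa> / v))" by simp
    also have "\<dots> = v / \<kappa>" using assms \<kappa> by (simp add: exp_minus)
    finally have "\<kappa> * exp (- (h * x)) \<le> v" using \<kappa> by (simp add: field_simps)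
    then show ?thesis by simp
  qed
  ultimately show ?thesis using that by blast
qed

text \<open>Stated with \<open>\<bar>e\<bar>\<close> because the exponents to which it is applied
  may have either sign.\<close>

lemma powr_between:
  fixes y c e :: real
  assumes "1 < c" "1 / c \<le> y" "y \<le> 1"
  shows "c powr (- \<bar>e\<bar>) \<le> y powr e" and "y powr e \<le> c powr \<bar>e\<bar>"
proof -
  have y: "0 < y" using assms by (meson less_le_trans zero_less_divide_1_iff zero_less_one less_trans)
  have "ln (1 / c) \<le> ln y" using assms y by (subst ln_le_cancel_iff) auto
  then have "\<bar>ln y\<bar> \<le> ln c" using assms y by (simp add: ln_div ln_le_zero_iff abs_if)
  then have "\<bar>e\<bar> * \<bar>ln y\<bar> \<le> \<bar>e\<bar> * ln c" by (intro mult_left_mono) auto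
  then have "\<bar>e * ln y\<bar> \<le> \<bar>e\<bar> * ln c" by (simp add: abs_mult)
  then have "- (\<bar>e\<bar> * ln c) \<le> e * ln y" "e * ln y \<le> \<bar>e\<bar> * ln c" by linarith+
  then show "c powr (- \<bar>e\<bar>) \<le> y powr e" "y powr e \<le> c powr \<bar>e\<bar>"
    using assms y by (simp_all add: powr_def)
qed

section \<open>Moments of the limit masses\<close>

context cascade
begin

lemma lmass_split:
  assumes "0 \<le> a" "a \<le> c" "c \<le> d"
  shows "AE \<omega> in M. lmass a d \<omega> = lmass a c \<omega> + lmass c d \<omega>"
  using mass_tendsto[OF assms(1,2)] mass_tendsto[OF order_trans[OF assms(1,2)] assms(3)]
    mass_tendsto[OF assms(1) order_trans[OF assms(2,3)]] AE_space
proof eventually_elim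
  fix \<omega>
  assume *: "(\<lambda>n. mass 0 n a c \<omega>) \<longlonglongrightarrow> lmass a c \<omega>" "(\<lambda>n. mass 0 n c d \<omega>) \<longlonglongrightarrow> lmass c d \<omega>"
    "(\<lambda>n. mass 0 n a d \<omega>) \<longlonglongrightarrow> lmass a d \<omega>" "\<omega> \<in> space M"
  have "(\<lambda>n. mass 0 n a d \<omega>) \<longlonglongrightarrow> lmass a c \<omega> + lmass c d \<omega>"
    using tendsto_add[OF *(1,2)] mass_split[OF assms(2,3) *(4)] by simp
  with *(3) show "lmass a d \<omega> = lmass a c \<omega> + lmass c d \<omega>" by (rule LIMSEQ_unique)
qed

lemma lmass_le_total:
  assumes "0 \<le> a" "a \<le> c" "c \<le> 1"
  shows "AE \<omega> in M. lmass a c \<omega> \<le> lmass 0 1 \<omega>"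
proof -
  have "AE \<omega> in M. lmass 0 1 \<omega> = lmass 0 a \<omega> + lmass a 1 \<omega>"
    "AE \<omega> in M. lmass a 1 \<omega> = lmass a c \<omega> + lmass c 1 \<omega>"
    using assms by (auto intro: lmass_split)
  then show ?thesis
  proof eventually_elim
    fix \<omega> assume "lmass 0 1 \<omega> = lmass 0 a \<omega> + lmass a 1 \<omega>" "lmass a 1 \<omega> = lmass a c \<omega> + lmass c 1 \<omega>"
    then show "lmass a c \<omega> \<le> lmass 0 1 \<omega>"
      using lmass_nonneg[of 0 a \<omega>] lmass_nonneg[of c 1 \<omega>] by linarith
  qed
qed

definition mom :: "real \<Rightarrow> real \<Rightarrow> real" where
  "mom q t = expectation (\<lambda>\<omega>. lmass 0 t \<omega> powr q)"

text \<open>The solution of \<open>b powr (- Kexp q) = kap q / b powr q\<close>, the ratio by which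
  the moment changes, up to the error terms, when the interval shrinks by the factor
  \<open>b\<close>.\<close>

definition Kexp :: "real \<Rightarrow> real" where
  "Kexp q = q - ln (kap q) / ln b"

context
  fixes q :: real
  assumes q: "0 < q" and Lq: "integrable M (\<lambda>\<omega>. lmass 0 1 \<omega> powr q)"
begin

lemma lmass_powr_integrable:
  assumes "0 \<le> a" "a \<le> c" "c \<le> 1"
  shows "integrable M (\<lambda>\<omega>. lmass a c \<omega> powr q)"
proof (rule Bochner_Integration.integrable_bound[OF Lq])
  have [measurable]: "lmass a c \<in> borel_measurable M" by (rule lmass_measurable[OF assms(1,2)])
  show "(\<lambda>\<omega>. lmass a c \<omega> powr q) \<in> borel_measurable M" by measurable
  show "AE \<omega> in M. norm (lmass a c \<omega> powr q) \<le> norm (lmass 0 1 \<omega> powr q)"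
    using lmass_le_total[OF assms] by eventually_elim (use q in \<open>auto intro!: powr_mono2 simp: lmass_nonneg\<close>)
qed

lemma mom_nonneg: "0 \<le> mom q t"
  unfolding mom_def by (intro Bochner_Integration.integral_nonneg) auto

lemma trunc_le_mom:
  assumes "0 < l" "0 \<le> t" "t \<le> 1"
  shows "tmom l q (lmass 0 t) \<le> mom q t"
  unfolding mom_def using assms q
  by (intro trunc_le_moment lmass_powr_integrable lmass_measurable) (auto simp: lmass_nonneg)

lemma mom_le_of_trunc_le:
  assumes "0 \<le> t" "t \<le> 1" "\<And>l. 0 < l \<Longrightarrow> tmom l q (lmass 0 t) \<le> B"
  shows "mom q t \<le> B"
  unfolding mom_def using assms q
  by (intro moment_le_of_trunc_le lmass_powr_integrable lmass_measurable) (auto simp: lmass_nonneg)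

text \<open>Stationarity is available for truncated moments only, so the equality is split into two
  inequalities, each tested at an arbitrary level.\<close>

lemma moment_shift:
  assumes "0 \<le> a" "0 \<le> t" "a + t \<le> 1"
  shows "expectation (\<lambda>\<omega>. lmass a (a + t) \<omega> powr q) = mom q t"
proof (rule antisym)
  have m: "lmass a (a + t) \<in> borel_measurable M" using assms by (intro lmass_measurable) auto
  have i: "integrable M (\<lambda>\<omega>. lmass a (a + t) \<omega> powr q)" using assms by (intro lmass_powr_integrable) auto
  show "expectation (\<lambda>\<omega>. lmass a (a + t) \<omega> powr q) \<le> mom q t"
  proof (rule moment_le_of_trunc_le[OF q m _ i])
    show "tmom l q (lmass a (a + t)) \<le> mom q t" if "0 < l" for l
      using trunc_lmass_shift[OF q that assms(1,2)] trunc_le_mom[OF that assms(2)] assms by simp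
  qed (simp add: lmass_nonneg)
  show "mom q t \<le> expectation (\<lambda>\<omega>. lmass a (a + t) \<omega> powr q)"
  proof (rule mom_le_of_trunc_le)
    show "tmom l q (lmass 0 t) \<le> expectation (\<lambda>\<omega>. lmass a (a + t) \<omega> powr q)"
      if "0 < l" for l
      using trunc_lmass_shift[OF q that assms(1,2)] trunc_le_moment[OF q that m _ i]
      by (simp add: lmass_nonneg)
  qed (use assms in auto)
qed

lemma mom_mono:
  assumes "0 \<le> s" "s \<le> t" "t \<le> 1"
  shows "mom q s \<le> mom q t"
  unfolding mom_def
proof (rule integral_mono_AE)
  show "AE \<omega> in M. lmass 0 s \<omega> powr q \<le> lmass 0 t \<omega> powr q"
    using lmass_split[OF order_refl assms(1,2)]
  proof eventually_elim
    fix \<omega> assume "lmass 0 t \<omega> = lmass 0 s \<omega> + lmass s t \<omega>"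
    then show "lmass 0 s \<omega> powr q \<le> lmass 0 t \<omega> powr q"
      using q lmass_nonneg[of s t \<omega>] lmass_nonneg[of 0 s \<omega>] by (intro powr_mono2) auto
  qed
qed (use assms in \<open>auto intro!: lmass_powr_integrable\<close>)

lemma div_b_bounds:
  assumes "0 \<le> t" "t \<le> 1"
  shows "0 \<le> t / b" "t / b \<le> 1"
  using assms b by (auto simp: divide_le_eq)

lemma mom_step_upper:
  assumes t: "0 \<le> t" "t \<le> 1"
  shows "mom q (t / b) \<le> (kap q + hi powr q * C2 * (t / b)) / b powr q * mom q t"
proof (rule mom_le_of_trunc_le[OF div_b_bounds[OF t]])
  fix l :: real assume l: "0 < l"
  have c: "0 \<le> (kap q + hi powr q * C2 * (t / b)) / b powr q"
    using kap_pos[OF q] C2_nonneg t b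
    by (intro divide_nonneg_nonneg add_nonneg_nonneg mult_nonneg_nonneg) auto
  have "tmom l q (lmass 0 (t / b))
    \<le> (kap q + hi powr q * C2 * (t / b)) / b powr q *
      tmom (l / (lo / b)) q (lmass 0 t)"
    by (rule trunc_lmass_step_upper[OF q l t(1)])
  \<comment> \<open>The changed level is absorbed here: at any level the truncated moment is at most
    the full one.\<close>
  also have "\<dots> \<le> (kap q + hi powr q * C2 * (t / b)) / b powr q * mom q t"
    using l lo b t by (intro mult_left_mono c trunc_le_mom) auto
  finally show "tmom l q (lmass 0 (t / b))
    \<le> (kap q + hi powr q * C2 * (t / b)) / b powr q * mom q t" .
qed

lemma mom_step_lower:
  assumes t: "0 \<le> t" "t \<le> 1"
  shows "max (lo powr q) (kap q - hi powr q * C2 * (t / b)) / b powr q * mom q t \<le> mom q (t / b)"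
proof -
  let ?c = "max (lo powr q) (kap q - hi powr q * C2 * (t / b)) / b powr q"
  have c: "0 < ?c" using lo b by (intro divide_pos_pos) (auto simp: less_max_iff_disj)
  have "mom q t \<le> mom q (t / b) / ?c"
  proof (rule mom_le_of_trunc_le[OF t])
    fix l :: real assume l: "0 < l"
    \<comment> \<open>Chosen so that the scale step returns exactly the prescribed level
      \<open>l\<close>.\<close>
    define l' where "l' = l * (hi / b)"
    have l': "0 < l'" "l' / (hi / b) = l" using l hi b by (auto simp: l'_def)
    have "?c * tmom l q (lmass 0 t) \<le> tmom l' q (lmass 0 (t / b))"
      using trunc_lmass_step_lower[OF q l'(1) t(1)] unfolding l'(2) .
    also have "\<dots> \<le> mom q (t / b)" by (rule trunc_le_mom[OF l'(1) div_b_bounds[OF t]])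
    finally show "tmom l q (lmass 0 t) \<le> mom q (t / b) / ?c"
      using c by (simp only: pos_le_divide_eq mult.commute)
  qed
  then show ?thesis using c by (simp only: pos_le_divide_eq mult.commute)
qed

text \<open>A vanishing moment would make the limit mass vanish almost surely, contradicting its
  mean 1.\<close>

lemma mom_1_pos: "0 < mom q 1"
proof -
  have "mom q 1 \<noteq> 0"
  proof
    assume "mom q 1 = 0"
    then have "AE \<omega> in M. lmass 0 1 \<omega> powr q = 0"
      unfolding mom_def by (subst (asm) integral_nonneg_eq_0_iff_AE[OF Lq]) auto
    then have "AE \<omega> in M. lmass 0 1 \<omega> = 0" by simp
    then have "expectation (lmass 0 1) = 0" by (rule integral_eq_zero_AE)
    then show False using expectation_lmass[of 0 1] by simp
  qed
  then show ?thesis using mom_nonneg[of 1] by simp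
qed

lemma geometric_powr: "(kap q / b powr q) ^ n = (1 / b ^ n) powr Kexp q"
proof -
  have "kap q / b powr q = b powr (- Kexp q)"
  proof -
    have "b powr (ln (kap q) / ln b) = kap q" using b kap_pos[OF q] by (simp add: powr_def)
    then show ?thesis by (simp add: Kexp_def powr_diff)
  qed
  then have "(kap q / b powr q) ^ n = (b powr (- Kexp q)) powr real n"
    using b by (simp add: powr_realpow)
  also have "\<dots> = (b powr real n) powr (- Kexp q)" by (simp add: powr_powr mult.commute)
  also have "\<dots> = (1 / b ^ n) powr Kexp q"
    using b by (simp add: powr_realpow powr_minus powr_divide inverse_eq_divide)
  finally show ?thesis .
qed

lemma mom_power_bounds:
  obtains c1 c2 where "0 < c1" "0 < c2"
    "\<And>n. c1 * (1 / b ^ n) powr Kexp q \<le> mom q (1 / b ^ n)"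
    "\<And>n. mom q (1 / b ^ n) \<le> c2 * (1 / b ^ n) powr Kexp q"
proof -
  define H where "H = hi powr q * C2"
  have H: "0 \<le> H" using C2_nonneg by (simp add: H_def)
  note \<kappa> = kap_pos[OF q]
  obtain h where h: "0 \<le> h" "\<And>x. 0 \<le> x \<Longrightarrow> kap q * exp (- (h * x)) \<le> max (lo powr q) (kap q - H * x)"
    using exp_lower_bound_of_max[of "lo powr q" "kap q" H] lo kap_ge[OF q] H by auto
  \<comment> \<open>Comes from bounding \<open>kap q + H * x\<close> by
    \<open>kap q * exp (h' * x)\<close>.\<close>
  define h' where "h' = H / kap q"
  have h': "0 \<le> h'" using H \<kappa> by (simp add: h'_def)
  \<comment> \<open>The step from \<open>1 / b ^ i\<close> to \<open>1 / b ^ Suc i\<close> has error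
    exponent proportional to \<open>1 / b ^ Suc i\<close>. Their sum stays below
    \<open>1 / (b - 1)\<close>, so n steps cost only a bounded factor.\<close>
  define S where "S n = (\<Sum>i<n. 1 / b ^ Suc i)" for n :: nat
  have S: "S n \<le> 1 / (b - 1)" for n
  proof -
    have "(b - 1) * S n = 1 - 1 / b ^ n"
    proof (induction n)
      case (Suc n)
      have "(b - 1) * S (Suc n) = (b - 1) * S n + (b - 1) * (1 / b ^ Suc n)"
        by (simp add: S_def distrib_left)
      also have "\<dots> = 1 - 1 / b ^ Suc n" unfolding Suc using b by (simp add: field_simps)
      finally show ?case .
    qed (simp add: S_def)
    then have "S n = (1 - 1 / b ^ n) / (b - 1)" using b by (simp add: field_simps)
    also have "\<dots> \<le> 1 / (b - 1)" using b by (intro divide_right_mono) auto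
    finally show ?thesis .
  qed
  define \<gamma> where "\<gamma> = kap q / b powr q"
  have \<gamma>: "0 < \<gamma>" using \<kappa> b by (simp add: \<gamma>_def)
  have t: "0 \<le> 1 / b ^ n" "1 / b ^ n \<le> 1" "1 / b ^ n / b = 1 / b ^ Suc n" for n
    using b by (auto simp: divide_le_eq one_le_power mult.commute)
  have lower: "\<gamma> ^ n * exp (- (h * S n)) * mom q 1 \<le> mom q (1 / b ^ n)" for n
  proof (induction n)
    case (Suc n)
    have "\<gamma> ^ Suc n * exp (- (h * S (Suc n))) * mom q 1
        = \<gamma> * exp (- (h * (1 / b ^ Suc n))) * (\<gamma> ^ n * exp (- (h * S n)) * mom q 1)"
    proof -
      have "- (h * S (Suc n)) = - (h * (1 / b ^ Suc n)) + - (h * S n)"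
        by (simp add: S_def distrib_left)
      then show ?thesis by (simp only: exp_add power_Suc ac_simps)
    qed
    also have "\<dots> \<le> \<gamma> * exp (- (h * (1 / b ^ Suc n))) * mom q (1 / b ^ n)"
      using \<gamma> Suc by (intro mult_left_mono) auto
    also have "\<dots> = kap q * exp (- (h * (1 / b ^ Suc n))) / b powr q * mom q (1 / b ^ n)"
      by (simp add: \<gamma>_def)
    also have "\<dots> \<le> max (lo powr q) (kap q - H * (1 / b ^ Suc n)) / b powr q * mom q (1 / b ^ n)"
      using h(2)[OF t(1)[of "Suc n"]] mom_nonneg by (intro mult_right_mono divide_right_mono) auto
    also have "\<dots> \<le> mom q (1 / b ^ Suc n)"
      using mom_step_lower[OF t(1,2), of n] unfolding t(3) H_def .
    finally show ?case .
  qed (simp add: S_def)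
  have upper: "mom q (1 / b ^ n) \<le> \<gamma> ^ n * exp (h' * S n) * mom q 1" for n
  proof (induction n)
    case (Suc n)
    have "mom q (1 / b ^ Suc n) \<le> (kap q + H * (1 / b ^ Suc n)) / b powr q * mom q (1 / b ^ n)"
      using mom_step_upper[OF t(1,2), of n] unfolding t(3) H_def .
    also have "\<dots> \<le> \<gamma> * exp (h' * (1 / b ^ Suc n)) * mom q (1 / b ^ n)"
    proof (intro mult_right_mono mom_nonneg)
      have "kap q + H * (1 / b ^ Suc n) = kap q * (1 + h' * (1 / b ^ Suc n))"
        using \<kappa> by (simp add: h'_def distrib_left)
      also have "\<dots> \<le> kap q * exp (h' * (1 / b ^ Suc n))"
        using \<kappa> by (intro mult_left_mono exp_ge_add_one_self) auto
      finally show "(kap q + H * (1 / b ^ Suc n)) / b powr q \<le> \<gamma> * exp (h' * (1 / b ^ Suc n))"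
        unfolding \<gamma>_def by (simp add: divide_right_mono)
    qed
    also have "\<dots> \<le> \<gamma> * exp (h' * (1 / b ^ Suc n)) * (\<gamma> ^ n * exp (h' * S n) * mom q 1)"
      using \<gamma> Suc by (intro mult_left_mono) auto
    also have "\<dots> = \<gamma> ^ Suc n * exp (h' * S (Suc n)) * mom q 1"
    proof -
      have "h' * S (Suc n) = h' * (1 / b ^ Suc n) + h' * S n"
        by (simp add: S_def distrib_left)
      then show ?thesis by (simp only: exp_add power_Suc ac_simps)
    qed
    finally show ?case .
  qed (simp add: S_def)
  show ?thesis
  proof (rule that)
    show "0 < exp (- (h * (1 / (b - 1)))) * mom q 1" "0 < exp (h' * (1 / (b - 1))) * mom q 1"
      using mom_1_pos by auto
    fix n
    have "exp (- (h * (1 / (b - 1)))) * mom q 1 * \<gamma> ^ n \<le> exp (- (h * S n)) * mom q 1 * \<gamma> ^ n"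
      using mult_left_mono[OF S h(1), of n] \<gamma> mom_nonneg by (intro mult_right_mono) auto
    then show "exp (- (h * (1 / (b - 1)))) * mom q 1 * (1 / b ^ n) powr Kexp q \<le> mom q (1 / b ^ n)"
      using lower[of n] unfolding geometric_powr[symmetric] \<gamma>_def by (simp add: ac_simps)
    have "exp (h' * S n) * mom q 1 * \<gamma> ^ n \<le> exp (h' * (1 / (b - 1))) * mom q 1 * \<gamma> ^ n"
      using mult_left_mono[OF S h', of n] \<gamma> mom_nonneg by (intro mult_right_mono) auto
    then show "mom q (1 / b ^ n) \<le> exp (h' * (1 / (b - 1))) * mom q 1 * (1 / b ^ n) powr Kexp q"
      using upper[of n] unfolding geometric_powr[symmetric] \<gamma>_def by (simp add: ac_simps)
  qed
qed

text \<open>Splitting the degenerate interval into two copies of itself makes its mass equal to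
  twice itself.\<close>

lemma mom_0: "mom q 0 = 0"
proof -
  have "AE \<omega> in M. lmass 0 0 \<omega> = lmass 0 0 \<omega> + lmass 0 0 \<omega>" by (rule lmass_split) auto
  then have "AE \<omega> in M. lmass 0 0 \<omega> powr q = 0" by eventually_elim simp
  then show ?thesis unfolding mom_def by (rule integral_eq_zero_AE)
qed

lemma mom_bounds:
  obtains c1 c2 where "0 < c1" "0 < c2" "c1 \<le> c2"
    "\<And>t. 0 \<le> t \<Longrightarrow> t \<le> 1 \<Longrightarrow> c1 * t powr Kexp q \<le> mom q t"
    "\<And>t. 0 \<le> t \<Longrightarrow> t \<le> 1 \<Longrightarrow> mom q t \<le> c2 * t powr Kexp q"
proof -
  obtain c1 c2 where c: "0 < c1" "0 < c2"
    "\<And>n. c1 * (1 / b ^ n) powr Kexp q \<le> mom q (1 / b ^ n)"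
    "\<And>n. mom q (1 / b ^ n) \<le> c2 * (1 / b ^ n) powr Kexp q"
    by (rule mom_power_bounds) blast
  let ?K = "Kexp q" and ?B = "b powr \<bar>Kexp q\<bar>"
  have B: "0 < ?B" using b by simp
  have bounds: "c1 / ?B * t powr ?K \<le> mom q t \<and> mom q t \<le> c2 * ?B * t powr ?K" if t: "0 \<le> t" "t \<le> 1" for t
  proof (cases "t = 0")
    case True
    \<comment> \<open>\<open>0 powr x\<close> is 0 for every \<open>x\<close>, so at
      \<open>t = 0\<close> all sides vanish whatever the sign of the exponent.\<close>
    then show ?thesis by (simp add: mom_0)
  next
    case False
    then have t0: "0 < t" using t by simp
    have "\<exists>n. 1 / b ^ n < t"
    proof -
      obtain n where "1 / t < b ^ n" using real_arch_pow[OF b] by blast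
      then have "1 / b ^ n < t" using t0 b by (simp add: field_simps)
      then show ?thesis by blast
    qed
    \<comment> \<open>Minimality of \<open>n\<close> puts \<open>t\<close> between consecutive
      powers of \<open>1 / b\<close>, and monotonicity of the moment interpolates between them. The
      case \<open>n = 0\<close> is excluded by \<open>t \<le> 1\<close>.\<close>
    then obtain n where n: "1 / b ^ n < t" "\<And>m. m < n \<Longrightarrow> \<not> 1 / b ^ m < t"
      using LeastI_ex[of "\<lambda>n. 1 / b ^ n < t"] not_less_Least by blast
    have "n \<noteq> 0" using n(1) t by (intro notI) simp
    then obtain m where m: "n = Suc m" using not0_implies_Suc by blast
    define u where "u = 1 / b ^ m"
    have u: "0 < u" "u \<le> 1" "t \<le> u" "u / b < t" using n(1) n(2)[of m] m b
      by (auto simp: u_def divide_le_eq one_le_power mult.commute)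
    have e: "1 / b ^ m = u" "1 / b ^ n = u / b" using m by (auto simp: u_def mult.commute)
    have "mom q t \<le> mom q u" using t u by (intro mom_mono) auto
    also have "\<dots> \<le> c2 * u powr ?K" using c(4)[of m] unfolding e .
    also have "\<dots> \<le> c2 * (?B * t powr ?K)"
    proof (intro mult_left_mono)
      \<comment> \<open>The ratio \<open>t / u\<close> lies between \<open>1 / b\<close> and 1; the
        negated exponent yields a bound on the power of \<open>u\<close> by that of
        \<open>t\<close>.\<close>
      have "(t / u) powr (- ?K) \<le> b powr \<bar>- ?K\<bar>"
        using u b t0 by (intro powr_between) (auto simp: field_simps)
      then have "(t / u) powr (- ?K) * t powr ?K \<le> ?B * t powr ?K" by (intro mult_right_mono) auto
      then show "u powr ?K \<le> ?B * t powr ?K" using t0 u by (simp add: powr_divide powr_minus field_simps)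
    qed (use c in auto)
    finally have 1: "mom q t \<le> c2 * ?B * t powr ?K" by (simp add: mult.assoc)
    have "c1 / ?B * t powr ?K \<le> c1 * (u / b) powr ?K"
    proof -
      have "b powr (- \<bar>?K\<bar>) \<le> (u / b / t) powr ?K"
        using u b t0 by (intro powr_between) (auto simp: field_simps)
      moreover have "(u / b / t) powr ?K = (u / b) powr ?K / t powr ?K"
        by (rule powr_divide)
      ultimately have "1 / ?B \<le> (u / b) powr ?K / t powr ?K" by (simp only: powr_minus_divide)
      then have "1 / ?B * t powr ?K \<le> (u / b) powr ?K" using t0 by (simp add: field_simps)
      from mult_left_mono[OF this, of c1] show ?thesis using c by simp
    qed
    also have "\<dots> \<le> mom q (u / b)" using c(3)[of n] unfolding e .
    also have "\<dots> \<le> mom q t" using t u b by (intro mom_mono) auto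
    finally show ?thesis using 1 by simp
  qed
  have c12: "c1 / ?B \<le> c2 * ?B"
    using bounds[of 1] by simp
  show ?thesis
    using that[of "c1 / ?B" "c2 * ?B"] c B c12 bounds by auto
qed

end

end

section \<open>Weak limits and the Renyi function\<close>

text \<open>One minus the distance to \<open>[a, c]\<close> in units of \<open>\<epsilon>\<close>,
  cut off at 0: a continuous substitute for the indicator, since weak convergence tests continuous
  functions only.\<close>

definition tent :: "real \<Rightarrow> real \<Rightarrow> real \<Rightarrow> real \<Rightarrow> real" where
  "tent a c \<epsilon> s = max 0 (1 - max 0 (max (a - s) (s - c)) / \<epsilon>)"

lemma tent_bounds: "0 < \<epsilon> \<Longrightarrow> 0 \<le> tent a c \<epsilon> s" "0 < \<epsilon> \<Longrightarrow> tent a c \<epsilon> s \<le> 1"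
  by (auto simp: tent_def)

lemma tent_eq_1: "s \<in> {a..c} \<Longrightarrow> tent a c \<epsilon> s = 1"
  by (auto simp: tent_def)

lemma tent_eq_0:
  assumes "0 < \<epsilon>" "s \<notin> {a - \<epsilon>..c + \<epsilon>}"
  shows "tent a c \<epsilon> s = 0"
proof -
  have "1 * \<epsilon> \<le> max 0 (max (a - s) (s - c))" using assms by auto
  then have "1 \<le> max 0 (max (a - s) (s - c)) / \<epsilon>" using assms by (subst pos_le_divide_eq)
  then show ?thesis by (simp add: tent_def)
qed

lemma tent_continuous: "\<epsilon> \<noteq> 0 \<Longrightarrow> continuous_on S (tent a c \<epsilon>)"
  unfolding tent_def by (intro continuous_intros) auto

lemma tent_measurable [measurable]: "tent a c \<epsilon> \<in> borel_measurable borel"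
  unfolding tent_def by measurable

abbreviation (in cascade) weak_conv :: "real measure \<Rightarrow> 'w \<Rightarrow> bool" where
  "weak_conv \<nu> \<omega> \<equiv> \<forall>f. continuous_on {0..1} f \<longrightarrow>
    (\<lambda>n. \<integral>s. indicator {0..1} s * f s * den 0 n s \<omega> \<partial>lborel) \<longlonglongrightarrow> (\<integral>s. indicator {0..1} s * f s \<partial>\<nu>)"

locale cascade_weak_limit = cascade M L b lo hi m2 C1 C2
  for M :: "'w measure" and L b lo hi m2 C1 C2 +
  fixes mu :: "'w \<Rightarrow> real measure"
  assumes mu_finite: "finite_measure (mu \<omega>)" and mu_sets: "sets (mu \<omega>) = sets borel"
    and mu_measurable: "(\<lambda>\<omega>. measure (mu \<omega>) {x..y}) \<in> borel_measurable M"
    and weak: "AE \<omega> in M. weak_conv (mu \<omega>) \<omega>"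
begin

section \<open>Comparison of weak limits with the limit masses\<close>

lemma mu_integrable:
  fixes f :: "real \<Rightarrow> real"
  assumes "f \<in> borel_measurable borel" "\<And>s. \<bar>f s\<bar> \<le> B"
  shows "integrable (mu \<omega>) f"
proof (rule finite_measure.integrable_const_bound[OF mu_finite])
  show "f \<in> borel_measurable (mu \<omega>)"
    using assms(1) by (simp cong: measurable_cong_sets add: measurable_cong_sets[OF mu_sets refl])
qed (use assms in auto)

lemma mu_indicator: "(\<integral>s. indicator {x..y} s \<partial>mu \<omega>) = measure (mu \<omega>) {x..y}"
proof -
  have "{x..y} \<inter> space (mu \<omega>) = {x..y}"
    using sets_eq_imp_space_eq[OF mu_sets[of \<omega>]] by simp
  then show ?thesis by (simp add: mu_sets)
qed

lemma tent_den_integrable: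
  assumes "0 < \<epsilon>" "\<omega> \<in> space M"
  shows "integrable lborel (\<lambda>s. indicator {0..1} s * tent a c \<epsilon> s * den 0 n s \<omega>)"
proof (rule Bochner_Integration.integrable_bound[OF den_integrable[OF assms(2), of 0 1 0 n]])
  show "(\<lambda>s. indicator {0..1} s * tent a c \<epsilon> s * den 0 n s \<omega>) \<in> borel_measurable lborel"
    using assms(2) by measurable
  show "AE s in lborel. norm (indicator {0..1} s * tent a c \<epsilon> s * den 0 n s \<omega>)
      \<le> norm (indicator {0..1} s * den 0 n s \<omega>)"
    using tent_bounds[OF assms(1)] den_pos
    by (intro AE_I2) (auto simp: abs_mult indicator_def less_imp_le mult_left_le_one_le)
qed

text \<open>The closed interval is enlarged to make room for the slopes of the tent; no statement
  about atoms at its endpoints is then required. The clipping at 0 and 1 reflects that the test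
  integrals extend over the unit interval only.\<close>

lemma mu_le_lmass:
  assumes "0 \<le> x" "x \<le> y" "y \<le> 1" "0 < \<epsilon>"
  shows "AE \<omega> in M. measure (mu \<omega>) {x..y} \<le> lmass (max 0 (x - \<epsilon>)) (min 1 (y + \<epsilon>)) \<omega>"
proof -
  let ?x = "max 0 (x - \<epsilon>)" and ?y = "min 1 (y + \<epsilon>)"
  have xy: "0 \<le> ?x" "?x \<le> ?y" using assms by auto
  show ?thesis
    using weak mass_tendsto[OF xy] AE_space
  proof eventually_elim
    fix \<omega> assume w: "weak_conv (mu \<omega>) \<omega>"
      and m: "(\<lambda>n. mass 0 n ?x ?y \<omega>) \<longlonglongrightarrow> lmass ?x ?y \<omega>" and \<omega>: "\<omega> \<in> space M"
    have "continuous_on {0..1} (tent x y \<epsilon>)" using assms by (intro tent_continuous) auto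
    then have lim: "(\<lambda>n. \<integral>s. indicator {0..1} s * tent x y \<epsilon> s * den 0 n s \<omega> \<partial>lborel)
          \<longlonglongrightarrow> (\<integral>s. indicator {0..1} s * tent x y \<epsilon> s \<partial>mu \<omega>)" using w by blast
    have "measure (mu \<omega>) {x..y} = (\<integral>s. indicator {x..y} s \<partial>mu \<omega>)" by (rule mu_indicator[symmetric])
    also have "\<dots> \<le> (\<integral>s. indicator {0..1} s * tent x y \<epsilon> s \<partial>mu \<omega>)"
    proof (intro integral_mono mu_integrable[where B=1])
      show "indicator {x..y} s \<le> indicator {0..1} s * tent x y \<epsilon> s" for s
        using tent_eq_1[of s x y \<epsilon>] tent_bounds[OF assms(4)] assms by (auto simp: indicator_def)
    qed (use tent_bounds[OF assms(4)] in \<open>auto simp: indicator_def\<close>)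
    also have "\<dots> \<le> lmass ?x ?y \<omega>"
    proof (rule LIMSEQ_le[OF lim m], intro exI allI impI)
      fix n :: nat
      show "(\<integral>s. indicator {0..1} s * tent x y \<epsilon> s * den 0 n s \<omega> \<partial>lborel) \<le> mass 0 n ?x ?y \<omega>"
        unfolding mass_def
      proof (intro integral_mono tent_den_integrable den_integrable assms \<omega>)
        fix s :: real
        have "indicator {0..1} s * tent x y \<epsilon> s \<le> (indicator {?x..?y} s :: real)"
          using tent_eq_0[OF assms(4), of s x y] tent_bounds[OF assms(4), of x y s]
          by (auto simp: indicator_def)
        then show "indicator {0..1} s * tent x y \<epsilon> s * den 0 n s \<omega> \<le> indicator {?x..?y} s * den 0 n s \<omega>"
          using den_pos[of 0 n s \<omega>] by (intro mult_right_mono) auto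
      qed
    qed
    finally show "measure (mu \<omega>) {x..y} \<le> lmass ?x ?y \<omega>" .
  qed
qed

text \<open>The same tent sandwiched the other way: it dominates the indicator of
  \<open>[x, y]\<close> before the limit and is dominated by that of the enlarged interval after
  it.\<close>

lemma lmass_le_mu:
  assumes "0 \<le> x - \<epsilon>" "x \<le> y" "y + \<epsilon> \<le> 1" "0 < \<epsilon>"
  shows "AE \<omega> in M. lmass x y \<omega> \<le> measure (mu \<omega>) {x - \<epsilon>..y + \<epsilon>}"
proof -
  have x: "0 \<le> x" using assms by simp
  show ?thesis
    using weak mass_tendsto[OF x assms(2)] AE_space
  proof eventually_elim
    fix \<omega> assume w: "weak_conv (mu \<omega>) \<omega>"
      and m: "(\<lambda>n. mass 0 n x y \<omega>) \<longlonglongrightarrow> lmass x y \<omega>" and \<omega>: "\<omega> \<in> space M"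
    have "continuous_on {0..1} (tent x y \<epsilon>)" using assms by (intro tent_continuous) auto
    then have lim: "(\<lambda>n. \<integral>s. indicator {0..1} s * tent x y \<epsilon> s * den 0 n s \<omega> \<partial>lborel)
          \<longlonglongrightarrow> (\<integral>s. indicator {0..1} s * tent x y \<epsilon> s \<partial>mu \<omega>)" using w by blast
    have "lmass x y \<omega> \<le> (\<integral>s. indicator {0..1} s * tent x y \<epsilon> s \<partial>mu \<omega>)"
    proof (rule LIMSEQ_le[OF m lim], intro exI allI impI)
      fix n :: nat
      show "mass 0 n x y \<omega> \<le> (\<integral>s. indicator {0..1} s * tent x y \<epsilon> s * den 0 n s \<omega> \<partial>lborel)"
        unfolding mass_def
      proof (intro integral_mono tent_den_integrable den_integrable assms \<omega>)
        fix s :: real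
        have "(indicator {x..y} s :: real) \<le> indicator {0..1} s * tent x y \<epsilon> s"
          using tent_eq_1[of s x y \<epsilon>] tent_bounds[OF assms(4)] assms by (auto simp: indicator_def)
        then show "indicator {x..y} s * den 0 n s \<omega> \<le> indicator {0..1} s * tent x y \<epsilon> s * den 0 n s \<omega>"
          using den_pos[of 0 n s \<omega>] by (intro mult_right_mono) auto
      qed
    qed
    also have "\<dots> \<le> (\<integral>s. indicator {x - \<epsilon>..y + \<epsilon>} s \<partial>mu \<omega>)"
    proof (intro integral_mono mu_integrable[where B=1])
      show "indicator {0..1} s * tent x y \<epsilon> s \<le> indicator {x - \<epsilon>..y + \<epsilon>} s" for s
        using tent_eq_0[OF assms(4), of s x y] tent_bounds[OF assms(4), of x y s]
        by (auto simp: indicator_def)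
    qed (use tent_bounds[OF assms(4)] in \<open>auto simp: indicator_def\<close>)
    also have "\<dots> = measure (mu \<omega>) {x - \<epsilon>..y + \<epsilon>}" by (rule mu_indicator)
    finally show "lmass x y \<omega> \<le> measure (mu \<omega>) {x - \<epsilon>..y + \<epsilon>}" .
  qed
qed

text \<open>Each of the \<open>2 ^ n\<close> dyadic cells has a moment comparable to
  \<open>(1 / 2 ^ n) powr Kexp q\<close>, with constants free of \<open>n\<close> and of the cell.
  The constants disappear on dividing the logarithm by \<open>n\<close>, so the lower limit is a
  genuine limit.\<close>

lemma renyi_eq:
  assumes q: "0 < q" and Lq: "integrable M (\<lambda>\<omega>. lmass 0 1 \<omega> powr q)"
  shows "renyi_T M mu q = ereal (Kexp q - 1)"
proof -
  let ?K = "Kexp q"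
  obtain c1 c2 where c: "0 < c1" "0 < c2"
    "\<And>t. 0 \<le> t \<Longrightarrow> t \<le> 1 \<Longrightarrow> c1 * t powr ?K \<le> mom q t"
    "\<And>t. 0 \<le> t \<Longrightarrow> t \<le> 1 \<Longrightarrow> mom q t \<le> c2 * t powr ?K"
    using mom_bounds[OF q Lq] by metis
  \<comment> \<open>\<open>d1\<close> stems from an inner interval of half the cell length,
    \<open>d2\<close> from an outer one of at most three times that length.\<close>
  define d1 where "d1 = c1 * (1 / 2) powr ?K"
  define d2 where "d2 = c2 * 3 powr \<bar>?K\<bar>"
  have d: "0 < d1" "0 < d2" using c by (auto simp: d1_def d2_def)
  define I where "I n k = {real k / 2 ^ n..real (Suc k) / 2 ^ n}" for n k :: nat
  have cell: "integrable M (\<lambda>\<omega>. measure (mu \<omega>) (I n k) powr q) \<and>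
      d1 * (1 / 2 ^ n) powr ?K \<le> expectation (\<lambda>\<omega>. measure (mu \<omega>) (I n k) powr q) \<and>
      expectation (\<lambda>\<omega>. measure (mu \<omega>) (I n k) powr q) \<le> d2 * (1 / 2 ^ n) powr ?K"
    if k: "k < 2 ^ n" for n k
  proof -
    define h where "h = (1 :: real) / 2 ^ n"
    define x where "x = real k * h"
    define y where "y = x + h"
    have h: "0 < h" by (simp add: h_def)
    have "real (Suc k) \<le> real (2 ^ n)" using k by (subst of_nat_le_iff) simp
    then have "real (Suc k) * h \<le> 1" by (simp add: h_def divide_le_eq)
    then have y1: "y \<le> 1" by (simp add: y_def x_def algebra_simps)
    have x0: "0 \<le> x" using h by (simp add: x_def)
    have I: "I n k = {x..y}" by (simp add: I_def x_def y_def h_def field_simps)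
    have [measurable]: "(\<lambda>\<omega>. measure (mu \<omega>) (I n k)) \<in> borel_measurable M"
      unfolding I_def by (rule mu_measurable)
    \<comment> \<open>The cell together with its two neighbours, as far as they lie in the unit
      interval; its length \<open>D\<close> is therefore between \<open>h\<close> and
      \<open>3 * h\<close>.\<close>
    define x' where "x' = max 0 (x - h)"
    define D where "D = min 1 (y + h) - x'"
    have D: "0 \<le> x'" "h \<le> D" "D \<le> 3 * h" "x' + D \<le> 1" "x' + D = min 1 (y + h)"
      using h x0 y1 by (auto simp: x'_def D_def y_def)
    have le: "AE \<omega> in M. measure (mu \<omega>) (I n k) \<le> lmass x' (x' + D) \<omega>"
    proof -
      have "x \<le> y" using h by (simp add: y_def)
      from mu_le_lmass[OF x0 this y1 h] show ?thesis unfolding I D(5) unfolding x'_def .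
    qed
    have i1: "integrable M (\<lambda>\<omega>. lmass x' (x' + D) \<omega> powr q)"
      using D h by (intro lmass_powr_integrable[OF q Lq]) auto
    have le': "AE \<omega> in M. measure (mu \<omega>) (I n k) powr q \<le> lmass x' (x' + D) \<omega> powr q"
      using le by eventually_elim (use q in \<open>auto intro!: powr_mono2\<close>)
    have i2: "integrable M (\<lambda>\<omega>. measure (mu \<omega>) (I n k) powr q)"
    proof (rule Bochner_Integration.integrable_bound[OF i1])
      show "AE \<omega> in M. norm (measure (mu \<omega>) (I n k) powr q) \<le> norm (lmass x' (x' + D) \<omega> powr q)"
        using le' by eventually_elim simp
    qed measurable
    have "expectation (\<lambda>\<omega>. measure (mu \<omega>) (I n k) powr q) \<le> expectation (\<lambda>\<omega>. lmass x' (x' + D) \<omega> powr q)"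
      by (rule integral_mono_AE[OF i2 i1 le'])
    also have "\<dots> = mom q D" using D h by (intro moment_shift[OF q Lq]) auto
    also have "\<dots> \<le> c2 * D powr ?K" using c(4)[of D] D h by auto
    also have "\<dots> \<le> c2 * (3 powr \<bar>?K\<bar> * h powr ?K)"
    proof (intro mult_left_mono)
      have "(h / D) powr (- ?K) \<le> 3 powr \<bar>- ?K\<bar>"
        using D h by (intro powr_between) (auto simp: field_simps)
      then have "(h / D) powr (- ?K) * h powr ?K \<le> 3 powr \<bar>?K\<bar> * h powr ?K" by (intro mult_right_mono) auto
      then show "D powr ?K \<le> 3 powr \<bar>?K\<bar> * h powr ?K"
        using D h by (simp add: powr_divide powr_minus field_simps)
    qed (use c in auto)
    finally have up: "expectation (\<lambda>\<omega>. measure (mu \<omega>) (I n k) powr q) \<le> d2 * h powr ?K"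
      by (simp add: d2_def mult.assoc)
    \<comment> \<open>A margin of a quarter cell on either side leaves the middle half, of length
      \<open>h / 2\<close>.\<close>
    define z where "z = x + h / 4"
    have z: "z - h / 4 = x" "z + h / 2 + h / 4 = y" by (simp_all add: z_def y_def)
    have ge: "AE \<omega> in M. lmass z (z + h / 2) \<omega> \<le> measure (mu \<omega>) (I n k)"
      using lmass_le_mu[of z "h / 4" "z + h / 2"] x0 y1 h unfolding I z by simp
    have z0: "0 \<le> z" "z + h / 2 \<le> 1" using x0 h y1 by (auto simp: z_def y_def)
    have "d1 * h powr ?K = c1 * (h / 2) powr ?K"
      using h by (simp add: d1_def powr_mult[symmetric] mult.assoc)
    also have "\<dots> \<le> mom q (h / 2)" using c(3)[of "h / 2"] z0 h by simp
    also have "\<dots> = expectation (\<lambda>\<omega>. lmass z (z + h / 2) \<omega> powr q)"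
      using z0 h by (intro moment_shift[OF q Lq, symmetric]) auto
    also have "\<dots> \<le> expectation (\<lambda>\<omega>. measure (mu \<omega>) (I n k) powr q)"
    proof (intro integral_mono_AE i2 lmass_powr_integrable[OF q Lq])
      show "AE \<omega> in M. lmass z (z + h / 2) \<omega> powr q \<le> measure (mu \<omega>) (I n k) powr q"
        using ge by eventually_elim (use q in \<open>auto intro!: powr_mono2 simp: lmass_nonneg\<close>)
    qed (use z0 h in auto)
    finally show ?thesis using i2 up unfolding h_def by blast
  qed
  define E where "E n = (\<integral>\<omega>. (\<Sum>k<2^n. measure (mu \<omega>) {real k / 2^n .. real (Suc k) / 2^n} powr q) \<partial>M)" for n :: nat
  have pw: "(2::real) ^ n * (1 / 2 ^ n) powr ?K = 2 powr (real n * (1 - ?K))" for n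
  proof -
    have "(2::real) ^ n = 2 powr real n" by (simp add: powr_realpow)
    then have "(2::real) ^ n * (1 / 2 ^ n) powr ?K = 2 powr real n * (2 powr (- real n)) powr ?K"
      by (simp add: powr_minus_divide)
    then show ?thesis by (simp add: powr_powr algebra_simps flip: powr_add)
  qed
  have E: "E n = (\<Sum>k<2^n. expectation (\<lambda>\<omega>. measure (mu \<omega>) (I n k) powr q))" for n
    unfolding E_def I_def[symmetric] using cell by (intro Bochner_Integration.integral_sum) auto
  have E1: "d1 * 2 powr (real n * (1 - ?K)) \<le> E n" for n
  proof -
    have "d1 * 2 powr (real n * (1 - ?K)) = (\<Sum>k<(2::nat)^n. d1 * (1 / 2 ^ n) powr ?K)"
      by (simp add: pw[symmetric])
    also have "\<dots> \<le> E n" unfolding E using cell by (intro sum_mono) auto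
    finally show ?thesis .
  qed
  have E2: "E n \<le> d2 * 2 powr (real n * (1 - ?K))" for n
  proof -
    have "E n \<le> (\<Sum>k<(2::nat)^n. d2 * (1 / 2 ^ n) powr ?K)" unfolding E using cell by (intro sum_mono) auto
    also have "\<dots> = d2 * 2 powr (real n * (1 - ?K))" by (simp add: pw[symmetric])
    finally show ?thesis .
  qed
  have l1: "log 2 d1 + real n * (1 - ?K) \<le> log 2 (E n)" and l2: "log 2 (E n) \<le> log 2 d2 + real n * (1 - ?K)" for n
  proof -
    have "0 < d1 * 2 powr (real n * (1 - ?K))" using d by simp
    then have E0: "0 < E n" using E1[of n] by (rule less_le_trans)
    have "log 2 (d1 * 2 powr (real n * (1 - ?K))) \<le> log 2 (E n)" using E1[of n] E0 d by (subst log_le_cancel_iff) auto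
    then show "log 2 d1 + real n * (1 - ?K) \<le> log 2 (E n)" using d by (simp add: log_mult)
    have "log 2 (E n) \<le> log 2 (d2 * 2 powr (real n * (1 - ?K)))" using E2[of n] E0 d by (subst log_le_cancel_iff) auto
    then show "log 2 (E n) \<le> log 2 d2 + real n * (1 - ?K)" using d by (simp add: log_mult)
  qed
  have "(\<lambda>n. - (1 / real n) * log 2 (E n)) \<longlonglongrightarrow> ?K - 1"
  proof (rule tendsto_sandwich)
    have *: "(\<lambda>n. ?K - 1 - x * (1 / real n)) \<longlonglongrightarrow> ?K - 1" for x
    proof -
      have "(\<lambda>n. ?K - 1 - x * (1 / real n)) \<longlonglongrightarrow> ?K - 1 - x * 0"
        by (intro tendsto_intros lim_1_over_n)
      then show ?thesis by simp
    qed
    show "(\<lambda>n. ?K - 1 - log 2 d2 * (1 / real n)) \<longlonglongrightarrow> ?K - 1"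
      "(\<lambda>n. ?K - 1 - log 2 d1 * (1 / real n)) \<longlonglongrightarrow> ?K - 1" by (rule *)+
    show "\<forall>\<^sub>F n in sequentially. ?K - 1 - log 2 d2 * (1 / real n) \<le> - (1 / real n) * log 2 (E n)"
      using eventually_gt_at_top[of 0]
    proof eventually_elim
      fix n :: nat assume n: "0 < n"
      have "1 / real n * log 2 (E n) \<le> 1 / real n * (log 2 d2 + real n * (1 - ?K))"
        using l2[of n] by (intro mult_left_mono) auto
      also have "\<dots> = log 2 d2 * (1 / real n) + (1 - ?K)" using n by (simp add: field_simps)
      finally show "?K - 1 - log 2 d2 * (1 / real n) \<le> - (1 / real n) * log 2 (E n)" by simp
    qed
    show "\<forall>\<^sub>F n in sequentially. - (1 / real n) * log 2 (E n) \<le> ?K - 1 - log 2 d1 * (1 / real n)"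
      using eventually_gt_at_top[of 0]
    proof eventually_elim
      fix n :: nat assume n: "0 < n"
      have "1 / real n * (log 2 d1 + real n * (1 - ?K)) \<le> 1 / real n * log 2 (E n)"
        using l1[of n] by (intro mult_left_mono) auto
      moreover have "1 / real n * (log 2 d1 + real n * (1 - ?K)) = log 2 d1 * (1 / real n) + (1 - ?K)"
        using n by (simp add: field_simps)
      ultimately show "- (1 / real n) * log 2 (E n) \<le> ?K - 1 - log 2 d1 * (1 / real n)" by simp
    qed
  qed
  then have "(\<lambda>n. ereal (- (1 / real n) * log 2 (E n))) \<longlonglongrightarrow> ereal (?K - 1)" by (rule tendsto_ereal)
  from lim_imp_Liminf[OF _ this] show ?thesis unfolding renyi_T_def E_def by simp
qed

end

section \<open>The log-binomial scenario\<close>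

locale log_binomial = prob_space M for M :: "'w measure" +
  fixes N :: nat and p b :: real and X :: "nat \<Rightarrow> real \<Rightarrow> 'w \<Rightarrow> nat"
  assumes p: "0 < p" "p < 1"
    and proc: "\<And>j. stationary_bd_process N p M (X j)"
    and X_joint: "\<And>j. (\<lambda>(s, \<omega>). real (X j s \<omega>)) \<in> borel_measurable (lborel \<Otimes>\<^sub>M M)"
    and X_indep: "indep_vars (\<lambda>_. Pi\<^sub>M {0..} (\<lambda>_. count_space UNIV)) (\<lambda>j \<omega>. restrict (\<lambda>t. X j t \<omega>) {0..}) UNIV"
    and b_gt: "b > (p * (exp 2 - 1) + 1) ^ N / (p * (exp 1 - 1) + 1) ^ (2 * N)"
begin

section \<open>Moments and laws of a single layer\<close>

definition r :: real where "r = p * (exp 1 - 1) + 1"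
definition cX :: real where "cX = real N * ln r"
definition m2 :: real where "m2 = (p * (exp 2 - 1) + 1) ^ N / r ^ (2 * N)"

text \<open>Truncating the state at \<open>N\<close> changes the process only on null sets but makes it bounded everywhere.\<close>

definition layer :: "nat \<Rightarrow> real \<Rightarrow> 'w \<Rightarrow> real" where
  "layer j s \<omega> = exp (real (min (X j s \<omega>) N) - cX)"

lemma bd: "bd_process M N p (X j)"
  by unfold_locales (fact p proc)+

lemma r_pos: "0 < r"
  using p by (simp add: r_def add_pos_pos)

lemma exp_cX: "exp cX = r ^ N"
  using r_pos by (simp add: cX_def exp_of_nat_mult)

text \<open>The second moment dominates the square of the mean. For one site the difference is the
  variance of the exponential of a Bernoulli variable, and the N-th power covers N sites. This is
  the source of \<open>b > 1\<close>.\<close>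

lemma m2_ge_1: "1 \<le> m2"
proof -
  have e2: "exp 2 = (exp 1 :: real)\<^sup>2" by (simp flip: exp_double)
  have "p * (exp 2 - 1) + 1 - r\<^sup>2 = p * (1 - p) * (exp 1 - 1)\<^sup>2"
    unfolding e2 r_def by (simp add: power2_eq_square algebra_simps)
  moreover have "0 \<le> p * (1 - p) * (exp 1 - 1)\<^sup>2" using p by simp
  ultimately have "r\<^sup>2 \<le> p * (exp 2 - 1) + 1" by linarith
  then have "(r\<^sup>2) ^ N \<le> (p * (exp 2 - 1) + 1) ^ N" by (intro power_mono) auto
  then show ?thesis using r_pos by (simp add: m2_def power_mult)
qed

lemma b_gt_1: "1 < b"
  using m2_ge_1 b_gt by (simp add: m2_def r_def)

lemma X_measurable [measurable (raw)]:
  assumes [measurable]: "f \<in> borel_measurable A" "g \<in> A \<rightarrow>\<^sub>M M"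
  shows "(\<lambda>x. real (X j (f x) (g x))) \<in> borel_measurable A"
proof -
  have "(\<lambda>x. (f x, g x)) \<in> A \<rightarrow>\<^sub>M lborel \<Otimes>\<^sub>M M" by measurable
  from measurable_compose[OF this X_joint[of j]] show ?thesis by simp
qed

lemma layer_measurable [measurable (raw)]:
  assumes [measurable]: "f \<in> borel_measurable A" "g \<in> A \<rightarrow>\<^sub>M M"
  shows "(\<lambda>x. layer j (f x) (g x)) \<in> borel_measurable A"
  unfolding layer_def of_nat_min by measurable

lemma AE_layer:
  assumes "0 \<le> s"
  shows "AE \<omega> in M. layer j s \<omega> = exp (real (X j s \<omega>) - cX)"
  using bd_process.AE_state_le[OF bd[of j] assms] by eventually_elim (simp add: layer_def min_absorb1)

lemma expectation_layer_powr:
  assumes "0 \<le> s"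
  shows "expectation (\<lambda>\<omega>. layer j s \<omega> powr q) = exp (- q * cX) * (p * (exp q - 1) + 1) ^ N"
proof -
  have "expectation (\<lambda>\<omega>. layer j s \<omega> powr q) = expectation (\<lambda>\<omega>. exp (- q * cX) * exp (q * real (X j s \<omega>)))"
  proof (rule integral_cong_AE)
    show "AE \<omega> in M. layer j s \<omega> powr q = exp (- q * cX) * exp (q * real (X j s \<omega>))"
      using AE_layer[OF assms, of j]
      by eventually_elim (simp add: powr_def algebra_simps flip: exp_add)
  qed measurable
  also have "\<dots> = exp (- q * cX) * (p * (exp q - 1) + 1) ^ N"
    using bd_process.expectation_exp_state[OF bd assms] by simp
  finally show ?thesis .
qed

lemma layer_pos: "0 < layer j s \<omega>"
  by (simp add: layer_def)

lemma layer_bounds: "exp (- cX) \<le> layer j s \<omega>" "layer j s \<omega> \<le> exp (real N - cX)"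
  by (simp_all add: layer_def)

lemma expectation_layer: "0 \<le> s \<Longrightarrow> expectation (layer j s) = 1"
  using expectation_layer_powr[of s j 1] exp_cX r_pos
  by (simp add: exp_minus r_def[symmetric] abs_of_pos[OF layer_pos])

lemma layer_sq: "layer j s \<omega> * layer j s \<omega> = layer j s \<omega> powr 2"
  using layer_pos[of j s \<omega>] by (simp add: power2_eq_square)

lemma expectation_layer_sq: "0 \<le> s \<Longrightarrow> expectation (\<lambda>\<omega>. layer j s \<omega> * layer j s \<omega>) = m2"
proof -
  assume s: "0 \<le> s"
  have "exp (- 2 * cX) = 1 / r ^ (2 * N)"
    by (simp add: exp_minus exp_double exp_cX power_even_eq inverse_eq_divide)
  then show ?thesis unfolding layer_sq expectation_layer_powr[OF s] by (simp add: m2_def)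
qed

lemma layer_mult_integrable: "integrable M (\<lambda>\<omega>. layer j s \<omega> * layer j t \<omega>)"
proof (rule integrable_const_bound[where B="exp (real N - cX) * exp (real N - cX)"])
  show "AE \<omega> in M. norm (layer j s \<omega> * layer j t \<omega>) \<le> exp (real N - cX) * exp (real N - cX)"
    using layer_bounds(2) layer_pos by (intro AE_I2) (auto simp: abs_mult less_imp_le intro!: mult_mono)
qed measurable

lemma layer_second_moment:
  assumes "0 \<le> s" "0 \<le> t"
  shows "expectation (\<lambda>\<omega>. layer j s \<omega> * layer j t \<omega>) \<le> m2"
proof -
  have "expectation (\<lambda>\<omega>. layer j s \<omega> * layer j t \<omega>)
      \<le> expectation (\<lambda>\<omega>. (layer j s \<omega> * layer j s \<omega> + layer j t \<omega> * layer j t \<omega>) / 2)"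
  proof (intro integral_mono)
    show "layer j s \<omega> * layer j t \<omega> \<le> (layer j s \<omega> * layer j s \<omega> + layer j t \<omega> * layer j t \<omega>) / 2" for \<omega>
      using zero_le_power2[of "layer j s \<omega> - layer j t \<omega>"] by (simp add: power2_eq_square algebra_simps)
  qed (use layer_mult_integrable in auto)
  also have "\<dots> = m2" using assms by (simp add: layer_mult_integrable expectation_layer_sq)
  finally show ?thesis .
qed

lemma layer_covariance:
  obtains C where "\<And>j s t. 0 \<le> s \<Longrightarrow> 0 \<le> t \<Longrightarrow>
    \<bar>expectation (\<lambda>\<omega>. layer j s \<omega> * layer j t \<omega>) - 1\<bar> \<le> C * exp (- \<bar>s - t\<bar>)"
proof -
  obtain C where C: "0 \<le> C" "\<And>s t. 0 \<le> s \<Longrightarrow> s \<le> t \<Longrightarrow>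
    \<bar>expectation (\<lambda>\<omega>. exp (real (X 0 s \<omega>)) * exp (real (X 0 t \<omega>))) - r ^ (2 * N)\<bar> \<le> C * exp (- (t - s))"
    by (rule bd_process.exp_covariance_decay[OF bd[of 0], folded r_def]) blast
  have main: "\<bar>expectation (\<lambda>\<omega>. layer j s \<omega> * layer j t \<omega>) - 1\<bar> \<le> C / r ^ (2 * N) * exp (- \<bar>s - t\<bar>)"
    if st: "0 \<le> s" "s \<le> t" for j s t
  proof -
    have e: "exp (- cX) * exp (- cX) = 1 / r ^ (2 * N)"
      by (simp add: exp_minus exp_cX inverse_eq_divide mult_2 power_add)
    have "expectation (\<lambda>\<omega>. layer j s \<omega> * layer j t \<omega>)
        = expectation (\<lambda>\<omega>. 1 / r ^ (2 * N) * (exp (real (X j s \<omega>)) * exp (real (X j t \<omega>))))"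
    proof (rule integral_cong_AE)
      show "AE \<omega> in M. layer j s \<omega> * layer j t \<omega> = 1 / r ^ (2 * N) * (exp (real (X j s \<omega>)) * exp (real (X j t \<omega>)))"
        unfolding e[symmetric] using AE_layer[OF st(1), of j] AE_layer[OF order_trans[OF st], of j]
        by eventually_elim (simp add: exp_diff exp_minus divide_inverse ac_simps)
    qed (use st in measurable)
    also have "\<dots> = 1 / r ^ (2 * N) * expectation (\<lambda>\<omega>. exp (real (X j s \<omega>)) * exp (real (X j t \<omega>)))"
      by simp
    \<comment> \<open>Two-time expectations are the same for all copies, so the constant obtained
      for \<open>X 0\<close> serves every layer.\<close>
    also have "expectation (\<lambda>\<omega>. exp (real (X j s \<omega>)) * exp (real (X j t \<omega>)))
        = expectation (\<lambda>\<omega>. exp (real (X 0 s \<omega>)) * exp (real (X 0 t \<omega>)))"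
      using bd_process.expectation_two_states[OF bd st, of "\<lambda>i k. exp (real i) * exp (real k)"] by simp
    finally have "expectation (\<lambda>\<omega>. layer j s \<omega> * layer j t \<omega>) - 1
        = (expectation (\<lambda>\<omega>. exp (real (X 0 s \<omega>)) * exp (real (X 0 t \<omega>))) - r ^ (2 * N)) / r ^ (2 * N)"
      using r_pos by (simp add: diff_divide_distrib)
    then have "\<bar>expectation (\<lambda>\<omega>. layer j s \<omega> * layer j t \<omega>) - 1\<bar>
        = \<bar>expectation (\<lambda>\<omega>. exp (real (X 0 s \<omega>)) * exp (real (X 0 t \<omega>))) - r ^ (2 * N)\<bar> / r ^ (2 * N)"
      using r_pos by simp
    also have "\<dots> \<le> C * exp (- (t - s)) / r ^ (2 * N)"
      using C(2)[OF st] r_pos by (intro divide_right_mono) auto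
    finally show ?thesis using st by simp
  qed
  show ?thesis
  proof (rule that)
    fix j :: nat and s t :: real assume "0 \<le> s" "0 \<le> t"
    then show "\<bar>expectation (\<lambda>\<omega>. layer j s \<omega> * layer j t \<omega>) - 1\<bar> \<le> C / r ^ (2 * N) * exp (- \<bar>s - t\<bar>)"
      using main[of s t j] main[of t s j] by (cases "s \<le> t") (auto simp: mult.commute abs_minus_commute)
  qed
qed

lemma layer_change:
  obtains C where "\<And>j s t. 0 \<le> s \<Longrightarrow> 0 \<le> t \<Longrightarrow>
    prob {\<omega> \<in> space M. layer j s \<omega> \<noteq> layer j t \<omega>} \<le> C * \<bar>s - t\<bar>"
proof -
  define C where "C = real (Suc N) * real N"
  have main: "prob {\<omega> \<in> space M. layer j s \<omega> \<noteq> layer j t \<omega>} \<le> (1 + C * exp C) * \<bar>s - t\<bar>"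
    if st: "0 \<le> s" "s \<le> t" for j s t
  proof -
    have "{\<omega> \<in> space M. real (X j s \<omega>) \<noteq> real (X j t \<omega>)} \<in> events" by measurable
    then have "prob {\<omega> \<in> space M. layer j s \<omega> \<noteq> layer j t \<omega>} \<le> prob {\<omega> \<in> space M. X j s \<omega> \<noteq> X j t \<omega>}"
      by (intro finite_measure_mono) (auto simp: layer_def)
    also have "\<dots> \<le> (1 + C * exp C) * (t - s)"
      using bd_process.prob_state_change[OF bd st] by (simp add: C_def)
    finally show ?thesis using st by simp
  qed
  have "prob {\<omega> \<in> space M. layer j s \<omega> \<noteq> layer j t \<omega>} \<le> (1 + C * exp C) * \<bar>s - t\<bar>"
    if *: "0 \<le> s" "0 \<le> t" for j s t
  proof -
    have "{\<omega> \<in> space M. layer j s \<omega> \<noteq> layer j t \<omega>} = {\<omega> \<in> space M. layer j t \<omega> \<noteq> layer j s \<omega>}" by auto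
    then show ?thesis
      using main[of s t j] main[of t s j] * by (cases "s \<le> t") (auto simp: abs_minus_commute)
  qed
  then show ?thesis by (rule that)
qed

lemma layer_law:
  assumes "0 \<le> \<alpha>" "0 \<le> \<beta>" "0 < k"
  shows "distr M (Pi\<^sub>M {..<k} (\<lambda>_. borel)) (\<lambda>\<omega>. \<lambda>i\<in>{..<k}. layer j (\<alpha> + \<beta> * real i) \<omega>)
      = distr M (Pi\<^sub>M {..<k} (\<lambda>_. borel)) (\<lambda>\<omega>. \<lambda>i\<in>{..<k}. layer 0 (\<beta> * real i) \<omega>)"
proof -
  let ?C = "Pi\<^sub>M {..<k} (\<lambda>_. count_space (UNIV :: nat set))" and ?B = "Pi\<^sub>M {..<k} (\<lambda>_. borel :: real measure)"
  define h where "h v = (\<lambda>i\<in>{..<k}. exp (real (min (v i) N) - cX))" for v :: "nat \<Rightarrow> nat"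
  have h: "h \<in> ?C \<rightarrow>\<^sub>M ?B"
    unfolding h_def
    by (intro measurable_restrict measurable_compose[OF measurable_component_singleton]) auto
  have g: "(\<lambda>\<omega>. \<lambda>i\<in>{..<k}. X j (a + \<beta> * real i) \<omega>) \<in> M \<rightarrow>\<^sub>M ?C" if "0 \<le> a" for j a
    using that assms bd_process.measurable_state[OF bd] by (intro measurable_restrict) auto
  have e: "distr M ?B (\<lambda>\<omega>. \<lambda>i\<in>{..<k}. layer j (a + \<beta> * real i) \<omega>)
      = distr (distr M ?C (\<lambda>\<omega>. \<lambda>i\<in>{..<k}. X j (a + \<beta> * real i) \<omega>)) ?B h" if "0 \<le> a" for j a
    by (subst distr_distr[OF h g[OF that]])
      (intro distr_cong refl, auto simp: h_def layer_def fun_eq_iff)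
  show ?thesis
    using e[OF assms(1), of j] e[OF order_refl, of 0] distr_grid_eq[OF bd bd assms, of j 0] by simp
qed

lemma layer_indep: "indep_vars (\<lambda>_. Pi\<^sub>M {0..} (\<lambda>_. borel)) (\<lambda>j \<omega>. \<lambda>t\<in>{0..}. layer j t \<omega>) UNIV"
proof -
  have "indep_vars (\<lambda>_. Pi\<^sub>M {0..} (\<lambda>_. borel))
      (\<lambda>j \<omega>. (\<lambda>t\<in>{0..}. exp (real (min (restrict (\<lambda>t. X j t \<omega>) {0..} t) N) - cX))) UNIV"
    by (rule indep_vars_compose2[OF X_indep, where Y="\<lambda>j x. \<lambda>t\<in>{0..}. exp (real (min (x t) N) - cX)"])
      (intro measurable_restrict measurable_compose[OF measurable_component_singleton], auto)
  also have "(\<lambda>j \<omega>. (\<lambda>t\<in>{0..}. exp (real (min (restrict (\<lambda>t. X j t \<omega>) {0..} t) N) - cX)))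
      = (\<lambda>j \<omega>. \<lambda>t\<in>{0..}. layer j t \<omega>)"
    by (auto simp: fun_eq_iff layer_def)
  finally show ?thesis .
qed

lemma cascade_layer:
  obtains C1 C2 where "cascade M layer b (exp (- cX)) (exp (real N - cX)) m2 C1 C2"
proof -
  obtain C1 where C1: "\<And>j s t. 0 \<le> s \<Longrightarrow> 0 \<le> t \<Longrightarrow>
    \<bar>expectation (\<lambda>\<omega>. layer j s \<omega> * layer j t \<omega>) - 1\<bar> \<le> C1 * exp (- \<bar>s - t\<bar>)"
    by (rule layer_covariance) blast
  obtain C2 where C2: "\<And>j s t. 0 \<le> s \<Longrightarrow> 0 \<le> t \<Longrightarrow>
    prob {\<omega> \<in> space M. layer j s \<omega> \<noteq> layer j t \<omega>} \<le> C2 * \<bar>s - t\<bar>"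
    by (rule layer_change) blast
  have "cascade M layer b (exp (- cX)) (exp (real N - cX)) m2 C1 C2"
  proof unfold_locales
    show "(\<lambda>x. layer j (fst x) (snd x)) \<in> borel_measurable (borel \<Otimes>\<^sub>M M)" for j by measurable
    show "m2 < b" using b_gt by (simp add: m2_def r_def)
  qed (fact exp_gt_zero layer_bounds b_gt_1 layer_indep layer_law expectation_layer layer_second_moment C1 C2)+
  then show ?thesis by (rule that)
qed

section \<open>Return to the original density\<close>

text \<open>At each fixed time truncation changes nothing almost surely, but the null set depends on
  the time. Fubini exchanges the quantifiers, and the countably many layers are then
  intersected.\<close>

lemma AE_density:
  "AE \<omega> in M. AE s in lborel. 0 \<le> s \<longrightarrow> (\<forall>n. (\<Prod>j\<le>n. layer (0 + j) (s * b ^ j) \<omega>) = mf_density cX X b n s \<omega>)"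
proof -
  interpret pair_sigma_finite lborel M ..
  have "AE \<omega> in M. AE s in lborel. 0 \<le> s \<longrightarrow> layer j (s * b ^ j) \<omega> = exp (real (X j (s * b ^ j) \<omega>) - cX)" for j
  proof -
    define P where "P s \<omega> \<longleftrightarrow> (0 \<le> s \<longrightarrow> layer j (s * b ^ j) \<omega> = exp (real (X j (s * b ^ j) \<omega>) - cX))" for s \<omega>
    have "{x \<in> space (lborel \<Otimes>\<^sub>M M). P (fst x) (snd x)} \<in> sets (lborel \<Otimes>\<^sub>M M)"
      unfolding P_def by measurable
    then have "(AE s in lborel. AE \<omega> in M. P s \<omega>) \<longleftrightarrow> (AE \<omega> in M. AE s in lborel. P s \<omega>)"
      by (rule AE_commute)
    moreover have "AE s in lborel. AE \<omega> in M. P s \<omega>"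
    proof (rule AE_I2)
      fix s
      show "AE \<omega> in M. P s \<omega>"
        unfolding P_def using AE_layer[of "s * b ^ j" j] b_gt_1 by (cases "0 \<le> s") auto
    qed
    ultimately show ?thesis unfolding P_def by blast
  qed
  then have "AE \<omega> in M. \<forall>j. AE s in lborel. 0 \<le> s \<longrightarrow> layer j (s * b ^ j) \<omega> = exp (real (X j (s * b ^ j) \<omega>) - cX)"
    by (simp add: AE_all_countable)
  then show ?thesis
  proof eventually_elim
    fix \<omega> assume "\<forall>j. AE s in lborel. 0 \<le> s \<longrightarrow> layer j (s * b ^ j) \<omega> = exp (real (X j (s * b ^ j) \<omega>) - cX)"
    then have "AE s in lborel. \<forall>j. 0 \<le> s \<longrightarrow> layer j (s * b ^ j) \<omega> = exp (real (X j (s * b ^ j) \<omega>) - cX)"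
      unfolding AE_all_countable .
    then show "AE s in lborel. 0 \<le> s \<longrightarrow> (\<forall>n. (\<Prod>j\<le>n. layer (0 + j) (s * b ^ j) \<omega>) = mf_density cX X b n s \<omega>)"
      by eventually_elim (simp add: mf_density_def)
  qed
qed

lemma mf_density_measurable [measurable (raw)]:
  assumes [measurable]: "f \<in> borel_measurable A" "g \<in> A \<rightarrow>\<^sub>M M"
  shows "(\<lambda>x. mf_density cX X b n (f x) (g x)) \<in> borel_measurable A"
  unfolding mf_density_def by measurable

lemma A_n_measurable: "A_n cX X b n t \<in> borel_measurable M"
  unfolding A_n_def
proof (rule lborel.borel_measurable_lebesgue_integral)
  show "(\<lambda>(\<omega>, s). indicator {0..t} s * mf_density cX X b n s \<omega>) \<in> borel_measurable (M \<Otimes>\<^sub>M lborel)"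
    unfolding split_beta' by measurable
qed

end

theorem theorem4:
  fixes M :: "'w measure" and N :: nat and p b :: real
    and X :: "nat \<Rightarrow> real \<Rightarrow> 'w \<Rightarrow> nat"
  defines "cX \<equiv> real N * ln (p * (exp 1 - 1) + 1)"
  defines "K \<equiv> (\<lambda>q::real. q * (1 + cX / ln b) - real N / ln b * ln (p * (exp q - 1) + 1))"
  assumes "prob_space M"
    and "N \<ge> 1" and "0 < p" and "p < 1"
    and proc: "\<And>j. stationary_bd_process N p M (X j)"
    and meas: "\<And>j. (\<lambda>(s, \<omega>). real (X j s \<omega>)) \<in> borel_measurable (lborel \<Otimes>\<^sub>M M)"
    and indep: "prob_space.indep_vars M (\<lambda>_. Pi\<^sub>M {0..} (\<lambda>_. count_space UNIV))
                  (\<lambda>j \<omega>. restrict (\<lambda>t. X j t \<omega>) {0..}) UNIV"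
    and b: "b > (p * (exp 2 - 1) + 1) ^ N / (p * (exp 1 - 1) + 1) ^ (2 * N)"
  shows "\<exists>A :: real \<Rightarrow> 'w \<Rightarrow> real.
     (\<forall>t\<in>{0..1}. A t \<in> borel_measurable M \<and> integrable M (\<lambda>\<omega>. (A t \<omega>)\<^sup>2) \<and>
        (\<lambda>n. \<integral>\<omega>. (A_n cX X b n t \<omega> - A t \<omega>)\<^sup>2 \<partial>M) \<longlonglongrightarrow> 0) \<and>
     (\<forall>q>0. integrable M (\<lambda>\<omega>. \<bar>A 1 \<omega>\<bar> powr q) \<longrightarrow>
        (\<exists>Cl Cu. 0 < Cl \<and> Cl \<le> Cu \<and>
           (\<forall>t\<in>{0..1}. Cl * t powr K q \<le> (\<integral>\<omega>. A t \<omega> powr q \<partial>M) \<and>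
                        (\<integral>\<omega>. A t \<omega> powr q \<partial>M) \<le> Cu * t powr K q)) \<and>
        (\<forall>mu. is_as_weak_limit M cX X b mu \<longrightarrow> renyi_T M mu q = ereal (K q - 1)))"
proof -
  interpret prob_space M by fact
  interpret log: log_binomial M N p b X
    by unfold_locales (use assms in auto)
  obtain C1 C2 where "cascade M log.layer b (exp (- log.cX)) (exp (real N - log.cX)) log.m2 C1 C2"
    by (rule log.cascade_layer)
  then interpret cascade M log.layer b "exp (- log.cX)" "exp (real N - log.cX)" log.m2 C1 C2 .
  have cX: "cX = log.cX" by (simp add: cX_def log.cX_def log.r_def)
  have density: "AE \<omega> in M. AE s in lborel. 0 \<le> s \<longrightarrow> (\<forall>n. den 0 n s \<omega> = mf_density cX X b n s \<omega>)"
    using log.AE_density unfolding den_def cX .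
  have A_n: "AE \<omega> in M. A_n cX X b n t \<omega> = mass 0 n 0 t \<omega>" for n t
    using density AE_space
  proof eventually_elim
    fix \<omega> assume d: "AE s in lborel. 0 \<le> s \<longrightarrow> (\<forall>n. den 0 n s \<omega> = mf_density cX X b n s \<omega>)" and \<omega>: "\<omega> \<in> space M"
    show "A_n cX X b n t \<omega> = mass 0 n 0 t \<omega>"
      unfolding A_n_def mass_def
    proof (rule integral_cong_AE)
      show "AE s in lborel. indicator {0..t} s * mf_density cX X b n s \<omega> = indicator {0..t} s * den 0 n s \<omega>"
        using d by eventually_elim (auto simp: indicator_def)
    qed (use \<omega> in \<open>simp_all add: cX\<close>)
  qed
  have L2: "lmass 0 t \<in> borel_measurable M \<and> integrable M (\<lambda>\<omega>. (lmass 0 t \<omega>)\<^sup>2) \<and>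
      (\<lambda>n. \<integral>\<omega>. (A_n cX X b n t \<omega> - lmass 0 t \<omega>)\<^sup>2 \<partial>M) \<longlonglongrightarrow> 0" if t: "t \<in> {0..1}" for t
  proof -
    have t0: "0 \<le> t" using t by simp
    have [measurable]: "lmass 0 t \<in> borel_measurable M" by (rule lmass_measurable[OF order_refl t0])
    have [measurable]: "A_n cX X b n t \<in> borel_measurable M" for n
      unfolding cX by (rule log.A_n_measurable)
    have "(\<integral>\<omega>. (A_n cX X b n t \<omega> - lmass 0 t \<omega>)\<^sup>2 \<partial>M) = (\<integral>\<omega>. (mass 0 n 0 t \<omega> - lmass 0 t \<omega>)\<^sup>2 \<partial>M)" for n
    proof (rule integral_cong_AE)
      show "AE \<omega> in M. (A_n cX X b n t \<omega> - lmass 0 t \<omega>)\<^sup>2 = (mass 0 n 0 t \<omega> - lmass 0 t \<omega>)\<^sup>2"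
        using A_n[of n t] by eventually_elim simp
    qed measurable
    then show ?thesis
      using mass_tendsto_L2[OF order_refl t0] lmass_sq_integrable[OF order_refl t0] by simp
  qed
  have K: "Kexp q = K q" if "q > 0" for q
  proof -
    have pos: "0 < p * (exp q - 1) + 1" using assms that by (simp add: add_pos_pos)
    \<comment> \<open>The logarithm of the binomial moment generating function, normalised by
      \<open>cX\<close>; inserted into \<open>Kexp\<close> it gives the stated exponent.\<close>
    have "ln (kap q) = - q * cX + real N * ln (p * (exp q - 1) + 1)"
      unfolding kap_def log.expectation_layer_powr[OF order_refl] cX
      using pos by (simp add: ln_mult ln_realpow)
    then show ?thesis unfolding Kexp_def K_def by (simp add: diff_divide_distrib distrib_left)
  qed
  have moments: "(\<exists>Cl Cu. 0 < Cl \<and> Cl \<le> Cu \<and>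
           (\<forall>t\<in>{0..1}. Cl * t powr K q \<le> (\<integral>\<omega>. lmass 0 t \<omega> powr q \<partial>M) \<and>
                        (\<integral>\<omega>. lmass 0 t \<omega> powr q \<partial>M) \<le> Cu * t powr K q)) \<and>
        (\<forall>mu. is_as_weak_limit M cX X b mu \<longrightarrow> renyi_T M mu q = ereal (K q - 1))"
    if q: "q > 0" and "integrable M (\<lambda>\<omega>. \<bar>lmass 0 1 \<omega>\<bar> powr q)" for q
  proof (intro conjI allI impI)
    have Lq: "integrable M (\<lambda>\<omega>. lmass 0 1 \<omega> powr q)" using that by (simp add: lmass_nonneg)
    obtain c1 c2 where "0 < c1" "c1 \<le> c2"
      "\<And>t. 0 \<le> t \<Longrightarrow> t \<le> 1 \<Longrightarrow> c1 * t powr Kexp q \<le> mom q t"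
      "\<And>t. 0 \<le> t \<Longrightarrow> t \<le> 1 \<Longrightarrow> mom q t \<le> c2 * t powr Kexp q"
      using mom_bounds[OF q Lq] by metis
    then show "\<exists>Cl Cu. 0 < Cl \<and> Cl \<le> Cu \<and>
           (\<forall>t\<in>{0..1}. Cl * t powr K q \<le> (\<integral>\<omega>. lmass 0 t \<omega> powr q \<partial>M) \<and>
                        (\<integral>\<omega>. lmass 0 t \<omega> powr q \<partial>M) \<le> Cu * t powr K q)"
      unfolding K[OF q] mom_def by (intro exI[of _ c1] exI[of _ c2]) auto
    fix mu assume mu: "is_as_weak_limit M cX X b mu"
    interpret cascade_weak_limit M log.layer b "exp (- log.cX)" "exp (real N - log.cX)" log.m2 C1 C2 mu
    proof (intro cascade_weak_limit.intro cascade_weak_limit_axioms.intro)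
      show "cascade M log.layer b (exp (- log.cX)) (exp (real N - log.cX)) log.m2 C1 C2" by unfold_locales
      show "finite_measure (mu \<omega>)" "sets (mu \<omega>) = sets borel" for \<omega>
        using mu by (auto simp: is_as_weak_limit_def)
      show "(\<lambda>\<omega>. measure (mu \<omega>) {x..y}) \<in> borel_measurable M" for x y
        using mu by (auto simp: is_as_weak_limit_def)
      have "AE \<omega> in M. \<forall>f. continuous_on {0..1} f \<longrightarrow>
        (\<lambda>n. \<integral>s. indicator {0..1} s * f s * mf_density cX X b n s \<omega> \<partial>lborel)
          \<longlonglongrightarrow> (\<integral>s. indicator {0..1} s * f s \<partial>mu \<omega>)"
        using mu by (auto simp: is_as_weak_limit_def)
      then show "AE \<omega> in M. weak_conv (mu \<omega>) \<omega>"
        using density AE_space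
      proof eventually_elim
        fix \<omega> assume w: "\<forall>f. continuous_on {0..1} f \<longrightarrow>
            (\<lambda>n. \<integral>s. indicator {0..1} s * f s * mf_density cX X b n s \<omega> \<partial>lborel)
              \<longlonglongrightarrow> (\<integral>s. indicator {0..1} s * f s \<partial>mu \<omega>)"
          and d: "AE s in lborel. 0 \<le> s \<longrightarrow> (\<forall>n. den 0 n s \<omega> = mf_density cX X b n s \<omega>)"
          and \<omega>: "\<omega> \<in> space M"
        have "(\<integral>s. indicator {0..1} s * f s * mf_density cX X b n s \<omega> \<partial>lborel)
            = (\<integral>s. indicator {0..1} s * f s * den 0 n s \<omega> \<partial>lborel)" if f: "continuous_on {0..1} f" for f n
        proof (rule integral_cong_AE)
          \<comment> \<open>\<open>f\<close> is continuous on the unit interval only and may be wild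
            elsewhere, so measurability is obtained for its product with the indicator.\<close>
          have [measurable]: "(\<lambda>s. indicator {0..1} s * f s) \<in> borel_measurable borel"
            using borel_measurable_continuous_on_indicator[OF _ f] by simp
          show "(\<lambda>s. indicator {0..1} s * f s * mf_density cX X b n s \<omega>) \<in> borel_measurable lborel"
            "(\<lambda>s. indicator {0..1} s * f s * den 0 n s \<omega>) \<in> borel_measurable lborel"
            using \<omega> unfolding cX by measurable
          show "AE s in lborel. indicator {0..1} s * f s * mf_density cX X b n s \<omega>
              = indicator {0..1} s * f s * den 0 n s \<omega>"
            using d by eventually_elim (auto simp: indicator_def)
        qed
        then show "weak_conv (mu \<omega>) \<omega>"
          using w by simp
      qed
    qed
    show "renyi_T M mu q = ereal (K q - 1)" using renyi_eq[OF q Lq] K[OF q] by simp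
  qed
  show ?thesis using L2 moments by (intro exI[of _ "lmass 0"]) auto
qed

end
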